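(* Let $f$ be a transcendental entire function that is geometrically finite and has finite order. Then for every repelling or parabolic periodic point $z$ of $f$ there is a periodic ray of $f$ landing at $z$.
   Context: For a transcendental entire function $f$: $S(f)$ is the closure of the set of finite critical and asymptotic values of $f$; the postsingular set is $P(f)=\overline{\bigcup_{n\ge0}f^n(S(f))}$; ${\mathcal F}(f)$ and ${\mathcal J}(f)$ are the Fatou and Julia sets. $f$ is called geometrically finite if $S(f)\cap{\mathcal F}(f)$ is compact and $P(f)\cap{\mathcal J}(f)$ is finite. $f$ has finite order if $\log\log|f(z)|=O(\log|z|)$ as $z\to\infty$. A periodic ray of $f$ is an injective curve $g:(0,\infty)\to\mathbb C$ with $\lim_{t\to\infty}g(t)=\infty$ such that there is $n\ge1$ with $g(2t)=f^n(g(t))$ for all $t>0$. It lands at $z_0$ if $\lim_{t\to0}g(t)=z_0$. A periodic point $z$ of minimal period $n$ is repelling if $|(f^n)'(z)|>1$ and parabolic if $(f^n)'(z)$ is a root of unity. *)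

theory Defs
  imports "HOL-Analysis.Analysis" "HOL-Computational_Algebra.Polynomial"
begin

definition transcendental_entire :: "(complex \<Rightarrow> complex) \<Rightarrow> bool" where
  "transcendental_entire f \<longleftrightarrow> f holomorphic_on UNIV \<and> \<not> (\<exists>p. \<forall>z. f z = poly p z)"

definition normal_family :: "complex set \<Rightarrow> (complex \<Rightarrow> complex) set \<Rightarrow> bool" where
  "normal_family U F \<longleftrightarrow>
     (\<forall>s::nat \<Rightarrow> complex \<Rightarrow> complex. (\<forall>k. s k \<in> F) \<longrightarrow>
        (\<exists>r. strict_mono r \<and>
           ((\<exists>g. \<forall>K. compact K \<and> K \<subseteq> U \<longrightarrow> uniform_limit K (\<lambda>k. s (r k)) g sequentially)
            \<or> (\<forall>K. compact K \<and> K \<subseteq> U \<longrightarrow>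
                 (\<forall>M. eventually (\<lambda>k. \<forall>z\<in>K. norm (s (r k) z) \<ge> M) sequentially)))))"

definition fatou_set :: "(complex \<Rightarrow> complex) \<Rightarrow> complex set" where
  "fatou_set f = {z. \<exists>U. open U \<and> z \<in> U \<and> normal_family U (range (\<lambda>n. f ^^ n))}"

definition julia_set :: "(complex \<Rightarrow> complex) \<Rightarrow> complex set" where
  "julia_set f = - fatou_set f"

definition critical_values :: "(complex \<Rightarrow> complex) \<Rightarrow> complex set" where
  "critical_values f = {f z | z. deriv f z = 0}"

definition asymptotic_values :: "(complex \<Rightarrow> complex) \<Rightarrow> complex set" where
  "asymptotic_values f = {a. \<exists>\<gamma>::real \<Rightarrow> complex. continuous_on {0..} \<gamma> \<and>
        filterlim \<gamma> at_infinity at_top \<and> ((\<lambda>t. f (\<gamma> t)) \<longlongrightarrow> a) at_top}"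

definition singular_set :: "(complex \<Rightarrow> complex) \<Rightarrow> complex set" where
  "singular_set f = closure (critical_values f \<union> asymptotic_values f)"

definition postsingular_set :: "(complex \<Rightarrow> complex) \<Rightarrow> complex set" where
  "postsingular_set f = closure (\<Union>n. (f ^^ n) ` singular_set f)"

definition geometrically_finite :: "(complex \<Rightarrow> complex) \<Rightarrow> bool" where
  "geometrically_finite f \<longleftrightarrow>
     compact (singular_set f \<inter> fatou_set f) \<and> finite (postsingular_set f \<inter> julia_set f)"

text \<open>Finite order: log log |f(z)| = O(log |z|) as z \<rightarrow> \<infinity> (upper bound; only meaningful where |f z| > e).\<close>
definition finite_order :: "(complex \<Rightarrow> complex) \<Rightarrow> bool" where
  "finite_order f \<longleftrightarrow> (\<exists>C R. \<forall>z. norm z > R \<and> norm (f z) > exp 1 \<longrightarrow>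
       ln (ln (norm (f z))) \<le> C * ln (norm z))"

definition periodic_ray :: "(complex \<Rightarrow> complex) \<Rightarrow> (real \<Rightarrow> complex) \<Rightarrow> bool" where
  "periodic_ray f g \<longleftrightarrow> continuous_on {0<..} g \<and> inj_on g {0<..} \<and>
     filterlim g at_infinity at_top \<and>
     (\<exists>n\<ge>1. \<forall>t>0. g (2 * t) = (f ^^ n) (g t))"

definition lands_at :: "(real \<Rightarrow> complex) \<Rightarrow> complex \<Rightarrow> bool" where
  "lands_at g z0 \<longleftrightarrow> (g \<longlongrightarrow> z0) (at_right 0)"

definition minimal_period :: "(complex \<Rightarrow> complex) \<Rightarrow> complex \<Rightarrow> nat \<Rightarrow> bool" where
  "minimal_period f z n \<longleftrightarrow> n \<ge> 1 \<and> (f ^^ n) z = z \<and> (\<forall>m. 0 < m \<and> m < n \<longrightarrow> (f ^^ m) z \<noteq> z)"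

definition repelling_periodic :: "(complex \<Rightarrow> complex) \<Rightarrow> complex \<Rightarrow> bool" where
  "repelling_periodic f z \<longleftrightarrow> (\<exists>n. minimal_period f z n \<and> norm (deriv (f ^^ n) z) > 1)"

definition parabolic_periodic :: "(complex \<Rightarrow> complex) \<Rightarrow> complex \<Rightarrow> bool" where
  "parabolic_periodic f z \<longleftrightarrow>
     (\<exists>n. minimal_period f z n \<and> (\<exists>k::nat. k \<ge> 1 \<and> (deriv (f ^^ n) z) ^ k = 1))"

end

theory Submission
  imports Defs "HOL-Complex_Analysis.Complex_Analysis" "HOL-Real_Asymp.Real_Asymp"
begin

text \<open>
  Let \<open>F\<close> be an iterate of \<open>f\<close> fixing \<open>z\<close> with multiplier of modulus greater than 1 or equal to 1. Outside a
  disc containing the bounded postsingular set, \<open>exp\<close> can be lifted through \<open>F\<close> indefinitely. A leaf is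
  an infinite sequence of such lifts \<open>V n\<close> on a right half-plane, \<open>F \<circ> V (n + 1) = V n\<close>; we use leaves
  that converge to \<open>z\<close>. Dropping the first lift and passing to logarithmic coordinates sends a leaf to another leaf. By
  Bloch's theorem the lifts are Lipschitz after taking logarithms, and a Montel argument (an escaping orbit
  cannot return) shows that late lifts contract. Hence the number of steps a leaf needs
  to get close to \<open>z\<close> stays bounded under this operation. Up to translation by multiples of \<open>2\<pi>i\<close> only finitely many leaves
  satisfy a given bound, so some leaf is periodic. Its exponential coordinates contain a curve to
  infinity that the dynamics maps into itself: finite order makes the inverse branches follow the
  model \<open>t \<mapsto> exp t\<close> up to bounded hyperbolic distance, and they contract. Pulling this curve back along
  the periodic leaf gives a ray, which lands at \<open>z\<close> because the leaf converges to \<open>z\<close>.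
\<close>

section \<open>Lifting through an entire function\<close>

text \<open>Geometric finiteness says little about forward orbits of singular values in the Fatou
  set, so boundedness of the postsingular set has to be proved first; the key is that orbits
  remaining far out belong to the Julia set. The half-plane \<open>rhp \<rho>\<close> is the
  universal cover of the exterior of a disc: being simply connected it carries global lifts, and a
  lift is fixed by one value. All hyperbolic estimates are replaced by a single bound: a logarithm
  \<open>L\<close> of an injective map on \<open>rhp a\<close> satisfies
  \<open>norm (deriv L x) \<le> 12 * pi / (Re x - a)\<close>. Finite order is used for one purpose,
  the lower bound on the real part of inverse branches, which sends the pulled-back curves to
  infinity. A parabolic point has attracting petals, so no neighbourhood is contracted by the local
  inverse; but leaf values always have orbits that leave, and contraction is demanded of such points
  alone. This lets one argument serve repelling and parabolic points. The slack factor
  \<open>1 + \<epsilon>\<close> in the radii is what keeps the step count of a leaf from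
  growing.\<close>

lemma lift_unique:
  fixes h :: "complex \<Rightarrow> complex" and u v :: "'a::topological_space \<Rightarrow> complex"
  assumes X: "connected X" "continuous_on X u" "continuous_on X v"
    and h: "h holomorphic_on UNIV"
    and eq: "\<And>x. x \<in> X \<Longrightarrow> h (u x) = h (v x)"
    and nz: "\<And>x. x \<in> X \<Longrightarrow> deriv h (u x) \<noteq> 0"
    and x0: "x0 \<in> X" "u x0 = v x0" and x: "x \<in> X"
  shows "u x = v x"
proof -
  let ?A = "{x \<in> X. u x = v x}"
  have "closedin (top_of_set X) {x \<in> X. (\<lambda>x. u x - v x) x = 0}"
    by (intro continuous_closedin_preimage_constant continuous_intros X)
  then have cl: "closedin (top_of_set X) ?A" by simp
  have op: "openin (top_of_set X) ?A"
  proof (subst openin_subopen, intro ballI)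
    fix a assume a: "a \<in> ?A"
    have "deriv h (u a) \<noteq> 0" using nz[of a] a by blast
    from has_complex_derivative_locally_injective[OF h UNIV_I open_UNIV this]
    obtain r where r: "r > 0" "inj_on h (ball (u a) r)" by metis
    let ?T = "(X \<inter> u -` ball (u a) r) \<inter> (X \<inter> v -` ball (u a) r)"
    have "openin (top_of_set X) ?T"
      by (intro openin_Int continuous_openin_preimage_gen X open_ball)
    moreover have "a \<in> ?T" using a r by auto
    moreover have "?T \<subseteq> ?A"
      using r(2) eq by (auto simp: inj_on_def)
    ultimately show "\<exists>T. openin (top_of_set X) T \<and> a \<in> T \<and> T \<subseteq> ?A" by blast
  qed
  have "?A = {} \<or> ?A = X"
    using X(1) cl op unfolding connected_clopen by blast
  then show ?thesis using x0 x by blast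
qed

text \<open>No closure is taken, unlike in \<open>singular_set\<close>: a lift continued along a
  radius can break down only at an asymptotic or a critical value itself.\<close>

definition regular_value :: "(complex \<Rightarrow> complex) \<Rightarrow> complex \<Rightarrow> bool" where
  "regular_value f w \<longleftrightarrow> w \<notin> critical_values f \<and> w \<notin> asymptotic_values f"

lemma regular_value_deriv: "regular_value f (f z) \<Longrightarrow> deriv f z \<noteq> 0"
  by (auto simp: regular_value_def critical_values_def)

lemma local_section:
  assumes f: "f holomorphic_on UNIV" and u: "u holomorphic_on S" "open S" "c \<in> S"
    and p: "f p = u c" "deriv f p \<noteq> 0"
  obtains s \<epsilon> g where "s > 0" "\<epsilon> > 0" "ball c \<epsilon> \<subseteq> S" "(\<lambda>x. g (u x)) holomorphic_on ball c \<epsilon>"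
    "\<And>x. x \<in> ball c \<epsilon> \<Longrightarrow> f (g (u x)) = u x" "\<And>z. z \<in> ball p s \<Longrightarrow> g (f z) = z"
proof -
  obtain s where s: "s > 0" "open (f ` ball p s)" "inj_on f (ball p s)"
    using has_complex_derivative_locally_invertible[OF f UNIV_I open_UNIV p(2)] by metis
  obtain g where g: "g holomorphic_on f ` ball p s" "\<And>z. z \<in> ball p s \<Longrightarrow> g (f z) = z"
    using holomorphic_has_inverse[OF holomorphic_on_subset[OF f] open_ball s(3)] by (metis subset_UNIV)
  have "open (S \<inter> u -` (f ` ball p s))"
    using continuous_openin_preimage_gen[OF holomorphic_on_imp_continuous_on[OF u(1)] s(2)] u(2) openin_open_eq by blast
  moreover have "u c \<in> f ` ball p s" using p(1) s(1) by (metis centre_in_ball image_eqI)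
  ultimately obtain \<epsilon> where \<epsilon>: "\<epsilon> > 0" "ball c \<epsilon> \<subseteq> S \<inter> u -` (f ` ball p s)"
    using u(3) by (metis IntI open_contains_ball vimageI)
  show ?thesis
  proof (rule that[OF s(1) \<epsilon>(1)])
    show "ball c \<epsilon> \<subseteq> S" using \<epsilon> by blast
    show "(\<lambda>x. g (u x)) holomorphic_on ball c \<epsilon>"
      by (rule holomorphic_on_compose_gen[OF holomorphic_on_subset[OF u(1)] g(1), unfolded o_def]) (use \<epsilon> in auto)
    show "f (g (u x)) = u x" if "x \<in> ball c \<epsilon>" for x
    proof -
      have "u x \<in> f ` ball p s" using \<epsilon>(2) that by auto
      then show ?thesis using g(2) by auto
    qed
  qed (rule g(2))
qed

text \<open>Follow the lift along the radius to \<open>c\<close>. If it tended to infinity,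
  \<open>u c\<close> would be an asymptotic value. So it has a finite accumulation point
  \<open>p\<close> with \<open>f p = u c\<close>, which is not critical, and the inverse branch of
  \<open>f\<close> at \<open>p\<close> continues \<open>v\<close> across \<open>c\<close>.\<close>

lemma lift_extends_at_boundary:
  assumes f: "f holomorphic_on UNIV" and u: "u holomorphic_on ball b r"
    and reg: "\<And>x. x \<in> ball b r \<Longrightarrow> regular_value f (u x)"
    and \<rho>: "0 < \<rho>" "\<rho> < r" and v: "v holomorphic_on ball b \<rho>"
    and fv: "\<And>x. x \<in> ball b \<rho> \<Longrightarrow> f (v x) = u x" and c: "c \<in> sphere b \<rho>"
  shows "\<exists>\<epsilon>>0. \<exists>\<kappa>. \<kappa> holomorphic_on ball c \<epsilon> \<and> ball c \<epsilon> \<subseteq> ball b r \<and>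
           (\<forall>x\<in>ball c \<epsilon>. f (\<kappa> x) = u x) \<and> (\<forall>x\<in>ball c \<epsilon> \<inter> ball b \<rho>. \<kappa> x = v x)"
proof -
  \<comment> \<open>The factor \<open>s / (1 + s)\<close> stretches the radius over
    \<open>{0..}\<close>, the parameter interval in \<open>asymptotic_values\<close>.\<close>
  define q where "q s = b + of_real (s / (1 + s)) * (c - b)" for s :: real
  define \<gamma> where "\<gamma> s = v (q s)" for s
  have cb: "norm (c - b) = \<rho>" using c by (simp add: dist_norm norm_minus_commute)
  have qin: "q s \<in> ball b \<rho>" if "s \<ge> 0" for s
  proof -
    have "dist b (q s) = \<bar>s / (1 + s)\<bar> * \<rho>"
      by (simp add: q_def dist_norm norm_mult cb del: of_real_divide of_real_add)
    also have "\<dots> < 1 * \<rho>"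
      using that \<rho> by (intro mult_strict_right_mono) (auto simp: field_simps)
    finally show ?thesis by simp
  qed
  have qlim: "(q \<longlongrightarrow> c) at_top"
  proof -
    have "((\<lambda>s::real. s / (1 + s)) \<longlongrightarrow> 1) at_top"
      by real_asymp
    then have "(q \<longlongrightarrow> b + of_real 1 * (c - b)) at_top"
      unfolding q_def by (intro tendsto_intros)
    then show ?thesis by simp
  qed
  have cin: "c \<in> ball b r" using c \<rho> by auto
  have ucont: "continuous_on (ball b r) u" using u by (rule holomorphic_on_imp_continuous_on)
  have ulim: "((\<lambda>s. u (q s)) \<longlongrightarrow> u c) at_top"
    using continuous_on_eq_continuous_at[of "ball b r" u] ucont cin qlim
    by (metis isCont_tendsto_compose open_ball)
  have fg: "f (\<gamma> s) = u (q s)" if "s \<ge> 0" for s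
    using fv qin that by (simp add: \<gamma>_def)
  have flim: "((\<lambda>s. f (\<gamma> s)) \<longlongrightarrow> u c) at_top"
    using ulim by (rule Lim_transform_eventually)
      (use fg in \<open>auto intro: eventually_mono[OF eventually_ge_at_top[of 0]]\<close>)
  have contg: "continuous_on {0..} \<gamma>"
    unfolding \<gamma>_def
  proof (rule continuous_on_compose2[OF holomorphic_on_imp_continuous_on[OF v]])
    show "continuous_on {0..} q" unfolding q_def
      by (intro continuous_intros) auto
    show "q ` {0..} \<subseteq> ball b \<rho>" using qin by auto
  qed
  have "\<not> filterlim \<gamma> at_infinity at_top"
    using reg[OF cin] contg flim by (auto simp: regular_value_def asymptotic_values_def)
  then obtain B where "\<not> (\<forall>\<^sub>F s in at_top. norm (\<gamma> s) \<ge> B)"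
    by (subst (asm) filterlim_at_infinity[where c = 0]) auto
  then have fr: "\<forall>N. \<exists>s\<ge>N. norm (\<gamma> s) < B"
    by (auto simp: eventually_at_top_linorder not_le)
  then have "\<forall>n::nat. \<exists>s. s \<ge> real n \<and> norm (\<gamma> s) < B" by auto
  then obtain s where s: "\<And>n::nat. s n \<ge> real n" "\<And>n. norm (\<gamma> (s n)) < B"
    by metis
  have "compact (cball (0::complex) B)" by simp
  moreover have "\<forall>n. \<gamma> (s n) \<in> cball 0 B" using s(2) by (auto simp: less_imp_le)
  ultimately obtain p k where pk: "strict_mono k" "(\<gamma> \<circ> s \<circ> k) \<longlonglongrightarrow> p"
    unfolding compact_def by (metis comp_apply)
  have sk: "filterlim (\<lambda>n. s (k n)) at_top sequentially"
  proof (rule filterlim_at_top_mono[OF filterlim_real_sequentially])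
    show "\<forall>\<^sub>F n in sequentially. real n \<le> s (k n)"
      using s(1) seq_suble[OF pk(1)] by (intro always_eventually) (meson of_nat_le_iff order_trans)
  qed
  have "(\<lambda>n. f (\<gamma> (s (k n)))) \<longlonglongrightarrow> f p"
  proof -
    have "isCont f p" using f by (meson UNIV_I continuous_on_eq_continuous_at holomorphic_on_imp_continuous_on open_UNIV)
    then show ?thesis using pk(2) by (auto intro: isCont_tendsto_compose simp: o_def)
  qed
  moreover have "(\<lambda>n. f (\<gamma> (s (k n)))) \<longlonglongrightarrow> u c"
    using filterlim_compose[OF flim sk] by simp
  ultimately have fp: "f p = u c" by (rule LIMSEQ_unique)
  then have "deriv f p \<noteq> 0" using reg[OF cin] regular_value_deriv by metis
  from local_section[OF f u open_ball cin fp this]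
  obtain r0 \<epsilon> g where r0: "r0 > 0" and \<epsilon>: "\<epsilon> > 0" "ball c \<epsilon> \<subseteq> ball b r"
    and g: "(\<lambda>x. g (u x)) holomorphic_on ball c \<epsilon>" "\<And>x. x \<in> ball c \<epsilon> \<Longrightarrow> f (g (u x)) = u x"
      "\<And>z. z \<in> ball p r0 \<Longrightarrow> g (f z) = z" by metis
  define \<kappa> where "\<kappa> x = g (u x)" for x
  have kh: "\<kappa> holomorphic_on ball c \<epsilon>" and fk: "\<And>x. x \<in> ball c \<epsilon> \<Longrightarrow> f (\<kappa> x) = u x"
    using g(1,2) by (simp_all add: \<kappa>_def[abs_def])
  have "\<forall>\<^sub>F n in sequentially. \<gamma> (s (k n)) \<in> ball p r0"
    using pk(2) r0 by (auto simp: o_def tendsto_iff dist_commute)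
  moreover have "(\<lambda>n. q (s (k n))) \<longlonglongrightarrow> c" using filterlim_compose[OF qlim sk] .
  then have "\<forall>\<^sub>F n in sequentially. q (s (k n)) \<in> ball c \<epsilon>"
    using \<epsilon>(1) by (auto simp: tendsto_iff dist_commute)
  ultimately have "\<forall>\<^sub>F n in sequentially. \<gamma> (s (k n)) \<in> ball p r0 \<and> q (s (k n)) \<in> ball c \<epsilon>"
    by (rule eventually_conj)
  then obtain n where n: "\<gamma> (s (k n)) \<in> ball p r0" "q (s (k n)) \<in> ball c \<epsilon>"
    using eventually_happens by fastforce
  have s0: "s (k n) \<ge> 0" using s(1)[of "k n"] by linarith
  \<comment> \<open>One common value suffices: uniqueness of lifts spreads it over the convex
    intersection of the two balls.\<close>
  have agree: "\<kappa> (q (s (k n))) = v (q (s (k n)))"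
    using g(3)[OF n(1)] fg[OF s0] by (simp add: \<kappa>_def \<gamma>_def)
  have "\<kappa> x = v x" if "x \<in> ball c \<epsilon> \<inter> ball b \<rho>" for x
  proof (rule lift_unique[where h = f and X = "ball c \<epsilon> \<inter> ball b \<rho>" and u = \<kappa> and v = v and ?x0.0 = "q (s (k n))"])
    show "connected (ball c \<epsilon> \<inter> ball b \<rho>)"
      by (intro convex_connected convex_Int convex_ball)
    show "continuous_on (ball c \<epsilon> \<inter> ball b \<rho>) \<kappa>" "continuous_on (ball c \<epsilon> \<inter> ball b \<rho>) v"
      by (meson kh v holomorphic_on_imp_continuous_on continuous_on_subset inf_le1 inf_le2)+
    show "f (\<kappa> x) = f (v x)" if "x \<in> ball c \<epsilon> \<inter> ball b \<rho>" for x using fk fv that by simp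
    show "deriv f (\<kappa> x) \<noteq> 0" if "x \<in> ball c \<epsilon> \<inter> ball b \<rho>" for x
      using regular_value_deriv[of f "\<kappa> x"] fk[of x] reg[of x] \<epsilon>(2) that by auto
  qed (use f n(2) qin[OF s0] agree that in auto)
  then show ?thesis using \<epsilon> kh fk by blast
qed

text \<open>Monodromy by exhaustion: let \<open>\<sigma>\<close> be the supremum of the radii that
  carry a lift. If \<open>\<sigma> < r\<close>, the continuations across the circle of radius
  \<open>\<sigma>\<close> glue to a lift on a larger ball.\<close>

lemma holomorphic_lift_ball:
  assumes f: "f holomorphic_on UNIV" and r: "r > 0" and u: "u holomorphic_on ball b r"
    and reg: "\<And>x. x \<in> ball b r \<Longrightarrow> regular_value f (u x)" and y: "f y = u b"
  shows "\<exists>v. v holomorphic_on ball b r \<and> v b = y \<and> (\<forall>x\<in>ball b r. f (v x) = u x)"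
proof -
  define L where "L \<rho> v \<longleftrightarrow> v holomorphic_on ball b \<rho> \<and> v b = y \<and> (\<forall>x\<in>ball b \<rho>. f (v x) = u x)" for \<rho> v
  have uniq: "v x = w x" if "L \<rho> v" "L \<sigma> w" "x \<in> ball b \<rho>" "x \<in> ball b \<sigma>" "\<rho> \<le> r" for \<rho> \<sigma> v w x
  proof (rule lift_unique[where h = f and X = "ball b \<rho> \<inter> ball b \<sigma>" and u = v and v = w and ?x0.0 = b])
    show "connected (ball b \<rho> \<inter> ball b \<sigma>)"
      by (intro convex_connected convex_Int convex_ball)
    show "continuous_on (ball b \<rho> \<inter> ball b \<sigma>) v" "continuous_on (ball b \<rho> \<inter> ball b \<sigma>) w"
      using \<open>L \<rho> v\<close> \<open>L \<sigma> w\<close> by (meson L_def holomorphic_on_imp_continuous_on continuous_on_subset inf_le1 inf_le2)+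
    show "f (v x) = f (w x)" if "x \<in> ball b \<rho> \<inter> ball b \<sigma>" for x using \<open>L \<rho> v\<close> \<open>L \<sigma> w\<close> that by (simp add: L_def)
    show "deriv f (v x) \<noteq> 0" if "x \<in> ball b \<rho> \<inter> ball b \<sigma>" for x
      using regular_value_deriv[of f "v x"] reg[of x] \<open>L \<rho> v\<close> that \<open>\<rho> \<le> r\<close> by (auto simp: L_def)
    have "dist b x \<ge> 0" by simp
    with that(3,4) show "b \<in> ball b \<rho> \<inter> ball b \<sigma>" by (auto simp del: zero_le_dist)
  qed (use that f in \<open>auto simp: L_def\<close>)
  define S where "S = {\<rho>. 0 < \<rho> \<and> \<rho> \<le> r \<and> (\<exists>v. L \<rho> v)}"
  have "regular_value f (f y)" using reg[of b] r y by auto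
  then have "deriv f y \<noteq> 0" by (rule regular_value_deriv)
  have "b \<in> ball b r" using r by simp
  from local_section[OF f u open_ball this y \<open>deriv f y \<noteq> 0\<close>]
  obtain r0 \<epsilon> g where r0: "r0 > 0" and \<epsilon>: "\<epsilon> > 0" "ball b \<epsilon> \<subseteq> ball b r"
    and g: "(\<lambda>x. g (u x)) holomorphic_on ball b \<epsilon>" "\<And>x. x \<in> ball b \<epsilon> \<Longrightarrow> f (g (u x)) = u x"
      "\<And>z. z \<in> ball y r0 \<Longrightarrow> g (f z) = z" by metis
  have "g (u b) = y" using g(3)[of y] r0 y by simp
  then have "L (min \<epsilon> r) (\<lambda>x. g (u x))"
    using g(1,2) unfolding L_def by (auto intro: holomorphic_on_subset)
  then have Sne: "min \<epsilon> r \<in> S" using \<epsilon>(1) r by (auto simp: S_def)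
  have bdd: "bdd_above S" unfolding S_def by (intro bdd_aboveI[of _ r]) auto
  define \<sigma> where "\<sigma> = Sup S"
  have "0 < min \<epsilon> r" using \<epsilon>(1) r by simp
  also have "min \<epsilon> r \<le> \<sigma>" unfolding \<sigma>_def by (rule cSup_upper[OF Sne bdd])
  finally have \<sigma>0: "0 < \<sigma>" .
  have "\<sigma> \<le> r" unfolding \<sigma>_def
  proof (rule cSup_least)
    show "S \<noteq> {}" using Sne by blast
  qed (simp add: S_def)
  note \<sigma> = \<sigma>0 this
  have "\<exists>\<rho> v. dist b x < \<rho> \<and> \<rho> \<le> r \<and> L \<rho> v" if "x \<in> ball b \<sigma>" for x
  proof -
    have "dist b x < Sup S" using that by (simp add: \<sigma>_def)
    then obtain \<rho> where "\<rho> \<in> S" "dist b x < \<rho>"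
      using less_cSup_iff[of S "dist b x"] bdd Sne by blast
    then show ?thesis by (auto simp: S_def)
  qed
  then obtain R V where RV: "\<And>x. x \<in> ball b \<sigma> \<Longrightarrow> dist b x < R x \<and> R x \<le> r \<and> L (R x) (V x)"
    by metis
  define v where "v x = V x x" for x
  have vV: "v z = V x z" if "x \<in> ball b \<sigma>" "z \<in> ball b (R x)" "z \<in> ball b \<sigma>" for x z
    unfolding v_def using RV[OF that(1)] RV[OF that(3)] that
    by (intro uniq[of "R z" _ "R x"]) auto
  have Lv: "L \<sigma> v"
    unfolding L_def
  proof (intro conjI ballI)
    show "v holomorphic_on ball b \<sigma>"
    proof (rule holomorphic_on_subset[of _ "\<Union>x\<in>ball b \<sigma>. ball b (R x) \<inter> ball b \<sigma>"])
      show "v holomorphic_on (\<Union>x\<in>ball b \<sigma>. ball b (R x) \<inter> ball b \<sigma>)"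
      proof (rule holomorphic_on_UN_open)
        fix x assume x: "x \<in> ball b \<sigma>"
        have "V x holomorphic_on ball b (R x) \<inter> ball b \<sigma>"
          using RV[OF x] by (auto simp: L_def intro: holomorphic_on_subset)
        then show "v holomorphic_on ball b (R x) \<inter> ball b \<sigma>"
          by (rule holomorphic_transform) (use vV x in auto)
      qed auto
      show "ball b \<sigma> \<subseteq> (\<Union>x\<in>ball b \<sigma>. ball b (R x) \<inter> ball b \<sigma>)" using RV by auto
    qed
    show "v b = y" using RV[of b] \<sigma> by (auto simp: v_def L_def)
    show "f (v x) = u x" if "x \<in> ball b \<sigma>" for x using RV[OF that] by (auto simp: v_def L_def)
  qed
  have "\<sigma> = r"
  proof (rule ccontr)
    assume "\<sigma> \<noteq> r"
    then have "\<sigma> < r" using \<sigma> by simp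
    have "\<forall>c\<in>sphere b \<sigma>. \<exists>\<epsilon> \<kappa>. \<epsilon> > 0 \<and> \<kappa> holomorphic_on ball c \<epsilon> \<and> ball c \<epsilon> \<subseteq> ball b r \<and>
           (\<forall>x\<in>ball c \<epsilon>. f (\<kappa> x) = u x) \<and> (\<forall>x\<in>ball c \<epsilon> \<inter> ball b \<sigma>. \<kappa> x = v x)"
      using lift_extends_at_boundary[OF f u reg \<sigma>(1) \<open>\<sigma> < r\<close>, of v] Lv unfolding L_def by blast
    then obtain E K where EK: "\<And>c. c \<in> sphere b \<sigma> \<Longrightarrow> E c > 0 \<and> K c holomorphic_on ball c (E c) \<and> ball c (E c) \<subseteq> ball b r \<and>
           (\<forall>x\<in>ball c (E c). f (K c x) = u x) \<and> (\<forall>x\<in>ball c (E c) \<inter> ball b \<sigma>. K c x = v x)"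
      by metis
    define W where "W = (\<Union>c\<in>sphere b \<sigma>. ball c (E c))"
    define w where "w x = (if x \<in> ball b \<sigma> then v x else K (SOME c. c \<in> sphere b \<sigma> \<and> x \<in> ball c (E c)) x)" for x
    \<comment> \<open>Overlapping discs centred on the circle also overlap inside
      \<open>ball b \<sigma>\<close>: projecting \<open>x\<close> to the closed ball brings it no
      farther from either centre. Inside, both continuations equal \<open>v\<close>.\<close>
    have KK: "K c x = K c' x" if "c \<in> sphere b \<sigma>" "c' \<in> sphere b \<sigma>" "x \<in> ball c (E c)" "x \<in> ball c' (E c')" for c c' x
    proof -
      define p where "p = closest_point (cball b \<sigma>) x"
      have cb: "convex (cball b \<sigma>)" "closed (cball b \<sigma>)" "cball b \<sigma> \<noteq> {}" using \<sigma> by auto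
      have pc: "dist d p \<le> dist d x" if "d \<in> sphere b \<sigma>" for d
      proof -
        have "d \<in> cball b \<sigma>" using that by auto
        then show ?thesis
          using closest_point_lipschitz[OF cb, of x d] by (simp add: p_def closest_point_self dist_commute)
      qed
      have "p \<in> cball b \<sigma>" unfolding p_def by (rule closest_point_in_set[OF cb(2,3)])
      then have "p \<in> closure (ball b \<sigma>)" using \<sigma> by simp
      moreover have "p \<in> ball c (E c) \<inter> ball c' (E c')" using pc[OF that(1)] pc[OF that(2)] that by auto
      moreover have "open (ball c (E c) \<inter> ball c' (E c'))" by auto
      ultimately obtain z where z: "z \<in> ball c (E c) \<inter> ball c' (E c')" "z \<in> ball b \<sigma>"
        using open_Int_closure_eq_empty by (metis Int_iff disjoint_iff)
      show ?thesis
      proof (rule lift_unique[where h = f and X = "ball c (E c) \<inter> ball c' (E c')" and u = "K c" and v = "K c'" and ?x0.0 = z])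
        show "connected (ball c (E c) \<inter> ball c' (E c'))"
          by (intro convex_connected convex_Int convex_ball)
        show "continuous_on (ball c (E c) \<inter> ball c' (E c')) (K c)" "continuous_on (ball c (E c) \<inter> ball c' (E c')) (K c')"
          using EK that(1,2) by (meson holomorphic_on_imp_continuous_on continuous_on_subset inf_le1 inf_le2)+
        show "deriv f (K c x) \<noteq> 0" if "x \<in> ball c (E c) \<inter> ball c' (E c')" for x
          using regular_value_deriv[of f "K c x"] reg[of x] EK[OF \<open>c \<in> sphere b \<sigma>\<close>] that by auto
      qed (use f z EK[OF that(1)] EK[OF that(2)] that(3,4) in auto)
    qed
    have wK: "w x = K c x" if "c \<in> sphere b \<sigma>" "x \<in> ball c (E c)" for c x
    proof (cases "x \<in> ball b \<sigma>")
      case True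
      then show ?thesis using EK that by (auto simp: w_def)
    next
      case False
      let ?c = "SOME c. c \<in> sphere b \<sigma> \<and> x \<in> ball c (E c)"
      have "?c \<in> sphere b \<sigma> \<and> x \<in> ball ?c (E ?c)" by (rule someI[of _ c]) (use that in auto)
      then show ?thesis using KK[of ?c c x] that False by (simp add: w_def)
    qed
    have openW: "open (ball b \<sigma> \<union> W)" by (auto simp: W_def)
    have sub: "cball b \<sigma> \<subseteq> ball b \<sigma> \<union> W"
    proof
      fix x assume "x \<in> cball b \<sigma>"
      then consider "x \<in> ball b \<sigma>" | "x \<in> sphere b \<sigma>" by fastforce
      then show "x \<in> ball b \<sigma> \<union> W"
      proof cases
        case 2
        then have "x \<in> ball x (E x)" using EK by simp
        then show ?thesis using 2 unfolding W_def by blast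
      qed simp
    qed
    have "cball b \<sigma> \<noteq> {}" using \<sigma> by simp
    from compact_in_open_separated[OF this compact_cball openW sub]
    obtain e where e: "e > 0" "{x. infdist x (cball b \<sigma>) \<le> e} \<subseteq> ball b \<sigma> \<union> W" .
    define \<rho> where "\<rho> = min (\<sigma> + e) r"
    have \<rho>: "\<sigma> < \<rho>" "\<rho> \<le> r" using e \<open>\<sigma> < r\<close> by (auto simp: \<rho>_def)
    have sub2: "ball b \<rho> \<subseteq> ball b \<sigma> \<union> W"
    proof
      fix x assume x: "x \<in> ball b \<rho>"
      have "infdist x (cball b \<sigma>) \<le> e"
      proof (cases "x \<in> cball b \<sigma>")
        case True then show ?thesis using e by simp
      next
        case False
        then have d: "dist b x > \<sigma>" "b \<noteq> x" using \<sigma> by auto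
        let ?z = "b + of_real (\<sigma> / dist b x) * (x - b)"
        have "dist b ?z = \<sigma>" using d \<sigma> by (simp add: dist_norm norm_mult norm_divide norm_minus_commute)
        then have "?z \<in> cball b \<sigma>" by simp
        moreover have "dist x ?z = dist b x - \<sigma>"
        proof -
          have "x - ?z = of_real (1 - \<sigma> / dist b x) * (x - b)" by (simp add: algebra_simps)
          then have "dist x ?z = \<bar>1 - \<sigma> / dist b x\<bar> * dist b x"
            by (simp add: dist_norm norm_mult norm_minus_commute del: of_real_divide of_real_diff)
          also have "\<dots> = dist b x - \<sigma>" using d \<sigma> by (simp add: field_simps abs_if)
          finally show ?thesis .
        qed
        ultimately show ?thesis using x infdist_le2[of ?z "cball b \<sigma>" x e] by (auto simp: \<rho>_def)
      qed
      then show "x \<in> ball b \<sigma> \<union> W" using e by auto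
    qed
    have "w holomorphic_on ball b \<sigma> \<union> W"
    proof (rule holomorphic_on_Un)
      show "w holomorphic_on ball b \<sigma>"
        by (rule holomorphic_transform[of v]) (use Lv in \<open>auto simp: w_def L_def\<close>)
      show "w holomorphic_on W" unfolding W_def
      proof (rule holomorphic_on_UN_open)
        fix c assume "c \<in> sphere b \<sigma>"
        then show "w holomorphic_on ball c (E c)"
          using EK[of c] wK[of c] by (metis holomorphic_transform)
      qed auto
    qed (auto simp: W_def)
    then have "w holomorphic_on ball b \<rho>" using sub2 holomorphic_on_subset by blast
    moreover have "f (w x) = u x" if "x \<in> ball b \<rho>" for x
    proof (cases "x \<in> ball b \<sigma>")
      case True then show ?thesis using Lv by (auto simp: w_def L_def)
    next
      case False
      then obtain c where "c \<in> sphere b \<sigma>" "x \<in> ball c (E c)" using sub2 \<open>x \<in> ball b \<rho>\<close> unfolding W_def by blast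
      then show ?thesis using wK EK by metis
    qed
    moreover have "w b = y" using Lv \<sigma> by (auto simp: w_def L_def)
    ultimately have "L \<rho> w" by (auto simp: L_def)
    then have "\<rho> \<in> S" using \<rho> \<sigma> by (auto simp: S_def)
    then show False using \<rho>(1) cSup_upper[OF _ bdd] by (fastforce simp: \<sigma>_def)
  qed
  then show ?thesis using Lv by (auto simp: L_def)
qed

section \<open>Lifts of the exponential to half-planes\<close>

definition rhp :: "real \<Rightarrow> complex set" where
  "rhp a = {\<zeta>. a < Re \<zeta>}"

lemma mem_rhp [simp]: "\<zeta> \<in> rhp a \<longleftrightarrow> a < Re \<zeta>" by (simp add: rhp_def)
lemma open_rhp [simp]: "open (rhp a)" by (simp add: rhp_def open_halfspace_Re_gt)
lemma convex_rhp [simp]: "convex (rhp a)" by (simp add: rhp_def convex_halfspace_Re_gt)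
lemma connected_rhp [simp]: "connected (rhp a)" by (simp add: convex_connected)

lemma ball_subset_rhp: "ball \<zeta> (Re \<zeta> - a) \<subseteq> rhp a"
proof
  fix x assume "x \<in> ball \<zeta> (Re \<zeta> - a)"
  then show "x \<in> rhp a"
    using abs_Re_le_cmod[of "\<zeta> - x"] by (auto simp: dist_norm)
qed

lemma entire_bounded_on_compact:
  assumes "f holomorphic_on UNIV" "compact K"
  shows "\<exists>D. \<forall>x\<in>K. norm (f x) \<le> D"
proof -
  have "compact (f ` K)"
    using assms by (meson compact_continuous_image continuous_on_subset holomorphic_on_imp_continuous_on subset_UNIV)
  then show ?thesis using compact_imp_bounded[of "f ` K"] unfolding bounded_iff by blast
qed

text \<open>The disc case transported by the Cayley transform \<open>m\<close>, normalised to send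
  the centre 0 to \<open>x0\<close>; \<open>k\<close> is its inverse.\<close>

lemma holomorphic_lift_rhp:
  assumes f: "f holomorphic_on UNIV" and u: "u holomorphic_on rhp a"
    and reg: "\<And>x. x \<in> rhp a \<Longrightarrow> regular_value f (u x)" and x0: "x0 \<in> rhp a" and y: "f y = u x0"
  shows "\<exists>v. v holomorphic_on rhp a \<and> v x0 = y \<and> (\<forall>x\<in>rhp a. f (v x) = u x)"
proof -
  define d where "d = Re x0 - a"
  define c where "c = Complex a (Im x0)"
  have d: "d > 0" using x0 by (simp add: d_def)
  have cd: "c + of_real d = x0" by (simp add: c_def d_def complex_eq_iff)
  define m where "m w = c + of_real d * ((1 + w) / (1 - w))" for w :: complex
  define k where "k \<zeta> = ((\<zeta> - c) / of_real d - 1) / ((\<zeta> - c) / of_real d + 1)" for \<zeta> :: complex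
  have mre: "m w \<in> rhp a" if "w \<in> ball 0 1" for w
  proof -
    have w: "norm w < 1" using that by simp
    then have w1: "w \<noteq> 1" by auto
    have "(norm w)\<^sup>2 < 1" using w by (simp add: abs_square_less_1)
    then have "(Re w)\<^sup>2 + (Im w)\<^sup>2 < 1" by (simp add: cmod_power2)
    moreover have "(1 - Re w)\<^sup>2 + (Im w)\<^sup>2 > 0"
      using w1 by (metis complex_eq_iff diff_self eq_iff_diff_eq_0 minus_complex.simps(1) one_complex.simps sum_power2_gt_zero_iff zero_complex.simps)
    ultimately have "Re ((1 + w) / (1 - w)) > 0"
      by (simp add: Re_divide power2_eq_square algebra_simps divide_simps)
    then have "d * Re ((1 + w) / (1 - w)) > 0" using d by simp
    moreover have "Re (of_real d * q) = d * Re q" for q by simp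
    ultimately have "Re (of_real d * ((1 + w) / (1 - w))) > 0" by metis
    then show ?thesis by (simp add: m_def c_def)
  qed
  have kb: "k \<zeta> \<in> ball 0 1 \<and> (\<zeta> - c) / of_real d + 1 \<noteq> 0" if "\<zeta> \<in> rhp a" for \<zeta>
  proof -
    define s where "s = (\<zeta> - c) / of_real d"
    have s: "Re s > 0" using that d by (simp add: s_def c_def)
    then have nz: "s + 1 \<noteq> 0" by (metis add_pos_pos less_numeral_extra(1,3) one_complex.simps(1) plus_complex.simps(1) zero_complex.simps(1))
    have "(norm (s - 1))\<^sup>2 < (norm (s + 1))\<^sup>2"
      using s by (simp add: cmod_power2) (simp add: power2_eq_square algebra_simps)
    then have "norm (s - 1) < norm (s + 1)" using power2_less_imp_less by fastforce
    then show ?thesis using nz by (simp add: k_def s_def[symmetric] norm_divide)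
  qed
  have mk: "m (k \<zeta>) = \<zeta>" if "\<zeta> \<in> rhp a" for \<zeta>
  proof -
    define s where "s = (\<zeta> - c) / of_real d"
    have nz: "s + 1 \<noteq> 0" using kb[OF that] by (simp add: s_def)
    have "k \<zeta> = (s - 1) / (s + 1)" by (simp add: k_def s_def)
    then have "1 + k \<zeta> = 2 * s / (s + 1)" "1 - k \<zeta> = 2 / (s + 1)"
      using nz by (simp_all add: field_simps)
    then have "(1 + k \<zeta>) / (1 - k \<zeta>) = s" using nz by simp
    then show ?thesis using d by (simp add: m_def s_def)
  qed
  have mh: "m holomorphic_on ball 0 1"
    unfolding m_def by (intro holomorphic_intros) auto
  have kh: "k holomorphic_on rhp a"
    unfolding k_def using d kb by (intro holomorphic_intros) auto
  have um: "(\<lambda>w. u (m w)) holomorphic_on ball 0 1"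
    by (rule holomorphic_on_compose_gen[OF mh u, unfolded o_def]) (use mre in auto)
  have m0: "m 0 = x0" by (simp add: m_def cd)
  have k0: "k x0 = 0" using d by (simp add: k_def flip: cd)
  obtain v where v: "v holomorphic_on ball 0 1" "v 0 = y" "\<forall>w\<in>ball 0 1. f (v w) = u (m w)"
    using holomorphic_lift_ball[OF f _ um, of y] reg mre y m0 by auto
  have "(\<lambda>\<zeta>. v (k \<zeta>)) holomorphic_on rhp a"
    by (rule holomorphic_on_compose_gen[OF kh v(1), unfolded o_def]) (use kb in auto)
  then show ?thesis using v kb mk k0 by (intro exI[of _ "\<lambda>\<zeta>. v (k \<zeta>)"]) auto
qed

text \<open>By the chain rule the two derivatives multiply to \<open>exp x\<close>, which never
  vanishes. Exponential lifts thus meet the noncriticality condition of \<open>lift_unique\<close>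
  automatically.\<close>

lemma deriv_nonzero_of_exp:
  assumes f: "f holomorphic_on UNIV" and g: "g holomorphic_on S" "open S"
    and fg: "\<And>x. x \<in> S \<Longrightarrow> f (g x) = exp x" and x: "x \<in> S"
  shows "deriv f (g x) \<noteq> 0"
proof -
  have "(g has_field_derivative deriv g x) (at x)"
    using g x by (metis holomorphic_derivI)
  moreover have "(f has_field_derivative deriv f (g x)) (at (g x))"
    using f by (metis UNIV_I holomorphic_derivI open_UNIV)
  ultimately have "((\<lambda>x. f (g x)) has_field_derivative deriv f (g x) * deriv g x) (at x)"
    using DERIV_chain2 by blast
  then have "(exp has_field_derivative deriv f (g x) * deriv g x) (at x)"
    by (rule has_field_derivative_transform_within_open[OF _ g(2) x]) (use fg in auto)
  moreover have "(exp has_field_derivative exp x) (at x)" by (rule DERIV_exp)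
  ultimately have "deriv f (g x) * deriv g x = exp x" using DERIV_unique by blast
  then show ?thesis by (metis exp_not_eq_zero mult_zero_left)
qed

lemma exp_lift_unique:
  assumes f: "f holomorphic_on UNIV"
    and u: "u holomorphic_on rhp a" and v: "v holomorphic_on rhp a"
    and fu: "\<And>x. x \<in> rhp a \<Longrightarrow> f (u x) = exp x" and fv: "\<And>x. x \<in> rhp a \<Longrightarrow> f (v x) = exp x"
    and x0: "x0 \<in> rhp a" "u x0 = v x0" and x: "x \<in> rhp a"
  shows "u x = v x"
  by (rule lift_unique[where h = f and X = "rhp a" and u = u and v = v and ?x0.0 = x0])
    (use assms deriv_nonzero_of_exp[OF f u _ fu] in \<open>auto intro: holomorphic_on_imp_continuous_on\<close>)

lemma periodic_reduce:
  fixes g :: "complex \<Rightarrow> 'b"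
  assumes per: "\<And>x. x \<in> rhp a \<Longrightarrow> g (x + of_real P * \<i>) = g x" and P: "P > 0" and x: "x \<in> rhp a"
  shows "\<exists>x'\<in>rhp a. Re x' = Re x \<and> 0 \<le> Im x' \<and> Im x' \<le> P \<and> g x' = g x"
proof -
  have pern: "g (x + of_real (of_nat n * P) * \<i>) = g x" if "x \<in> rhp a" for x n
  proof (induction n)
    case (Suc n)
    have "x + of_real (of_nat n * P) * \<i> \<in> rhp a" using that by simp
    from per[OF this] Suc show ?case by (simp add: algebra_simps)
  qed auto
  define m where "m = \<lfloor>Im x / P\<rfloor>"
  define x' where "x' = x - of_real (of_int m * P) * \<i>"
  have x': "x' \<in> rhp a" "Re x' = Re x" using x by (auto simp: x'_def)
  have "of_int m \<le> Im x / P" "Im x / P < of_int m + 1" by (auto simp: m_def)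
  then have im: "0 \<le> Im x'" "Im x' \<le> P" using P by (auto simp: x'_def field_simps)
  have "g x' = g x"
  proof (cases "m \<ge> 0")
    case True
    then have "x = x' + of_real (of_nat (nat m) * P) * \<i>" by (simp add: x'_def)
    then show ?thesis using pern[OF x'(1), of "nat m"] by simp
  next
    case False
    then have "x' = x + of_real (of_nat (nat (- m)) * P) * \<i>" by (simp add: x'_def)
    then show ?thesis using pern[OF x, of "nat (- m)"] by simp
  qed
  then show ?thesis using x' im by blast
qed

text \<open>A coincidence of values forces, by uniqueness of lifts, a purely imaginary period of
  \<open>g\<close>. Then the image of \<open>g\<close> fills a neighbourhood of infinity on which
  \<open>f\<close> tends to infinity, and \<open>f\<close> would be a polynomial.\<close>

lemma inj_on_exp_lift:
  assumes f: "f holomorphic_on UNIV" and np: "\<not> (\<exists>p. \<forall>z. f z = poly p z)"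
    and g: "g holomorphic_on rhp a" and fg: "\<And>x. x \<in> rhp a \<Longrightarrow> f (g x) = exp x"
  shows "inj_on g (rhp a)"
proof (rule ccontr)
  assume "\<not> inj_on g (rhp a)"
  then obtain x y where xy: "x \<in> rhp a" "y \<in> rhp a" "x \<noteq> y" "g x = g y" by (auto simp: inj_on_def)
  then have "exp x = exp y" using fg by metis
  then obtain n where n: "x = y + complex_of_real (2 * of_int n * pi) * \<i>" by (auto simp: exp_eq)
  have per: "g \<zeta> = g (\<zeta> + of_real (2 * of_int n * pi) * \<i>)" if "\<zeta> \<in> rhp a" for \<zeta>
  proof (rule exp_lift_unique[OF f g, of "\<lambda>\<zeta>. g (\<zeta> + of_real (2 * of_int n * pi) * \<i>)"])
    show "(\<lambda>\<zeta>. g (\<zeta> + of_real (2 * of_int n * pi) * \<i>)) holomorphic_on rhp a"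
      by (rule holomorphic_on_compose_gen[OF _ g, unfolded o_def]) (auto intro!: holomorphic_intros)
    show "f (g (\<zeta> + of_real (2 * of_int n * pi) * \<i>)) = exp \<zeta>" if "\<zeta> \<in> rhp a" for \<zeta>
    proof -
      have "f (g (\<zeta> + of_real (2 * of_int n * pi) * \<i>)) = exp (\<zeta> + of_real (2 * of_int n * pi) * \<i>)"
        by (rule fg) (use that in auto)
      also have "\<dots> = exp \<zeta>" by (subst exp_eq) auto
      finally show ?thesis .
    qed
    show "g y = g (y + of_real (2 * of_int n * pi) * \<i>)" using n xy by simp
  qed (use xy that fg in auto)
  define P where "P = 2 * \<bar>real_of_int n\<bar> * pi"
  have P: "P > 0" using n xy by (auto simp: P_def)
  have perP: "g (\<zeta> + of_real P * \<i>) = g \<zeta>" if "\<zeta> \<in> rhp a" for \<zeta>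
  proof (cases "n \<ge> 0")
    case True then show ?thesis using per[OF that] by (simp add: P_def)
  next
    case False
    then have "\<zeta> = (\<zeta> + of_real P * \<i>) + of_real (2 * of_int n * pi) * \<i>" by (simp add: P_def algebra_simps)
    then show ?thesis using per[of "\<zeta> + of_real P * \<i>"] that by (metis Re_complex_of_real mem_rhp add.right_neutral plus_complex.sel(1) Re_i_times mult.commute Im_complex_of_real neg_equal_0_iff_equal)
  qed
  have gcont: "continuous_on (rhp a) g" using g by (rule holomorphic_on_imp_continuous_on)
  \<comment> \<open>Modulo the period the boundary line of \<open>rhp \<sigma>\<close> is compact,
    so the image \<open>A\<close> of \<open>rhp \<sigma>\<close> has no boundary far out. Open,
    closed and nonempty relative to the exterior of a disc, it contains that exterior.\<close>
  have big: "\<exists>B. \<forall>z. norm z > B \<longrightarrow> norm (f z) \<ge> exp \<sigma>" if "\<sigma> > a" for \<sigma>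
  proof -
    define Bx where "Bx C = cbox (Complex \<sigma> 0) (Complex C P)" for C
    have Bxc: "compact (g ` Bx C)" for C
      by (rule compact_continuous_image[OF continuous_on_subset[OF gcont]])
        (use that in \<open>auto simp: Bx_def in_cbox_complex_iff\<close>)
    obtain B where B: "\<And>z. z \<in> g ` Bx \<sigma> \<Longrightarrow> norm z \<le> B"
      using compact_imp_bounded[OF Bxc[of \<sigma>]] unfolding bounded_iff by blast
    define A where "A = g ` rhp \<sigma>"
    have sub: "rhp \<sigma> \<subseteq> rhp a" using that by auto
    have nc: "\<not> g constant_on rhp \<sigma>"
    proof
      assume "g constant_on rhp \<sigma>"
      then have "f (g (of_real (\<sigma> + 1))) = f (g (of_real (\<sigma> + 2)))" by (auto simp: constant_on_def)
      then have "exp (of_real (\<sigma> + 1)) = (exp (of_real (\<sigma> + 2)) :: complex)"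
        using fg that by auto
      then have "norm (exp (of_real (\<sigma> + 1)) :: complex) = norm (exp (of_real (\<sigma> + 2)) :: complex)" by simp
      then show False by simp
    qed
    have openA: "open A" unfolding A_def
      using open_mapping_thm[OF holomorphic_on_subset[OF g sub]] nc by (metis connected_rhp open_rhp order_refl)
    have boxin: "z \<in> g ` Bx C" if "z = g \<zeta>" "Re \<zeta> > \<sigma>" "Re \<zeta> \<le> C" for z \<zeta> C
    proof -
      have "\<zeta> \<in> rhp a" using that \<open>\<sigma> > a\<close> by simp
      then obtain \<zeta>' where "Re \<zeta>' = Re \<zeta>" "0 \<le> Im \<zeta>'" "Im \<zeta>' \<le> P" "g \<zeta>' = g \<zeta>"
        using periodic_reduce[where g = g and a = a and P = P and x = \<zeta>] perP P by blast
      then show ?thesis using that by (auto simp: Bx_def in_cbox_complex_iff intro!: image_eqI[of _ _ \<zeta>'])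
    qed
    \<comment> \<open>\<open>f\<close> is bounded near \<open>z\<close>, which bounds
      \<open>Re \<zeta>\<close>; so points of \<open>A\<close> near \<open>z\<close> come from a
      compact box. A preimage of \<open>z\<close> with real part \<open>\<sigma>\<close> would give
      \<open>norm z \<le> B\<close>.\<close>
    have bdry: "z \<in> A" if z: "z \<in> closure A" "norm z > B" for z
    proof -
      obtain D where D: "\<And>w. w \<in> cball z 1 \<Longrightarrow> norm (f w) \<le> D"
        using entire_bounded_on_compact[OF f compact_cball] by blast
      have "A \<inter> ball z 1 \<subseteq> g ` Bx (ln (max D 1))"
      proof
        fix w assume w: "w \<in> A \<inter> ball z 1"
        then obtain \<zeta> where \<zeta>: "w = g \<zeta>" "Re \<zeta> > \<sigma>" by (auto simp: A_def)
        have "exp (Re \<zeta>) \<le> D" using D[of w] w fg[of \<zeta>] \<zeta> that sub by (auto simp: less_imp_le)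
        then have "Re \<zeta> \<le> ln (max D 1)" by (subst ln_ge_iff) auto
        then show "w \<in> g ` Bx (ln (max D 1))" using boxin \<zeta> by blast
      qed
      then have "closure (A \<inter> ball z 1) \<subseteq> g ` Bx (ln (max D 1))"
        using Bxc by (simp add: closure_minimal compact_imp_closed)
      moreover have "z \<in> closure (A \<inter> ball z 1)"
        using z(1) by (metis IntI Int_commute centre_in_ball open_Int_closure_subset open_ball subset_eq zero_less_one)
      ultimately obtain \<zeta> where \<zeta>: "\<zeta> \<in> Bx (ln (max D 1))" "z = g \<zeta>" by blast
      have "Re \<zeta> \<noteq> \<sigma>"
      proof
        assume "Re \<zeta> = \<sigma>"
        then have "\<zeta> \<in> Bx \<sigma>" using \<zeta> by (auto simp: Bx_def in_cbox_complex_iff)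
        then show False using B \<zeta> z(2) by force
      qed
      then have "Re \<zeta> > \<sigma>" using \<zeta> by (auto simp: Bx_def in_cbox_complex_iff)
      then show ?thesis using \<zeta> by (auto simp: A_def)
    qed
    define U where "U = - cball (0::complex) (max B 0)"
    have Uconn: "connected U"
      unfolding U_def by (rule connected_complement_bounded_convex) auto
    have "openin (top_of_set U) (U \<inter> A)" using openA by (auto simp: openin_open)
    moreover have "closedin (top_of_set U) (U \<inter> A)"
    proof -
      have "U \<inter> A = U \<inter> closure A" using bdry closure_subset by (auto simp: U_def)
      then show ?thesis by (simp add: closedin_closed_Int)
    qed
    moreover have "U \<inter> A \<noteq> {}"
    proof
      assume e: "U \<inter> A = {}"
      obtain D where D: "\<And>w. w \<in> cball 0 (max B 0) \<Longrightarrow> norm (f w) \<le> D"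
        using entire_bounded_on_compact[OF f compact_cball] by blast
      define \<zeta> where "\<zeta> = complex_of_real (max (\<sigma> + 1) (ln (max D 1) + 1))"
      have \<zeta>: "\<zeta> \<in> rhp \<sigma>" by (simp add: \<zeta>_def)
      then have "g \<zeta> \<in> cball 0 (max B 0)" using e by (auto simp: A_def U_def)
      moreover have "f (g \<zeta>) = exp \<zeta>" using fg \<zeta> sub by blast
      ultimately have "norm (exp \<zeta>) \<le> D" using D by metis
      then have "exp (Re \<zeta>) \<le> max D 1" by simp
      moreover have "exp (Re \<zeta>) > max D 1"
        by (metis \<zeta>_def Re_complex_of_real exp_less_cancel_iff exp_ln less_add_one less_max_iff_disj max.strict_coboundedI2 zero_less_one)
      ultimately show False by simp
    qed
    ultimately have "U \<inter> A = U" using Uconn unfolding connected_clopen by blast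
    then have "norm (f z) \<ge> exp \<sigma>" if "norm z > max B 0" for z
    proof -
      have "z \<in> U" using that unfolding U_def by (simp only: Compl_iff mem_cball_0 not_le not_False_eq_True)
      then have "z \<in> A" using \<open>U \<inter> A = U\<close> by blast
      then obtain \<zeta> where \<zeta>: "z = g \<zeta>" "Re \<zeta> > \<sigma>" by (auto simp: A_def)
      then have "f z = exp \<zeta>" using fg \<open>\<sigma> > a\<close> by simp
      then show ?thesis using \<zeta> by simp
    qed
    then show ?thesis by blast
  qed
  have "((inverse \<circ> f) \<longlongrightarrow> 0) at_infinity"
  proof (rule tendstoI)
    fix e :: real assume e: "e > 0"
    define \<sigma> where "\<sigma> = max (a + 1) (1 - ln e)"
    have "\<sigma> > a" by (simp add: \<sigma>_def)
    then obtain B where B: "\<forall>z. norm z > B \<longrightarrow> norm (f z) \<ge> exp \<sigma>" using big by blast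
    have "exp (- \<sigma>) \<le> exp (ln e - 1)" by (simp add: \<sigma>_def)
    also have "\<dots> < exp (ln e)" by simp
    finally have es: "exp (- \<sigma>) < e" using e by simp
    have "dist ((inverse \<circ> f) z) 0 < e" if "norm z \<ge> B + 1" for z
    proof -
      have "norm (f z) \<ge> exp \<sigma>" using B that by simp
      then have "inverse (norm (f z)) \<le> inverse (exp \<sigma>)" by (intro le_imp_inverse_le) auto
      then show ?thesis using es by (simp add: norm_inverse exp_minus)
    qed
    then show "\<forall>\<^sub>F z in at_infinity. dist ((inverse \<circ> f) z) 0 < e"
      by (auto simp: eventually_at_infinity)
  qed
  then obtain c n where c: "\<And>z. f z = (\<Sum>i\<le>n. c i * z ^ i)"
    using pole_at_infinity[OF f] by blast
  then have "f z = poly (\<Sum>i\<le>n. monom (c i) i) z" for z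
    by (simp add: poly_sum poly_monom)
  then show False using np by blast
qed

text \<open>A logarithm of \<open>h - c\<close> attains no two values differing by \<open>2\<pi>i\<close>, so its image contains no
  disc of radius greater than \<open>\<pi>\<close>; Bloch's theorem turns this into a bound on the derivative.\<close>

lemma injective_log_deriv_bound:
  assumes h: "h holomorphic_on ball x d" and inj: "inj_on h (ball x d)" and d: "d > 0"
    and omit: "\<And>y. y \<in> ball x d \<Longrightarrow> h y \<noteq> c"
  shows "norm (deriv h x) * d \<le> 12 * pi * norm (h x - c)"
proof -
  have h': "(\<lambda>y. h y - c) holomorphic_on ball x d" by (intro holomorphic_intros h)
  obtain l where l: "l holomorphic_on ball x d" "\<And>y. y \<in> ball x d \<Longrightarrow> exp (l y) = h y - c"
    using holomorphic_logarithm_exists[OF convex_ball open_ball h', of x] omit d by auto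
  have xin: "x \<in> ball x d" using d by simp
  have "(l has_field_derivative deriv l x) (at x)"
    using l xin by (metis holomorphic_derivI open_ball)
  then have "((\<lambda>y. exp (l y)) has_field_derivative exp (l x) * deriv l x) (at x)"
    by (rule DERIV_chain2[OF DERIV_exp])
  then have "((\<lambda>y. h y - c) has_field_derivative exp (l x) * deriv l x) (at x)"
    by (rule has_field_derivative_transform_within_open[OF _ open_ball xin]) (use l in auto)
  moreover have "((\<lambda>y. h y - c) has_field_derivative deriv h x - 0) (at x)"
    using h xin by (intro DERIV_diff) (auto intro: holomorphic_derivI)
  ultimately have dl: "deriv h x = (h x - c) * deriv l x"
    using DERIV_unique l(2)[OF xin] by fastforce
  \<comment> \<open>The 12 is the constant in \<open>Bloch\<close>. A disc of radius above
    \<open>pi\<close> contains \<open>b - \<i> * pi\<close> and \<open>b + \<i> * pi\<close>, two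
    logarithms of the same number.\<close>
  have "d * norm (deriv l x) / 12 \<le> pi"
  proof (rule ccontr)
    assume "\<not> ?thesis"
    then have gt: "d * norm (deriv l x) / 12 > pi" by simp
    obtain b where b: "ball b (d * norm (deriv l x) / 12) \<subseteq> l ` ball x d"
      using Bloch[OF l(1) d order_refl] by blast
    have "b - \<i> * pi \<in> ball b (d * norm (deriv l x) / 12)" "b + \<i> * pi \<in> ball b (d * norm (deriv l x) / 12)"
      using gt by (auto simp: dist_norm norm_mult)
    then have "b - \<i> * pi \<in> l ` ball x d" "b + \<i> * pi \<in> l ` ball x d" using b by blast+
    then obtain y z where yz: "y \<in> ball x d" "z \<in> ball x d" "l y = b - \<i> * pi" "l z = b + \<i> * pi"
      by (elim imageE) auto
    have "l z = l y + 2 * of_real pi * \<i>" using yz by (simp add: algebra_simps)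
    then have "exp (l z) = exp (l y)" by (simp add: exp_add)
    then have "h y = h z" using l(2) yz by (metis diff_add_cancel)
    then have "y = z" using inj yz by (auto simp: inj_on_def)
    then have "b - \<i> * pi = b + \<i> * pi" using yz by simp
    then show False by (simp add: complex_eq_iff)
  qed
  then have "norm (deriv l x) * d \<le> 12 * pi" by (simp add: mult.commute)
  then have "norm (h x - c) * (norm (deriv l x) * d) \<le> norm (h x - c) * (12 * pi)"
    by (rule mult_left_mono) simp
  then show ?thesis by (simp only: dl norm_mult mult_ac)
qed

section \<open>Orbits near infinity and the Fatou set\<close>

lemma holomorphic_funpow:
  assumes "f holomorphic_on UNIV"
  shows "(f ^^ n) holomorphic_on UNIV"
proof (induction n)
  case (Suc n)
  show ?case using holomorphic_on_compose_gen[OF Suc assms] by (simp add: o_def)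
qed (simp add: id_def)

lemma continuous_funpow:
  assumes "f holomorphic_on UNIV"
  shows "continuous_on A (f ^^ n)" "isCont (f ^^ n) x"
  using holomorphic_funpow[OF assms, of n]
  by (auto intro: continuous_on_subset holomorphic_on_imp_continuous_on
      simp: continuous_on_eq_continuous_at dest!: holomorphic_on_imp_continuous_on)

lemma deriv_funpow_Suc:
  assumes "f holomorphic_on UNIV"
  shows "deriv (f ^^ Suc n) x = deriv f ((f ^^ n) x) * deriv (f ^^ n) x"
proof -
  have "deriv (f \<circ> (f ^^ n)) x = deriv f ((f ^^ n) x) * deriv (f ^^ n) x"
    using assms holomorphic_funpow[OF assms, of n]
    by (intro deriv_chain) (auto simp: holomorphic_on_open field_differentiable_def)
  then show ?thesis by simp
qed

lemma entire_constant_on_open: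
  assumes f: "f holomorphic_on UNIV" and U: "open U" "U \<noteq> {}" and c: "f constant_on U"
  shows "f constant_on UNIV"
proof -
  obtain y where y: "\<And>x. x \<in> U \<Longrightarrow> f x = y" using c by (auto simp: constant_on_def)
  have "f x = y" for x
    by (rule analytic_continuation_open[of U UNIV f "\<lambda>_. y"]) (use U f y in auto)
  then show ?thesis by (auto simp: constant_on_def)
qed

lemma transcendental_not_constant:
  assumes "\<not> (\<exists>p. \<forall>z. f z = poly p z)"
  shows "\<not> f constant_on UNIV"
proof
  assume "f constant_on UNIV"
  then obtain y where "\<And>x. f x = y" by (auto simp: constant_on_def)
  then have "\<forall>z. f z = poly [:y:] z" by simp
  then show False using assms by blast
qed

text \<open>Were \<open>f ^^ Suc n\<close> constant, \<open>f ^^ n\<close> would be constant on the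
  open set \<open>range f\<close>, hence everywhere by the identity theorem.\<close>

lemma funpow_not_constant:
  fixes f :: "complex \<Rightarrow> complex"
  assumes f: "f holomorphic_on UNIV" and nc: "\<not> f constant_on UNIV"
  shows "\<not> (f ^^ n) constant_on UNIV"
proof (induction n)
  case 0
  have "(0 :: complex) \<noteq> 1" by simp
  then show ?case unfolding constant_on_def by (metis UNIV_I funpow_0)
next
  case (Suc n)
  show ?case
  proof
    assume "(f ^^ Suc n) constant_on UNIV"
    then obtain c where c: "\<And>z. (f ^^ n) (f z) = c" by (auto simp: constant_on_def funpow_swap1)
    have "open (f ` UNIV)"
      using open_mapping_thm[OF f open_UNIV connected_UNIV open_UNIV] nc by auto
    moreover have "(f ^^ n) constant_on (f ` UNIV)" using c by (auto simp: constant_on_def)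
    ultimately have "(f ^^ n) constant_on UNIV"
      using entire_constant_on_open[OF holomorphic_funpow[OF f]] by auto
    then show False using Suc by simp
  qed
qed

lemma open_image_funpow:
  fixes f :: "complex \<Rightarrow> complex"
  assumes f: "f holomorphic_on UNIV" and nc: "\<not> f constant_on UNIV" and U: "open U"
  shows "open ((f ^^ n) ` U)"
  using open_mapping_thm[OF holomorphic_funpow[OF f] open_UNIV connected_UNIV U, of n] funpow_not_constant[OF f nc, of n] by auto

text \<open>The Eremenko-Lyubich setting. The bound on \<open>f 0\<close> keeps the origin out of
  the set where \<open>norm (f z) > exp M\<close>, so that inverse branches into this set have
  logarithms.\<close>

locale class_B =
  fixes f :: "complex \<Rightarrow> complex" and M :: real
  assumes hol: "f holomorphic_on UNIV"
    and not_poly: "\<not> (\<exists>p. \<forall>z. f z = poly p z)"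
    and regular: "norm w > exp M \<Longrightarrow> regular_value f w"
    and f0: "norm (f 0) \<le> exp M"
begin

text \<open>\<open>g\<close> parametrises the tract containing \<open>z\<close>: it inverts a
  logarithm of \<open>f\<close> there.\<close>

lemma exp_lift:
  assumes z: "norm (f z) > exp M"
  obtains g \<zeta> where "g holomorphic_on rhp M" "\<And>x. x \<in> rhp M \<Longrightarrow> f (g x) = exp x" "\<zeta> \<in> rhp M" "g \<zeta> = z"
    "inj_on g (rhp M)" "\<And>x. x \<in> rhp M \<Longrightarrow> g x \<noteq> 0" "exp \<zeta> = f z"
proof -
  have nz: "f z \<noteq> 0" using z by (metis norm_zero not_exp_less_zero)
  define \<zeta> where "\<zeta> = Ln (f z)"
  have e: "exp \<zeta> = f z" using nz by (simp add: \<zeta>_def)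
  then have "exp (Re \<zeta>) > exp M" using z by (metis norm_exp_eq_Re)
  then have \<zeta>: "\<zeta> \<in> rhp M" by simp
  have "\<exists>v. v holomorphic_on rhp M \<and> v \<zeta> = z \<and> (\<forall>x\<in>rhp M. f (v x) = exp x)"
    by (rule holomorphic_lift_rhp[OF hol _ _ \<zeta>]) (use regular e in \<open>auto intro: holomorphic_intros\<close>)
  then obtain g where g: "g holomorphic_on rhp M" "g \<zeta> = z" "\<And>x. x \<in> rhp M \<Longrightarrow> f (g x) = exp x" by blast
  have "g x \<noteq> 0" if "x \<in> rhp M" for x
  proof
    assume "g x = 0"
    then have "norm (exp x) \<le> exp M" using g(3)[OF that] f0 by simp
    then show False using that by simp
  qed
  then show ?thesis using that g \<zeta> e inj_on_exp_lift[OF hol not_poly g(1,3)] by blast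
qed

text \<open>The Eremenko-Lyubich estimate, here with constant \<open>12 * pi\<close>: apply
  \<open>injective_log_deriv_bound\<close> with \<open>c = 0\<close> to the inverse branch, on the
  largest disc about \<open>\<zeta>\<close> in the half-plane.\<close>

lemma expansion:
  assumes z: "norm (f z) > exp M"
  shows "norm (f z) * (ln (norm (f z)) - M) \<le> 12 * pi * (norm z * norm (deriv f z))"
proof -
  obtain g \<zeta> where g: "g holomorphic_on rhp M" "\<And>x. x \<in> rhp M \<Longrightarrow> f (g x) = exp x" "\<zeta> \<in> rhp M" "g \<zeta> = z"
    "inj_on g (rhp M)" "\<And>x. x \<in> rhp M \<Longrightarrow> g x \<noteq> 0" "exp \<zeta> = f z" using exp_lift[OF z] by blast
  define d where "d = Re \<zeta> - M"
  have d: "d > 0" using g(3) by (simp add: d_def)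
  have sub: "ball \<zeta> d \<subseteq> rhp M" unfolding d_def by (rule ball_subset_rhp)
  have "norm (deriv g \<zeta>) * d \<le> 12 * pi * norm (g \<zeta> - 0)"
    by (rule injective_log_deriv_bound) (use g sub d in \<open>auto intro: holomorphic_on_subset inj_on_subset\<close>)
  then have b: "norm (deriv g \<zeta>) * d \<le> 12 * pi * norm z" using g by simp
  have "(g has_field_derivative deriv g \<zeta>) (at \<zeta>)"
    using g(1,3) by (metis holomorphic_derivI open_rhp)
  moreover have "(f has_field_derivative deriv f (g \<zeta>)) (at (g \<zeta>))"
    using hol by (metis UNIV_I holomorphic_derivI open_UNIV)
  ultimately have "((\<lambda>x. f (g x)) has_field_derivative deriv f (g \<zeta>) * deriv g \<zeta>) (at \<zeta>)"
    using DERIV_chain2 by blast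
  then have "(exp has_field_derivative deriv f (g \<zeta>) * deriv g \<zeta>) (at \<zeta>)"
    by (rule has_field_derivative_transform_within_open[OF _ open_rhp g(3)]) (use g in auto)
  moreover have "(exp has_field_derivative exp \<zeta>) (at \<zeta>)" by (rule DERIV_exp)
  ultimately have "deriv f z * deriv g \<zeta> = f z" using DERIV_unique g by metis
  then have eq: "norm (f z) = norm (deriv f z) * norm (deriv g \<zeta>)" by (metis norm_mult)
  have "norm (f z) = exp (Re \<zeta>)" using g(7) by (metis norm_exp_eq_Re)
  then have "ln (norm (f z)) - M = d" by (simp add: d_def)
  then have "norm (f z) * (ln (norm (f z)) - M) = norm (deriv f z) * (norm (deriv g \<zeta>) * d)" using eq by simp
  also have "\<dots> \<le> norm (deriv f z) * (12 * pi * norm z)" using b by (rule mult_left_mono) simp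
  finally show ?thesis by (simp add: mult_ac)
qed

text \<open>A tract is simply connected and omits the origin, so it contains no closed curve winding
  around the origin.\<close>

lemma no_circle_in_tract:
  assumes s: "s > pi" and big: "\<And>y. y \<in> ball b s \<Longrightarrow> norm (f (exp y)) > exp M"
  shows False
proof -
  let ?D = "ball b s"
  have bD: "b \<in> ?D" using s pi_gt_zero by (simp del: pi_gt_zero)
  have fe: "(\<lambda>y. f (exp y)) holomorphic_on ?D"
    by (rule holomorphic_on_compose_gen[OF _ hol, unfolded o_def]) (auto intro: holomorphic_intros)
  have "f (exp y) \<noteq> 0" if "y \<in> ?D" for y using big[OF that] by (metis norm_zero not_exp_less_zero)
  then obtain m where m: "m holomorphic_on ?D" "\<And>y. y \<in> ?D \<Longrightarrow> exp (m y) = f (exp y)"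
    using holomorphic_logarithm_exists[OF convex_ball open_ball fe _ bD] by blast
  have mr: "m y \<in> rhp M" if "y \<in> ?D" for y
    using big[OF that] m(2)[OF that] by (metis exp_less_cancel_iff mem_rhp norm_exp_eq_Re)
  obtain g \<zeta> where g: "g holomorphic_on rhp M" "\<And>x. x \<in> rhp M \<Longrightarrow> f (g x) = exp x" "\<zeta> \<in> rhp M" "g \<zeta> = exp b"
    "inj_on g (rhp M)" "\<And>x. x \<in> rhp M \<Longrightarrow> g x \<noteq> 0" "exp \<zeta> = f (exp b)" using exp_lift[OF big[OF bD]] by blast
  obtain n where n: "\<zeta> = m b + complex_of_real (of_int (2 * n) * pi) * \<i>"
  proof -
    have "exp \<zeta> = exp (m b)" using g(7) m(2)[OF bD] by simp
    then show ?thesis using that unfolding exp_eq by blast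
  qed
  \<comment> \<open>\<open>\<zeta>\<close> and \<open>m b\<close> are logarithms of the same value.
    Shifting by their difference makes \<open>g (m y + c)\<close> equal to \<open>exp y\<close> at
    \<open>y = b\<close>, hence on the whole disc.\<close>
  define c where "c = complex_of_real (of_int (2 * n) * pi) * \<i>"
  have ec: "exp (x + c) = exp x" for x unfolding c_def by (subst exp_eq) blast
  have mc: "m y + c \<in> rhp M" if "y \<in> ?D" for y using mr[OF that] by (simp add: c_def)
  have mch: "(\<lambda>y. m y + c) holomorphic_on ?D" by (intro holomorphic_intros m)
  have gm: "g (m y + c) = exp y" if "y \<in> ?D" for y
  proof (rule lift_unique[where h = f and X = ?D and u = "\<lambda>y. g (m y + c)" and v = exp and ?x0.0 = b])
    have "(\<lambda>y. g (m y + c)) holomorphic_on ?D"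
      by (rule holomorphic_on_compose_gen[OF mch g(1), unfolded o_def]) (use mc in auto)
    then show "continuous_on ?D (\<lambda>y. g (m y + c))" by (rule holomorphic_on_imp_continuous_on)
    show "f (g (m x + c)) = f (exp x)" if "x \<in> ?D" for x using g(2)[OF mc[OF that]] ec m(2)[OF that] by simp
    show "deriv f (g (m x + c)) \<noteq> 0" if "x \<in> ?D" for x
      by (rule deriv_nonzero_of_exp[OF hol g(1) open_rhp g(2) mc[OF that]])
    show "g (m b + c) = exp b" using g(4) n by (simp add: c_def)
  qed (use hol bD that in \<open>auto intro!: continuous_intros\<close>)
  obtain l where l: "l holomorphic_on rhp M" "\<And>x. x \<in> rhp M \<Longrightarrow> exp (l x) = g x"
    using holomorphic_logarithm_exists[OF convex_rhp open_rhp g(1,6) g(3)] by blast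
  define e where "e = l (m b + c) - b"
  have ee: "exp e = 1" using l(2)[OF mc[OF bD]] gm[OF bD] by (simp add: e_def exp_diff)
  have lm: "l (m y + c) = y + e" if "y \<in> ?D" for y
  proof (rule lift_unique[where h = exp and X = ?D and u = "\<lambda>y. l (m y + c)" and v = "\<lambda>y. y + e" and ?x0.0 = b])
    have "(\<lambda>y. l (m y + c)) holomorphic_on ?D"
      by (rule holomorphic_on_compose_gen[OF mch l(1), unfolded o_def]) (use mc in auto)
    then show "continuous_on ?D (\<lambda>y. l (m y + c))" by (rule holomorphic_on_imp_continuous_on)
    show "exp (l (m x + c)) = exp (x + e)" if "x \<in> ?D" for x using l(2)[OF mc[OF that]] gm[OF that] ee by (simp add: exp_add)
    have "deriv exp x = exp x" for x :: complex by (rule DERIV_imp_deriv) (rule DERIV_exp)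
    then show "deriv exp (l (m x + c)) \<noteq> 0" if "x \<in> ?D" for x by simp
  qed (use bD that in \<open>auto intro!: continuous_intros holomorphic_intros simp: e_def\<close>)
  have y: "b - \<i> * pi \<in> ?D" "b + \<i> * pi \<in> ?D" using s by (auto simp: dist_norm norm_mult)
  \<comment> \<open>These two points have the same exponential, so injectivity of \<open>g\<close>
    gives them the same \<open>m\<close>. But \<open>l (m y + c) = y + e\<close> separates
    them.\<close>
  have "b + \<i> * pi = b - \<i> * pi + 2 * of_real pi * \<i>" by (simp add: algebra_simps)
  then have "exp (b + \<i> * pi) = exp (b - \<i> * pi)" by (simp only: exp_add) simp
  then have "g (m (b - \<i> * pi) + c) = g (m (b + \<i> * pi) + c)" using gm y by simp
  then have "m (b - \<i> * pi) + c = m (b + \<i> * pi) + c" using inj_onD[OF g(5)] mc y by blast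
  then have "b - \<i> * pi + e = b + \<i> * pi + e" using lm[OF y(1)] lm[OF y(2)] by simp
  then show False by (simp add: complex_eq_iff)
qed

text \<open>The logarithmic derivative of \<open>f ^^ i\<close> at \<open>a\<close> at least doubles
  with each step. By Bloch, a logarithm of \<open>f ^^ i\<close> on a fixed disc eventually covers a
  disc of radius above \<open>pi\<close>, where \<open>norm (f (exp y)) > exp M\<close>: impossible
  by \<open>no_circle_in_tract\<close>.\<close>

lemma no_open_set_near_infinity:
  assumes B: "open B" "a \<in> B" and big: "\<And>x i. x \<in> B \<Longrightarrow> i \<ge> 1 \<Longrightarrow> norm ((f ^^ i) x) \<ge> R"
    and R: "R \<ge> exp (M + 24 * pi)"
  shows False
proof -
  obtain \<beta> where \<beta>: "\<beta> > 0" "ball a \<beta> \<subseteq> B" using B open_contains_ball by blast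
  have RM: "R > exp M" using R by (rule less_le_trans[rotated]) simp
  have R0: "R > 0" using R by (meson exp_gt_zero less_le_trans)
  \<comment> \<open>Growth is counted from \<open>i = 1\<close>, since points of \<open>B\<close>
    itself may be small. The \<open>24 * pi\<close> in the bound for \<open>R\<close> makes
    \<open>expansion\<close> yield the factor 2.\<close>
  define D where "D i = norm (deriv (f ^^ i) a) / norm ((f ^^ i) a)" for i
  have "regular_value f (f a)" using regular big[OF B(2), of 1] RM by simp
  then have "deriv f a \<noteq> 0" by (rule regular_value_deriv)
  moreover have "f a \<noteq> 0" using big[OF B(2), of 1] R0 by auto
  ultimately have D1: "D 1 > 0" by (simp add: D_def)
  have step: "D (Suc i) \<ge> 2 * D i" if "i \<ge> 1" for i
  proof -
    define z where "z = (f ^^ i) a"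
    have z: "norm z \<ge> R" using big[OF B(2) that] by (simp add: z_def)
    have fz: "norm (f z) \<ge> R" using big[OF B(2), of "Suc i"] by (simp add: z_def)
    have "ln (exp (M + 24 * pi)) \<le> ln (norm (f z))" using fz R R0 by (subst ln_le_cancel_iff) auto
    then have "24 * pi \<le> ln (norm (f z)) - M" by simp
    then have "norm (f z) * (24 * pi) \<le> norm (f z) * (ln (norm (f z)) - M)" by (rule mult_left_mono) simp
    also have "\<dots> \<le> 12 * pi * (norm z * norm (deriv f z))" using fz RM by (intro expansion) simp
    finally have "12 * pi * (2 * norm (f z)) \<le> 12 * pi * (norm z * norm (deriv f z))" by (simp add: mult_ac)
    then have "2 * norm (f z) \<le> norm z * norm (deriv f z)" by (subst (asm) mult_le_cancel_left_pos) auto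
    moreover have "norm z > 0" "norm (f z) > 0" using z fz R0 by linarith+
    ultimately have k: "2 / norm z \<le> norm (deriv f z) / norm (f z)" by (simp add: divide_simps mult_ac)
    have "2 * D i = 2 / norm z * norm (deriv (f ^^ i) a)" by (simp add: D_def z_def)
    also have "\<dots> \<le> norm (deriv f z) / norm (f z) * norm (deriv (f ^^ i) a)" using k by (rule mult_right_mono) simp
    also have "\<dots> = D (Suc i)" by (simp add: D_def deriv_funpow_Suc[OF hol] z_def norm_mult del: funpow.simps) simp
    finally show ?thesis .
  qed
  have grow: "D (Suc i) \<ge> 2 ^ i * D 1" for i
  proof (induction i)
    case (Suc i)
    have "2 ^ Suc i * D 1 \<le> 2 * D (Suc i)" using Suc by simp
    also have "\<dots> \<le> D (Suc (Suc i))" by (rule step) simp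
    finally show ?case .
  qed simp
  obtain n where n: "12 * (pi + 1) / (\<beta> * D 1) < 2 ^ n" using real_arch_pow[of 2] by auto
  define i where "i = Suc n"
  have "12 * (pi + 1) < \<beta> * (2 ^ n * D 1)" using n \<beta> D1 by (simp add: field_simps)
  also have "\<dots> \<le> \<beta> * D i" using grow[of n] \<beta> by (simp add: i_def)
  finally have Di: "\<beta> * D i / 12 > pi" by simp
  have fi: "(f ^^ i) holomorphic_on ball a \<beta>" using holomorphic_funpow[OF hol] holomorphic_on_subset by blast
  have nz: "(f ^^ i) x \<noteq> 0" if "x \<in> ball a \<beta>" for x
    using big[of x i] that \<beta> R0 by (auto simp: i_def)
  have ain: "a \<in> ball a \<beta>" using \<beta> by simp
  obtain l where l: "l holomorphic_on ball a \<beta>" "\<And>x. x \<in> ball a \<beta> \<Longrightarrow> exp (l x) = (f ^^ i) x"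
    using holomorphic_logarithm_exists[OF convex_ball open_ball fi nz ain] by blast
  have "(l has_field_derivative deriv l a) (at a)" using l ain by (metis holomorphic_derivI open_ball)
  then have "((\<lambda>y. exp (l y)) has_field_derivative exp (l a) * deriv l a) (at a)"
    by (rule DERIV_chain2[OF DERIV_exp])
  then have "((f ^^ i) has_field_derivative exp (l a) * deriv l a) (at a)"
    by (rule has_field_derivative_transform_within_open[OF _ open_ball ain]) (use l in auto)
  then have "deriv (f ^^ i) a = (f ^^ i) a * deriv l a" using l(2)[OF ain] by (simp add: DERIV_imp_deriv)
  then have "norm (deriv l a) = D i" using nz[OF ain] by (simp add: D_def norm_mult)
  then obtain b where b: "ball b (\<beta> * D i / 12) \<subseteq> l ` ball a \<beta>"
    using Bloch[OF l(1) \<beta>(1), of "\<beta> * D i / 12"] by auto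
  show False
  proof (rule no_circle_in_tract[OF Di])
    fix y assume "y \<in> ball b (\<beta> * D i / 12)"
    then obtain x where x: "x \<in> ball a \<beta>" "y = l x" using b by blast
    then have "f (exp y) = (f ^^ Suc i) x" using l by simp
    then show "norm (f (exp y)) > exp M" using big[of x "Suc i"] x \<beta> RM by (auto simp del: funpow.simps)
  qed
qed

end

section \<open>Normality, orbits of Fatou points, and boundedness of the postsingular set\<close>

lemma fatou_normal_subsequence:
  assumes "a \<in> fatou_set f"
  obtains e r where "e > 0" "strict_mono (r :: nat \<Rightarrow> nat)"
    "(\<exists>g. uniform_limit (cball a e) (\<lambda>k. f ^^ i (r k)) g sequentially)
     \<or> (\<forall>M. \<forall>\<^sub>F k in sequentially. \<forall>z\<in>cball a e. norm ((f ^^ i (r k)) z) \<ge> M)"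
proof -
  obtain U where U: "open U" "a \<in> U" "normal_family U (range (\<lambda>n. f ^^ n))"
    using assms by (auto simp: fatou_set_def)
  obtain e where e: "e > 0" "cball a e \<subseteq> U" using U open_contains_cball by blast
  have "\<forall>k. f ^^ i k \<in> range (\<lambda>n. f ^^ n)" by blast
  then obtain r where r: "strict_mono r" and alt:
    "(\<exists>g. \<forall>K. compact K \<and> K \<subseteq> U \<longrightarrow> uniform_limit K (\<lambda>k. f ^^ i (r k)) g sequentially)
     \<or> (\<forall>K. compact K \<and> K \<subseteq> U \<longrightarrow> (\<forall>M. eventually (\<lambda>k. \<forall>z\<in>K. norm ((f ^^ i (r k)) z) \<ge> M) sequentially))"
    using U(3)[unfolded normal_family_def, rule_format, of "\<lambda>k. f ^^ i k"] by blast
  have K: "compact (cball a e) \<and> cball a e \<subseteq> U" using e(2) by simp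
  show ?thesis
    by (rule that[OF e(1) r]) (use alt K in \<open>elim disj_forward ex_forward all_forward, simp_all\<close>)
qed

text \<open>Otherwise points \<open>x k\<close> tending to \<open>a\<close> are mapped below
  \<open>R / 2\<close> at times \<open>i k\<close> when \<open>a\<close> is mapped above
  \<open>R\<close>. A finite uniform limit along a subsequence would be discontinuous at
  \<open>a\<close>, and uniform divergence to infinity fails at the \<open>x k\<close>.\<close>

lemma fatou_nbhd_lower_bound:
  assumes f: "f holomorphic_on UNIV" and a: "a \<in> fatou_set f" and R: "R > 0"
    and big: "\<And>i. i \<ge> i0 \<Longrightarrow> norm ((f ^^ i) a) \<ge> R"
  shows "\<exists>\<beta>>0. \<forall>x\<in>ball a \<beta>. \<forall>i\<ge>i0. norm ((f ^^ i) x) \<ge> R / 2"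
proof (rule ccontr)
  assume neg: "\<not> ?thesis"
  have "\<forall>k::nat. \<exists>x i. x \<in> ball a (1 / (real k + 1)) \<and> i \<ge> i0 \<and> norm ((f ^^ i) x) < R / 2"
  proof
    fix k :: nat
    have "1 / (real k + 1) > 0" by simp
    then show "\<exists>x i. x \<in> ball a (1 / (real k + 1)) \<and> i \<ge> i0 \<and> norm ((f ^^ i) x) < R / 2"
      using neg by (meson not_le)
  qed
  then obtain x i where x: "\<And>k::nat. x k \<in> ball a (1 / (real k + 1))"
    and i: "\<And>k. i k \<ge> i0" and small: "\<And>k. norm ((f ^^ i k) (x k)) < R / 2" by metis
  obtain e r where e: "e > 0" and r: "strict_mono r" and alt:
    "(\<exists>g. uniform_limit (cball a e) (\<lambda>k. f ^^ i (r k)) g sequentially)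
     \<or> (\<forall>M. \<forall>\<^sub>F k in sequentially. \<forall>z\<in>cball a e. norm ((f ^^ i (r k)) z) \<ge> M)"
    by (rule fatou_normal_subsequence[OF a, of i])
  have xlim: "x \<longlonglongrightarrow> a"
  proof (rule metric_LIMSEQ_I)
    fix d :: real assume "d > 0"
    then obtain N where N: "1 / (real N + 1) < d" by (metis nat_approx_posE of_nat_Suc add.commute)
    have "dist (x n) a < d" if "n \<ge> N" for n
    proof -
      have "dist (x n) a < 1 / (real n + 1)" using x[of n] by (simp add: dist_commute)
      also have "\<dots> \<le> 1 / (real N + 1)" using that by (intro divide_left_mono) auto
      finally show ?thesis using N by simp
    qed
    then show "\<exists>no. \<forall>n\<ge>no. dist (x n) a < d" by blast
  qed
  then have xr: "(\<lambda>k. x (r k)) \<longlonglongrightarrow> a" using LIMSEQ_subseq_LIMSEQ[OF _ r] by (simp add: o_def)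
  then have xin: "\<forall>\<^sub>F k in sequentially. x (r k) \<in> cball a e"
    using e by (auto simp: tendsto_iff dist_commute elim!: eventually_mono allE[of _ e])
  from alt show False
  proof
    assume "\<exists>g. uniform_limit (cball a e) (\<lambda>k. f ^^ i (r k)) g sequentially"
    then obtain g where g: "uniform_limit (cball a e) (\<lambda>k. f ^^ i (r k)) g sequentially" ..
    have gc: "continuous_on (cball a e) g"
      by (rule uniform_limit_theorem[OF _ g]) (auto intro!: always_eventually continuous_funpow f)
    have "(\<lambda>k. (f ^^ i (r k)) a) \<longlonglongrightarrow> g a" using tendsto_uniform_limitI[OF g] e by simp
    then have "(\<lambda>k. norm ((f ^^ i (r k)) a)) \<longlonglongrightarrow> norm (g a)" by (rule tendsto_norm)
    then have ge: "norm (g a) \<ge> R" by (rule LIMSEQ_le_const) (use big i in auto)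
    have "(\<lambda>k. g (x (r k))) \<longlonglongrightarrow> g a"
      by (rule continuous_on_tendsto_compose[OF gc xr _ xin]) (use e in auto)
    moreover have "(\<lambda>k. (f ^^ i (r k)) (x (r k)) - g (x (r k))) \<longlonglongrightarrow> 0"
    proof (rule tendstoI)
      fix d :: real assume "d > 0"
      then have "\<forall>\<^sub>F k in sequentially. \<forall>z\<in>cball a e. dist ((f ^^ i (r k)) z) (g z) < d"
        using g by (auto simp: uniform_limit_iff)
      then show "\<forall>\<^sub>F k in sequentially. dist ((f ^^ i (r k)) (x (r k)) - g (x (r k))) 0 < d"
        using xin by eventually_elim (simp add: dist_norm)
    qed
    ultimately have "(\<lambda>k. ((f ^^ i (r k)) (x (r k)) - g (x (r k))) + g (x (r k))) \<longlonglongrightarrow> 0 + g a"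
      by (intro tendsto_add)
    then have "(\<lambda>k. norm ((f ^^ i (r k)) (x (r k)))) \<longlonglongrightarrow> norm (g a)" by (auto intro: tendsto_norm)
    then have "norm (g a) \<le> R / 2" by (rule LIMSEQ_le_const2) (use small in \<open>auto intro: less_imp_le\<close>)
    then show False using ge R by simp
  next
    assume "\<forall>M. \<forall>\<^sub>F k in sequentially. \<forall>z\<in>cball a e. norm ((f ^^ i (r k)) z) \<ge> M"
    then have "\<forall>\<^sub>F k in sequentially. \<forall>z\<in>cball a e. norm ((f ^^ i (r k)) z) \<ge> R" ..
    then have "\<forall>\<^sub>F k in sequentially. False"
      using xin
    proof eventually_elim
      case (elim k)
      then have "norm ((f ^^ i (r k)) (x (r k))) \<ge> R" by blast
      then show False using small[of "r k"] R by simp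
    qed
    then show False by simp
  qed
qed

text \<open>\<open>f ^^ n\<close> near \<open>z\<close> is \<open>f ^^ (n - 1)\<close> near
  \<open>f z\<close>. The zeroth iterate has no such predecessor, hence the case split on whether it
  occurs infinitely often in the given sequence.\<close>

lemma fatou_backward_invariant:
  assumes f: "f holomorphic_on UNIV" and z: "f z \<in> fatou_set f"
  shows "z \<in> fatou_set f"
proof -
  obtain U where U: "open U" "f z \<in> U" "normal_family U (range (\<lambda>n. f ^^ n))"
    using z by (auto simp: fatou_set_def)
  have fc: "continuous_on A f" for A using f by (meson continuous_on_subset holomorphic_on_imp_continuous_on subset_UNIV)
  have "normal_family (f -` U) (range (\<lambda>n. f ^^ n))"
    unfolding normal_family_def
  proof (intro allI impI)
    fix s :: "nat \<Rightarrow> complex \<Rightarrow> complex" assume "\<forall>k. s k \<in> range (\<lambda>n. f ^^ n)"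
    then have "\<forall>k. \<exists>n. s k = f ^^ n" by blast
    then obtain n where n: "\<And>k. s k = f ^^ n k" by metis
    let ?goal = "\<lambda>r. (\<exists>g. \<forall>K. compact K \<and> K \<subseteq> f -` U \<longrightarrow> uniform_limit K (\<lambda>k. s (r k)) g sequentially)
            \<or> (\<forall>K. compact K \<and> K \<subseteq> f -` U \<longrightarrow>
                 (\<forall>M. eventually (\<lambda>k. \<forall>z\<in>K. norm (s (r k) z) \<ge> M) sequentially))"
    show "\<exists>r. strict_mono r \<and> ?goal r"
    proof (cases "\<exists>\<^sub>\<infinity>k. n k = 0")
      case True
      then have inf: "infinite {k. n k = 0}" by (simp add: INFM_iff_infinite)
      define r where "r = enumerate {k. n k = 0}"
      have r: "strict_mono r" "\<And>k. n (r k) = 0"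
        using inf enumerate_in_set[OF inf] by (auto simp: r_def strict_mono_enumerate)
      have "uniform_limit K (\<lambda>k. s (r k)) id sequentially" for K :: "complex set"
        by (simp add: n r uniform_limit_iff id_def)
      then show ?thesis using r by blast
    next
      case False
      then obtain k0 where k0: "\<And>k. k \<ge> k0 \<Longrightarrow> n k \<noteq> 0"
        by (auto simp: INFM_nat_le)
      define s' where "s' k = f ^^ (n (k + k0) - 1)" for k
      have "\<forall>k. s' k \<in> range (\<lambda>n. f ^^ n)" by (auto simp: s'_def)
      then obtain r where r: "strict_mono r" and alt:
        "(\<exists>g. \<forall>K. compact K \<and> K \<subseteq> U \<longrightarrow> uniform_limit K (\<lambda>k. s' (r k)) g sequentially)
         \<or> (\<forall>K. compact K \<and> K \<subseteq> U \<longrightarrow> (\<forall>M. eventually (\<lambda>k. \<forall>z\<in>K. norm (s' (r k) z) \<ge> M) sequentially))"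
        using U(3)[unfolded normal_family_def, rule_format, of s'] by blast
      define q where "q k = r k + k0" for k
      have q: "strict_mono q" using r by (auto simp: q_def strict_mono_def)
      have sq: "s (q k) z = s' (r k) (f z)" for k z
      proof -
        obtain j where "n (q k) = Suc j" using k0[of "q k"] by (auto simp: q_def gr0_conv_Suc)
        then show ?thesis by (simp add: n s'_def q_def funpow_swap1)
      qed
      have fK: "compact (f ` K) \<and> f ` K \<subseteq> U" if "compact K \<and> K \<subseteq> f -` U" for K
        using that compact_continuous_image[OF fc] by blast
      from alt have "?goal q"
      proof
        assume "\<exists>g. \<forall>K. compact K \<and> K \<subseteq> U \<longrightarrow> uniform_limit K (\<lambda>k. s' (r k)) g sequentially"
        then obtain g where g: "\<And>K. compact K \<and> K \<subseteq> U \<Longrightarrow> uniform_limit K (\<lambda>k. s' (r k)) g sequentially" by blast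
        have "uniform_limit K (\<lambda>k. s (q k)) (\<lambda>z. g (f z)) sequentially" if "compact K \<and> K \<subseteq> f -` U" for K
          using g[OF fK[OF that]] by (simp add: uniform_limit_iff sq)
        then show ?thesis by blast
      next
        assume *: "\<forall>K. compact K \<and> K \<subseteq> U \<longrightarrow> (\<forall>M. eventually (\<lambda>k. \<forall>z\<in>K. norm (s' (r k) z) \<ge> M) sequentially)"
        have "eventually (\<lambda>k. \<forall>z\<in>K. norm (s (q k) z) \<ge> M) sequentially" if "compact K \<and> K \<subseteq> f -` U" for K M
          using *[rule_format, OF fK[OF that], of M] by (simp add: sq)
        then show ?thesis by blast
      qed
      then show ?thesis using q by blast
    qed
  qed
  moreover have "open (f -` U)" using fc[of UNIV] U(1) by (simp add: continuous_on_open_vimage)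
  ultimately show ?thesis using U(2) by (auto simp: fatou_set_def intro!: exI[of _ "f -` U"])
qed

lemma julia_funpow:
  assumes "f holomorphic_on UNIV" "z \<in> julia_set f"
  shows "(f ^^ n) z \<in> julia_set f"
  by (induction n) (use assms fatou_backward_invariant[OF assms(1)] in \<open>auto simp: julia_set_def\<close>)

lemma postsingular_forward:
  assumes f: "f holomorphic_on UNIV" and z: "z \<in> postsingular_set f"
  shows "f z \<in> postsingular_set f"
proof -
  let ?A = "\<Union>n. (f ^^ n) ` singular_set f"
  have "f ` closure ?A \<subseteq> closure (f ` ?A)"
    by (rule continuous_image_closure_subset[of UNIV]) (use f in \<open>auto intro: holomorphic_on_imp_continuous_on\<close>)
  also have "f ` ?A \<subseteq> ?A"
  proof
    fix y assume "y \<in> f ` ?A"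
    then obtain n s where "s \<in> singular_set f" "y = (f ^^ Suc n) s" by auto
    then show "y \<in> ?A" by blast
  qed
  then have "closure (f ` ?A) \<subseteq> closure ?A" by (rule closure_mono)
  finally show ?thesis using z by (auto simp: postsingular_set_def)
qed

lemma singular_subset_postsingular: "singular_set f \<subseteq> postsingular_set f"
proof -
  have "(f ^^ 0) ` singular_set f \<subseteq> (\<Union>n. (f ^^ n) ` singular_set f)" by blast
  then show ?thesis using closure_subset by (auto simp: postsingular_set_def)
qed

text \<open>The factor 2 pays for the loss in \<open>fatou_nbhd_lower_bound\<close>. The image of
  the resulting disc under \<open>f ^^ i0\<close> is an open set of the kind excluded by
  \<open>no_open_set_near_infinity\<close>.\<close>

lemma orbit_near_infinity_in_julia:
  assumes cB: "class_B f M" and R: "R \<ge> 2 * exp (M + 24 * pi)"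
    and big: "\<And>i. i \<ge> i0 \<Longrightarrow> norm ((f ^^ i) a) \<ge> R"
  shows "a \<in> julia_set f"
proof (rule ccontr)
  interpret class_B f M by (rule cB)
  assume "a \<notin> julia_set f"
  then have a: "a \<in> fatou_set f" by (simp add: julia_set_def)
  have "exp (M + 24 * pi) > 0" by simp
  then have R0: "R > 0" using R by linarith
  obtain \<beta> where \<beta>: "\<beta> > 0" "\<And>x i. x \<in> ball a \<beta> \<Longrightarrow> i \<ge> i0 \<Longrightarrow> norm ((f ^^ i) x) \<ge> R / 2"
    using fatou_nbhd_lower_bound[OF hol a R0 big] by blast
  let ?B = "(f ^^ i0) ` ball a \<beta>"
  have "open ?B"
    using open_image_funpow[OF hol transcendental_not_constant[OF not_poly]] by simp
  moreover have "(f ^^ i0) a \<in> ?B" using \<beta>(1) by simp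
  ultimately show False
  proof (rule no_open_set_near_infinity)
    fix x i assume "x \<in> ?B"
    then obtain y where y: "y \<in> ball a \<beta>" "x = (f ^^ i0) y" by blast
    then have "(f ^^ i) x = (f ^^ (i + i0)) y" by (simp add: funpow_add)
    then show "norm ((f ^^ i) x) \<ge> R / 2" using \<beta>(2)[OF y(1), of "i + i0"] by simp
  qed (use R in simp)
qed

text \<open>A finite uniform limit near \<open>w\<close> would bound the values at
  \<open>x k\<close>. So a subsequence of iterates tends to infinity uniformly near
  \<open>w\<close>, in particular at \<open>w\<close>.\<close>

lemma fatou_unbounded_orbits:
  assumes f: "f holomorphic_on UNIV" and w: "w \<in> fatou_set f" and x: "x \<longlonglongrightarrow> w"
    and big: "\<And>k::nat. norm ((f ^^ n k) (x k)) \<ge> real k"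
  shows "\<exists>n. norm ((f ^^ n) w) > B"
proof -
  obtain e r where e: "e > 0" and r: "strict_mono r" and alt:
    "(\<exists>g. uniform_limit (cball w e) (\<lambda>k. f ^^ n (r k)) g sequentially)
     \<or> (\<forall>M. \<forall>\<^sub>F k in sequentially. \<forall>z\<in>cball w e. norm ((f ^^ n (r k)) z) \<ge> M)"
    by (rule fatou_normal_subsequence[OF w, of n])
  have xr: "(\<lambda>k. x (r k)) \<longlonglongrightarrow> w" using LIMSEQ_subseq_LIMSEQ[OF x r] by (simp add: o_def)
  then have xin: "\<forall>\<^sub>F k in sequentially. x (r k) \<in> cball w e"
    using e by (auto simp: tendsto_iff dist_commute elim!: eventually_mono allE[of _ e])
  from alt show ?thesis
  proof
    assume "\<exists>g. uniform_limit (cball w e) (\<lambda>k. f ^^ n (r k)) g sequentially"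
    then obtain g where g: "uniform_limit (cball w e) (\<lambda>k. f ^^ n (r k)) g sequentially" ..
    have gc: "continuous_on (cball w e) g"
      by (rule uniform_limit_theorem[OF _ g]) (auto intro!: always_eventually continuous_funpow f)
    obtain D where D: "\<And>z. z \<in> cball w e \<Longrightarrow> norm (g z) \<le> D"
      using compact_imp_bounded[OF compact_continuous_image[OF gc compact_cball]] unfolding bounded_iff by blast
    have "\<forall>\<^sub>F k in sequentially. \<forall>z\<in>cball w e. dist ((f ^^ n (r k)) z) (g z) < 1"
      using g by (auto simp: uniform_limit_iff)
    moreover have "\<forall>\<^sub>F k in sequentially. k > nat \<lceil>D + 1\<rceil>" by (rule eventually_gt_at_top)
    ultimately have "\<forall>\<^sub>F k in sequentially. False"
      using xin
    proof eventually_elim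
      case (elim k)
      then have "dist ((f ^^ n (r k)) (x (r k))) (g (x (r k))) < 1" by blast
      then have "norm ((f ^^ n (r k)) (x (r k))) < D + 1"
        using D[of "x (r k)"] elim(3) norm_triangle_ineq2[of "(f ^^ n (r k)) (x (r k))" "g (x (r k))"]
        by (simp add: dist_norm)
      moreover have "real k \<le> real (r k)" using seq_suble[OF r] by simp
      ultimately have "real k < D + 1" using big[of "r k"] by linarith
      then show False using elim(2) by linarith
    qed
    then show ?thesis by simp
  next
    assume "\<forall>M. \<forall>\<^sub>F k in sequentially. \<forall>z\<in>cball w e. norm ((f ^^ n (r k)) z) \<ge> M"
    then have "\<forall>\<^sub>F k in sequentially. \<forall>z\<in>cball w e. norm ((f ^^ n (r k)) z) \<ge> B + 1" ..
    then obtain k where "\<forall>z\<in>cball w e. norm ((f ^^ n (r k)) z) \<ge> B + 1"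
      using eventually_happens by fastforce
    then have "norm ((f ^^ n (r k)) w) \<ge> B + 1" using e by simp
    then show ?thesis by (intro exI[of _ "n (r k)"]) linarith
  qed
qed

text \<open>An oscillating unbounded orbit makes arbitrarily long excursions outside the disc of radius \<open>R\<close>;
  a limit of their starting points has its whole orbit out there.\<close>

lemma excursion_limit:
  assumes f: "f holomorphic_on UNIV" and unb: "\<And>B. \<exists>n. norm ((f ^^ n) w) > B"
    and osc: "\<And>i0. \<exists>i\<ge>i0. norm ((f ^^ i) w) < R"
  shows "\<exists>a. a \<in> closure (range (\<lambda>n. (f ^^ n) w)) \<and> norm a \<le> R \<and> (\<forall>j\<ge>1. norm ((f ^^ j) a) \<ge> R)"
proof -
  have "\<exists>m. norm ((f ^^ m) w) \<le> R \<and> (\<forall>j. 1 \<le> j \<and> j \<le> k \<longrightarrow> norm ((f ^^ (m + j)) w) > R)" for k :: nat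
  proof -
    obtain D where D: "\<And>j x. j \<le> k \<Longrightarrow> x \<in> cball 0 R \<Longrightarrow> norm ((f ^^ j) x) \<le> D j"
      using entire_bounded_on_compact[OF holomorphic_funpow[OF f] compact_cball] by metis
    obtain i1 where i1: "norm ((f ^^ i1) w) < R" using osc by blast
    \<comment> \<open>At time \<open>n\<close> the orbit is beyond everything the disc of radius
      \<open>R\<close> reaches within \<open>k\<close> steps, so its last visit \<open>m\<close> to
      that disc before \<open>n\<close> is more than \<open>k\<close> steps earlier.\<close>
    obtain n where n: "norm ((f ^^ n) w) > max (Max (D ` {..k})) (Max ((\<lambda>i. norm ((f ^^ i) w)) ` {..i1}))"
      using unb by blast
    then have nw: "norm ((f ^^ n) w) > Max (D ` {..k})" "norm ((f ^^ n) w) > Max ((\<lambda>i. norm ((f ^^ i) w)) ` {..i1})"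
      unfolding max_less_iff_conj by blast+
    have nD: "norm ((f ^^ n) w) > D j" if "j \<le> k" for j
      using nw(1) by (rule le_less_trans[rotated]) (use that in \<open>intro Max_ge, auto\<close>)
    have ni1: "n > i1"
    proof (rule ccontr)
      assume "\<not> i1 < n"
      then have "norm ((f ^^ n) w) \<le> Max ((\<lambda>i. norm ((f ^^ i) w)) ` {..i1})" by (intro Max_ge) auto
      then show False using nw(2) by linarith
    qed
    define A where "A = {i. i \<le> n \<and> norm ((f ^^ i) w) \<le> R}"
    have A: "finite A" "A \<noteq> {}" using i1 ni1 by (auto simp: A_def intro!: exI[of _ i1])
    define m where "m = Max A"
    have m: "m \<in> A" unfolding m_def using A by (rule Max_in)
    have mm: "norm ((f ^^ i) w) > R" if "m < i" "i \<le> n" for i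
      using Max_ge[OF A(1), of i] that unfolding m_def[symmetric] by (force simp: A_def not_le[symmetric])
    have "m + k < n"
    proof (rule ccontr)
      assume "\<not> m + k < n"
      then have k: "n - m \<le> k" by simp
      have "(f ^^ n) w = (f ^^ (n - m)) ((f ^^ m) w)" using m by (simp add: A_def flip: funpow_add comp_apply[of "f ^^ (n - m)"])
      then have "norm ((f ^^ n) w) \<le> D (n - m)" using D[OF k, of "(f ^^ m) w"] m by (simp add: A_def)
      then show False using nD[OF k] by simp
    qed
    then show ?thesis using m mm by (intro exI[of _ m]) (auto simp: A_def)
  qed
  then obtain m where m: "\<And>k. norm ((f ^^ m k) w) \<le> R"
    "\<And>k j. 1 \<le> j \<Longrightarrow> j \<le> k \<Longrightarrow> norm ((f ^^ (m k + j)) w) > R" by metis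
  have "\<forall>k. (f ^^ m k) w \<in> cball 0 R" using m(1) by simp
  then obtain a r where a: "a \<in> cball 0 R" and r: "strict_mono r" and lim: "(\<lambda>k. (f ^^ m (r k)) w) \<longlonglongrightarrow> a"
    using compact_cball[of "0::complex" R] unfolding compact_def by (auto simp: o_def dest!: spec[of _ "\<lambda>k. (f ^^ m k) w"])
  have "norm ((f ^^ j) a) \<ge> R" if "j \<ge> 1" for j
  proof -
    have "(\<lambda>k. (f ^^ j) ((f ^^ m (r k)) w)) \<longlonglongrightarrow> (f ^^ j) a"
      by (rule isCont_tendsto_compose[OF continuous_funpow(2)[OF f] lim])
    then have "(\<lambda>k. norm ((f ^^ j) ((f ^^ m (r k)) w))) \<longlonglongrightarrow> norm ((f ^^ j) a)" by (rule tendsto_norm)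
    then show ?thesis
    proof (rule LIMSEQ_le_const)
      have "R \<le> norm ((f ^^ j) ((f ^^ m (r k)) w))" if "k \<ge> j" for k
      proof -
        have "j \<le> r k" using seq_suble[OF r, of k] that by simp
        from m(2)[OF \<open>j \<ge> 1\<close> this] show ?thesis by (simp add: funpow_add add.commute[of _ j] less_imp_le)
      qed
      then show "\<exists>N. \<forall>k\<ge>N. R \<le> norm ((f ^^ j) ((f ^^ m (r k)) w))" by blast
    qed
  qed
  moreover have "a \<in> closure (range (\<lambda>n. (f ^^ n) w))"
    using lim by (auto simp: closure_sequential intro!: exI[of _ "\<lambda>k. (f ^^ m (r k)) w"])
  ultimately show ?thesis using a by auto
qed

lemma singular_set_bounded:
  assumes "geometrically_finite f"
  shows "bounded (singular_set f)"
proof -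
  have "singular_set f = (singular_set f \<inter> fatou_set f) \<union> (singular_set f \<inter> julia_set f)"
    by (auto simp: julia_set_def)
  moreover have "bounded (singular_set f \<inter> fatou_set f)" using assms by (auto simp: geometrically_finite_def compact_imp_bounded)
  moreover have "singular_set f \<inter> julia_set f \<subseteq> postsingular_set f \<inter> julia_set f"
    using singular_subset_postsingular by blast
  then have "bounded (singular_set f \<inter> julia_set f)"
    using assms finite_subset finite_imp_bounded unfolding geometrically_finite_def by metis
  ultimately show ?thesis by (metis bounded_Un)
qed

lemma regular_value_outside_singular: "w \<notin> singular_set f \<Longrightarrow> regular_value f w"
  using closure_subset[of "critical_values f \<union> asymptotic_values f"]
  by (auto simp: singular_set_def regular_value_def)

lemma class_B_ex:
  assumes f: "transcendental_entire f" and S: "singular_set f \<subseteq> cball 0 B"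
  shows "\<exists>M0. \<forall>M\<ge>M0. class_B f M"
proof (intro exI allI impI)
  fix M assume M: "M \<ge> ln (max 1 (max B (norm (f 0))))"
  have "max 1 (max B (norm (f 0))) = exp (ln (max 1 (max B (norm (f 0)))))" by (subst exp_ln) auto
  also have "\<dots> \<le> exp M" using M by (rule exp_le_cancel_iff[THEN iffD2])
  finally have "max 1 (max B (norm (f 0))) \<le> exp M" .
  then have e: "B \<le> exp M" "norm (f 0) \<le> exp M" unfolding max.bounded_iff by blast+
  show "class_B f M"
  proof
    fix w :: complex assume w: "norm w > exp M"
    have "w \<notin> singular_set f"
    proof
      assume "w \<in> singular_set f"
      then show False using S w e(1) by auto
    qed
    then show "regular_value f w" by (rule regular_value_outside_singular)
  qed (use f e in \<open>auto simp: transcendental_entire_def\<close>)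
qed

text \<open>If singular orbits were not jointly bounded, compactness would give one singular Fatou
  point \<open>w\<close> with unbounded orbit. It cannot remain far out, as it is not in the Julia
  set, so it oscillates; its long excursions accumulate at a postsingular point \<open>a\<close> of
  the Julia set, and \<open>f a\<close> is larger than finiteness of \<open>P(f)\<close> in the
  Julia set allows.\<close>

lemma postsingular_bounded:
  assumes te: "transcendental_entire f" and gf: "geometrically_finite f"
  shows "bounded (postsingular_set f)"
proof -
  let ?S = "singular_set f" and ?P = "postsingular_set f" and ?J = "julia_set f"
  have f: "f holomorphic_on UNIV" using te by (simp add: transcendental_entire_def)
  obtain B where "\<forall>x\<in>?S. norm x \<le> B" using singular_set_bounded[OF gf] unfolding bounded_iff ..
  then have "?S \<subseteq> cball 0 B" by auto
  then obtain M where cB: "class_B f M" using class_B_ex[OF te] by blast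
  have "bounded (?P \<inter> ?J)" using gf finite_imp_bounded by (auto simp: geometrically_finite_def)
  then obtain R1 where R1: "\<And>x. x \<in> ?P \<Longrightarrow> x \<in> ?J \<Longrightarrow> norm x \<le> R1"
    unfolding bounded_iff by blast
  have Pn: "(f ^^ n) x \<in> ?P" if "x \<in> ?P" for n x
    by (induction n) (use that postsingular_forward[OF f] in auto)
  \<comment> \<open>The first entry is the threshold for lying in the Julia set, the second exceeds
    every postsingular point there.\<close>
  define R where "R = max (2 * exp (M + 24 * pi)) (R1 + 1)"
  have "bounded (\<Union>n. (f ^^ n) ` ?S)"
  proof (rule ccontr)
    assume "\<not> ?thesis"
    then have "\<forall>B. \<exists>n. \<exists>x\<in>?S. norm ((f ^^ n) x) > B" unfolding bounded_iff by (force simp: not_le)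
    then have "\<forall>k::nat. \<exists>n x. x \<in> ?S \<and> norm ((f ^^ n) x) > max (real k) R1" by blast
    then obtain n x where x: "\<And>k. x k \<in> ?S" and big: "\<And>k. norm ((f ^^ n k) (x k)) > max (real k) R1"
      by metis
    have "x k \<in> ?S \<inter> fatou_set f" for k
    proof (rule ccontr)
      assume "\<not> ?thesis"
      then have "x k \<in> ?J" using x by (auto simp: julia_set_def)
      then have "(f ^^ n k) (x k) \<in> ?J" by (rule julia_funpow[OF f])
      moreover have "(f ^^ n k) (x k) \<in> ?P" using Pn x singular_subset_postsingular by blast
      ultimately show False using R1 big[of k] by fastforce
    qed
    moreover have "compact (?S \<inter> fatou_set f)" using gf by (simp add: geometrically_finite_def)
    ultimately obtain w r where w: "w \<in> ?S \<inter> fatou_set f" and r: "strict_mono r" and lim: "(\<lambda>k. x (r k)) \<longlonglongrightarrow> w"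
      unfolding compact_def by (auto simp: o_def dest!: spec[of _ x])
    have unb: "\<exists>n. norm ((f ^^ n) w) > B" for B
    proof (rule fatou_unbounded_orbits[OF f _ lim, of "\<lambda>k. n (r k)"])
      fix k
      have "real k \<le> real (r k)" using seq_suble[OF r] by simp
      then show "real k \<le> norm ((f ^^ n (r k)) (x (r k)))" using big[of "r k"] by simp
    qed (use w in auto)
    have wJ: "w \<notin> ?J" using w by (simp add: julia_set_def)
    have osc: "\<exists>i\<ge>i0. norm ((f ^^ i) w) < R" for i0
    proof (rule ccontr)
      assume "\<not> ?thesis"
      then have "w \<in> ?J"
        by (intro orbit_near_infinity_in_julia[OF cB, of R i0]) (auto simp: R_def not_less)
      then show False using wJ by simp
    qed
    obtain a where a: "a \<in> closure (range (\<lambda>n. (f ^^ n) w))" "norm a \<le> R" "\<And>j. j \<ge> 1 \<Longrightarrow> norm ((f ^^ j) a) \<ge> R"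
      using excursion_limit[OF f unb osc] by blast
    have "range (\<lambda>n. (f ^^ n) w) \<subseteq> ?P" using Pn w singular_subset_postsingular by blast
    moreover have "closed ?P" by (simp add: postsingular_set_def)
    ultimately have aP: "a \<in> ?P" using a(1) closure_minimal by blast
    have aJ: "a \<in> ?J"
      by (rule orbit_near_infinity_in_julia[OF cB, of R 1]) (use a(3) in \<open>auto simp: R_def\<close>)
    have "norm ((f ^^ 1) a) \<le> R1" by (rule R1[OF Pn[OF aP] julia_funpow[OF f aJ]])
    moreover have "norm ((f ^^ 1) a) \<ge> R" by (rule a(3)) simp
    ultimately show False by (simp add: R_def)
  qed
  then show ?thesis unfolding postsingular_set_def by (rule bounded_closure)
qed

section \<open>Growth of inverse branches\<close>

lemma rhp_nonempty [simp]: "rhp a \<noteq> {}"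
proof -
  have "of_real (a + 1) \<in> rhp a" by simp
  then show ?thesis by blast
qed

text \<open>This is \<open>injective_log_deriv_bound\<close> with \<open>c = 0\<close> on the
  largest disc about \<open>x\<close>, after cancelling \<open>norm (exp (L x))\<close>.\<close>

lemma log_deriv_bound:
  assumes L: "L holomorphic_on rhp a" and inj: "inj_on (\<lambda>x. exp (L x)) (rhp a)" and x: "x \<in> rhp a"
  shows "norm (deriv L x) \<le> 12 * pi / (Re x - a)"
proof -
  define d where "d = Re x - a"
  have d: "d > 0" using x by (simp add: d_def)
  have sub: "ball x d \<subseteq> rhp a" unfolding d_def by (rule ball_subset_rhp)
  have hol: "(\<lambda>x. exp (L x)) holomorphic_on rhp a" by (intro holomorphic_intros L)
  have "norm (deriv (\<lambda>x. exp (L x)) x) * d \<le> 12 * pi * norm (exp (L x) - 0)"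
    by (rule injective_log_deriv_bound) (use hol inj sub d in \<open>auto intro: holomorphic_on_subset inj_on_subset\<close>)
  moreover have "deriv (\<lambda>x. exp (L x)) x = exp (L x) * deriv L x"
  proof (rule DERIV_imp_deriv)
    have "(L has_field_derivative deriv L x) (at x)" using L x by (metis holomorphic_derivI open_rhp)
    then show "((\<lambda>x. exp (L x)) has_field_derivative exp (L x) * deriv L x) (at x)"
      by (rule DERIV_chain2[OF DERIV_exp])
  qed
  ultimately have "norm (exp (L x)) * (norm (deriv L x) * d) \<le> norm (exp (L x)) * (12 * pi)"
    by (simp only: norm_mult diff_zero mult_ac)
  then have "norm (deriv L x) * d \<le> 12 * pi" by (subst (asm) mult_le_cancel_left_pos) auto
  then show ?thesis using d by (simp add: d_def[symmetric] field_simps)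
qed

lemma lipschitz_right_of:
  assumes L: "L holomorphic_on rhp a" and bd: "\<And>x. x \<in> rhp a \<Longrightarrow> norm (deriv L x) \<le> A / (Re x - a)"
    and s: "s > a" and A: "A \<ge> 0" and xy: "Re x \<ge> s" "Re y \<ge> s"
  shows "norm (L x - L y) \<le> A / (s - a) * norm (x - y)"
proof (rule field_differentiable_bound[where f' = "deriv L"])
  show "convex {z. Re z \<ge> s}" by (rule convex_halfspace_Re_ge)
  show "(L has_field_derivative deriv L z) (at z within {z. Re z \<ge> s})" if "z \<in> {z. Re z \<ge> s}" for z
    by (rule has_field_derivative_at_within[OF holomorphic_derivI[OF L open_rhp]]) (use that s in auto)
  show "norm (deriv L z) \<le> A / (s - a)" if "z \<in> {z. Re z \<ge> s}" for z
  proof -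
    have "norm (deriv L z) \<le> A / (Re z - a)" by (rule bd) (use that s in auto)
    also have "\<dots> \<le> A / (s - a)" using that s A by (intro divide_left_mono) auto
    finally show ?thesis .
  qed
qed (use xy in auto)

text \<open>In the coordinate \<open>v = ln (x - a)\<close> the function becomes Lipschitz, whence logarithmic growth.\<close>

lemma log_growth_on_reals:
  assumes L: "L holomorphic_on rhp a" and bd: "\<And>x. x \<in> rhp a \<Longrightarrow> norm (deriv L x) \<le> A / (Re x - a)" and v: "v \<ge> 0"
  shows "norm (L (of_real (a + exp v)) - L (of_real (a + 1))) \<le> A * v"
proof -
  define S where "S = complex_of_real ` {0..v}"
  have "norm ((\<lambda>z. L (of_real a + exp z)) (of_real v) - (\<lambda>z. L (of_real a + exp z)) (of_real 0)) \<le> A * norm (complex_of_real v - of_real 0)"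
  proof (rule field_differentiable_bound[where S = S and f' = "\<lambda>z. deriv L (of_real a + exp z) * exp z"])
    have "S = closed_segment (of_real 0) (of_real v)"
      using v by (simp only: S_def closed_segment_of_real closed_segment_eq_real_ivl1)
    then show "convex S" by simp
    show "((\<lambda>z. L (of_real a + exp z)) has_field_derivative deriv L (of_real a + exp z) * exp z) (at z within S)"
      if "z \<in> S" for z
    proof -
      have "of_real a + exp z \<in> rhp a" using that by (auto simp: S_def exp_of_real)
      then have 1: "(L has_field_derivative deriv L (of_real a + exp z)) (at (of_real a + exp z))"
        using L by (metis holomorphic_derivI open_rhp)
      have "((\<lambda>z. of_real a + exp z) has_field_derivative exp z) (at z within S)"
        by (auto intro!: derivative_eq_intros)
      then show ?thesis by (rule DERIV_chain2[where f = L and g = "\<lambda>z. of_real a + exp z", OF 1])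
    qed
    show "norm (deriv L (of_real a + exp z) * exp z) \<le> A" if "z \<in> S" for z
    proof -
      obtain t where t: "z = of_real t" using \<open>z \<in> S\<close> by (auto simp: S_def)
      have e: "exp z = of_real (exp t)" by (simp add: t exp_of_real)
      have "norm (deriv L (of_real a + exp z)) \<le> A / (Re (of_real a + exp z) - a)"
        by (rule bd) (simp add: e)
      then have "norm (deriv L (of_real a + exp z)) \<le> A / exp t" by (simp add: e)
      then have "norm (deriv L (of_real a + exp z)) * exp t \<le> A" by (simp add: field_simps)
      then show ?thesis by (simp add: e norm_mult)
    qed
  qed (use v in \<open>auto simp: S_def\<close>)
  then show ?thesis using v by (simp add: exp_of_real)
qed

lemma exp_eq_lift_const:
  assumes X: "connected X" "u holomorphic_on X" "v holomorphic_on X" "X \<noteq> {}"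
    and eq: "\<And>x. x \<in> X \<Longrightarrow> exp (u x) = exp (v x)"
  shows "\<exists>n::int. \<forall>x\<in>X. u x = v x + of_real (of_int (2 * n) * pi) * \<i>"
proof -
  obtain b where b: "b \<in> X" using X by blast
  obtain n where n: "u b = v b + of_real (of_int (2 * n) * pi) * \<i>" using eq[OF b] unfolding exp_eq by blast
  have "u x = v x + of_real (of_int (2 * n) * pi) * \<i>" if x: "x \<in> X" for x
  proof (rule lift_unique[where h = exp and X = X and u = u and v = "\<lambda>x. v x + of_real (of_int (2 * n) * pi) * \<i>" and ?x0.0 = b])
    show "exp (u x) = exp (v x + of_real (of_int (2 * n) * pi) * \<i>)" if "x \<in> X" for x
      using eq[OF that] exp_eq[of "v x + of_real (of_int (2 * n) * pi) * \<i>" "v x"] by auto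
    have "deriv exp x = exp x" for x :: complex by (rule DERIV_imp_deriv) (rule DERIV_exp)
    then show "deriv exp (u x) \<noteq> 0" for x by simp
  qed (use X x b n in \<open>auto intro!: continuous_intros holomorphic_intros holomorphic_on_imp_continuous_on\<close>)
  then show ?thesis by blast
qed

abbreviation iter_exp :: "nat \<Rightarrow> real \<Rightarrow> real" where
  "iter_exp p \<equiv> exp ^^ p"

text \<open>The model for \<open>f ^^ p\<close> in logarithmic coordinates is
  \<open>iter_exp p\<close>. The upper bound reflects the logarithmic growth of inverse branches;
  the lower bound is where finite order enters. The induction splits off the first application of
  \<open>f\<close>: \<open>K\<close>, a logarithm of \<open>f (exp (L x))\<close>, is a branch for
  the remaining \<open>p\<close> iterates.\<close>

lemma (in class_B) tract_log_growth:
  assumes M0: "M \<ge> 0" and ord: "finite_order f"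
    and L: "L holomorphic_on rhp a" and fL: "\<And>x. x \<in> rhp a \<Longrightarrow> (f ^^ p) (exp (L x)) = exp x"
  shows "\<exists>D\<ge>1. \<exists>t0. \<forall>t\<ge>t0. Re (L (of_real (iter_exp p t))) \<ge> t / D \<and> norm (L (of_real (iter_exp p t))) \<le> D * t"
  using L fL
proof (induction p arbitrary: L a)
  case 0
  have "\<exists>n::int. \<forall>x\<in>rhp a. L x = x + of_real (of_int (2 * n) * pi) * \<i>"
    by (rule exp_eq_lift_const) (use 0 in \<open>auto intro: holomorphic_intros\<close>)
  then obtain n :: int where n: "\<And>x. x \<in> rhp a \<Longrightarrow> L x = x + of_real (of_int (2 * n) * pi) * \<i>" by blast
  define c where "c = \<bar>of_int (2 * n) * pi\<bar>"
  have main: "Re (L (of_real t)) \<ge> t / 2 \<and> norm (L (of_real t)) \<le> 2 * t" if "t \<ge> max (max c 0) (a + 1)" for t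
  proof -
    have "L (of_real t) = of_real t + of_real (of_int (2 * n) * pi) * \<i>" by (rule n) (use that in auto)
    moreover have "norm (of_real t + of_real (of_int (2 * n) * pi) * \<i>) \<le> \<bar>t\<bar> + c"
      by (rule norm_triangle_le) (simp add: c_def norm_mult abs_mult)
    ultimately show ?thesis using that by auto
  qed
  have "\<exists>t0. \<forall>t\<ge>t0. Re (L (of_real t)) \<ge> t / 2 \<and> norm (L (of_real t)) \<le> 2 * t" using main by blast
  then have "(1::real) \<le> 2 \<and> (\<exists>t0. \<forall>t\<ge>t0. Re (L (of_real t)) \<ge> t / 2 \<and> norm (L (of_real t)) \<le> 2 * t)" by simp
  then show ?case unfolding funpow_0 by blast
next
  case (Suc p)
  obtain Bd where Bd: "\<And>z. z \<in> cball 0 (exp M) \<Longrightarrow> norm ((f ^^ p) z) \<le> Bd"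
    using entire_bounded_on_compact[OF holomorphic_funpow[OF hol] compact_cball] by metis
  \<comment> \<open>Right of \<open>a'\<close>, \<open>exp x\<close> exceeds all values of
    \<open>f ^^ p\<close> on the disc of radius \<open>exp M\<close>, so
    \<open>f (exp (L x))\<close> lies outside that disc.\<close>
  define a' where "a' = max a (ln (max 1 Bd))"
  have sub: "rhp a' \<subseteq> rhp a" by (auto simp: a'_def)
  have fL: "(f ^^ p) (f (exp (L x))) = exp x" if "x \<in> rhp a'" for x
    using Suc.prems(2)[of x] that sub by (auto simp: funpow_swap1)
  have large: "norm (f (exp (L x))) > exp M" if x: "x \<in> rhp a'" for x
  proof (rule ccontr)
    assume "\<not> ?thesis"
    then have "norm (exp x) \<le> Bd" using Bd[of "f (exp (L x))"] fL[OF x] by simp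
    then have "exp (Re x) \<le> max 1 Bd" by simp
    then have "Re x \<le> ln (max 1 Bd)" by (subst ln_ge_iff) auto
    then show False using x by (auto simp: a'_def)
  qed
  have Lh: "L holomorphic_on rhp a'" using Suc.prems(1) sub by (rule holomorphic_on_subset)
  have feh: "(\<lambda>x. f (exp (L x))) holomorphic_on rhp a'"
    by (rule holomorphic_on_compose_gen[OF _ hol, unfolded o_def]) (auto intro!: holomorphic_intros Lh)
  have eLh: "(\<lambda>x. exp (L x)) holomorphic_on rhp a'" by (intro holomorphic_intros Lh)
  define x0 where "x0 = complex_of_real (a' + 1)"
  have x0: "x0 \<in> rhp a'" by (simp add: x0_def)
  have "f (exp (L x)) \<noteq> 0" if "x \<in> rhp a'" for x using large[OF that] by (metis norm_zero not_exp_less_zero)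
  then obtain K where K: "K holomorphic_on rhp a'" "\<And>x. x \<in> rhp a' \<Longrightarrow> exp (K x) = f (exp (L x))"
    using holomorphic_logarithm_exists[OF convex_rhp open_rhp feh _ x0] by blast
  have Kr: "Re (K x) > M" if "x \<in> rhp a'" for x
    using large[OF that] K(2)[OF that] by (metis exp_less_cancel_iff norm_exp_eq_Re)
  have "(f ^^ p) (exp (K x)) = exp x" if "x \<in> rhp a'" for x using K(2)[OF that] fL[OF that] by simp
  from Suc.IH[OF K(1) this] obtain D t0 where D: "D \<ge> 1"
    and KD: "\<And>s. s \<ge> t0 \<Longrightarrow> Re (K (of_real (iter_exp p s))) \<ge> s / D \<and> norm (K (of_real (iter_exp p s))) \<le> D * s"
    by blast
  obtain g \<zeta> where g: "g holomorphic_on rhp M" "\<And>x. x \<in> rhp M \<Longrightarrow> f (g x) = exp x" "\<zeta> \<in> rhp M" "g \<zeta> = exp (L x0)"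
    "inj_on g (rhp M)" "\<And>x. x \<in> rhp M \<Longrightarrow> g x \<noteq> 0" "exp \<zeta> = f (exp (L x0))" using exp_lift[OF large[OF x0]] by blast
  have "exp \<zeta> = exp (K x0)" using g(7) K(2)[OF x0] by simp
  then obtain n :: int where n: "\<zeta> = K x0 + of_real (of_int (2 * n) * pi) * \<i>" unfolding exp_eq by blast
  define c where "c = complex_of_real (of_int (2 * n) * pi) * \<i>"
  have ec: "exp (x + c) = exp x" for x unfolding c_def by (subst exp_eq) blast
  have cr: "Re c = 0" by (simp add: c_def)
  have Kc: "K x + c \<in> rhp M" if "x \<in> rhp a'" for x using Kr[OF that] by (simp add: cr)
  have Kch: "(\<lambda>x. K x + c) holomorphic_on rhp a'" by (intro holomorphic_intros K)
  have gKh: "(\<lambda>x. g (K x + c)) holomorphic_on rhp a'"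
    by (rule holomorphic_on_compose_gen[OF Kch g(1), unfolded o_def]) (use Kc in auto)
  have gK: "g (K x + c) = exp (L x)" if "x \<in> rhp a'" for x
  proof (rule lift_unique[where h = f and X = "rhp a'" and u = "\<lambda>x. g (K x + c)" and v = "\<lambda>x. exp (L x)" and ?x0.0 = x0])
    show "f (g (K x + c)) = f (exp (L x))" if "x \<in> rhp a'" for x using g(2)[OF Kc[OF that]] ec K(2)[OF that] by simp
    show "deriv f (g (K x + c)) \<noteq> 0" if "x \<in> rhp a'" for x
      by (rule deriv_nonzero_of_exp[OF hol g(1) open_rhp g(2) Kc[OF that]])
    show "g (K x0 + c) = exp (L x0)" using g(4) n by (simp add: c_def)
  qed (use hol x0 that gKh eLh in \<open>auto intro: holomorphic_on_imp_continuous_on\<close>)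
  obtain l where l: "l holomorphic_on rhp M" "\<And>x. x \<in> rhp M \<Longrightarrow> exp (l x) = g x"
    using holomorphic_logarithm_exists[OF convex_rhp open_rhp g(1,6) g(3)] by blast
  have lKh: "(\<lambda>x. l (K x + c)) holomorphic_on rhp a'"
    by (rule holomorphic_on_compose_gen[OF Kch l(1), unfolded o_def]) (use Kc in auto)
  have "\<exists>n::int. \<forall>x\<in>rhp a'. L x = l (K x + c) + of_real (of_int (2 * n) * pi) * \<i>"
    by (rule exp_eq_lift_const) (use l Kc gK lKh Lh x0 in auto)
  then obtain n2 :: int where n2: "\<And>x. x \<in> rhp a' \<Longrightarrow> L x = l (K x + c) + of_real (of_int (2 * n2) * pi) * \<i>" by blast
  have "inj_on (\<lambda>x. exp (l x)) (rhp M)" using g(5) l(2) by (simp add: inj_on_def)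
  then have ld: "norm (deriv l x) \<le> 12 * pi / (Re x - M)" if "x \<in> rhp M" for x
    by (rule log_deriv_bound[OF l(1) _ that])
  obtain C R where CR: "\<And>z. norm z > R \<Longrightarrow> norm (f z) > exp 1 \<Longrightarrow> ln (ln (norm (f z))) \<le> C * ln (norm z)"
    using ord unfolding finite_order_def by blast
  obtain Bf where Bf: "\<And>z. z \<in> cball 0 (max R 1) \<Longrightarrow> norm (f z) \<le> Bf"
    using entire_bounded_on_compact[OF hol compact_cball] by metis
  \<comment> \<open>The order constant may be nonpositive; a constant that one can divide by is
    needed.\<close>
  define C' where "C' = max C 1"
  have C': "C' \<ge> 1" by (simp add: C'_def)
  define A where "A = 12 * pi"
  have A: "A > 0" by (simp add: A_def)
  \<comment> \<open>The contributions to \<open>norm (L x)\<close> independent of \<open>t\<close>: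
    a base value of \<open>l\<close>, the translation by \<open>n2\<close>, and the bounded distance
    established in fact 2 below.\<close>
  define B1 where "B1 = norm (l (of_real (M + 1))) + norm (complex_of_real (of_int (2 * n2) * pi) * \<i>) + 2 * A * D * (D + 3)"
  have B1: "B1 \<ge> 0" using A D by (simp add: B1_def)
  define D' where "D' = max (2 * C') (A + B1)"
  have D'1: "D' \<ge> 1" using C' by (simp add: D'_def)
  define T where "T = {t0, 1, 2 * D * M, norm c, D * (max 2 (ln (max 1 Bf) + 1)), 2 * ln D, a' + 1, M}"
  define t1 where "t1 = Max T"
  have tT: "t \<ge> e" if "t \<ge> t1" "e \<in> T" for t e
    using that Max_ge[of T e] unfolding t1_def T_def by (meson finite.emptyI finite.insertI order_trans)
  have main: "Re (L (of_real (iter_exp (Suc p) t))) \<ge> t / D' \<and> norm (L (of_real (iter_exp (Suc p) t))) \<le> D' * t" if t: "t \<ge> t1" for t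
  proof -
    have tb: "t \<ge> t0" "t \<ge> 1" "t \<ge> 2 * D * M" "t \<ge> norm c" "t \<ge> D * (max 2 (ln (max 1 Bf) + 1))" "t \<ge> 2 * ln D" "t \<ge> a' + 1" "t \<ge> M"
      by (rule tT[OF t], unfold T_def, blast)+
    define s where "s = exp t"
    have st: "s \<ge> t + 1" unfolding s_def using exp_ge_add_one_self[of t] by linarith
    have s0: "s > 0" by (simp add: s_def)
    define x where "x = complex_of_real (iter_exp p s)"
    have xe: "complex_of_real (iter_exp (Suc p) t) = x" by (simp add: x_def s_def funpow_swap1)
    have it: "iter_exp p s \<ge> s" for p
    proof (induction p)
      case (Suc p)
      have "iter_exp (Suc p) s \<ge> iter_exp p s + 1" using exp_ge_add_one_self[of "iter_exp p s"] by (simp add: add.commute)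
      then show ?case using Suc by linarith
    qed simp
    have "a' < iter_exp p s" using st tb(7) it[of p] by linarith
    then have xin: "x \<in> rhp a'" by (simp add: x_def)
    have Kx: "Re (K x) \<ge> s / D" "norm (K x) \<le> D * s" using KD[of s] st tb(1) by (auto simp: x_def)
    have sD: "s / D \<ge> 2 * M" "s / D \<ge> 2" "s / D \<ge> ln (max 1 Bf) + 1"
    proof -
      have "D * (max 2 (ln (max 1 Bf) + 1)) \<le> s" using tb(5) st by linarith
      then have "max 2 (ln (max 1 Bf) + 1) \<le> s / D" using D by (subst pos_le_divide_eq) (linarith, simp only: mult.commute)
      then show "s / D \<ge> 2" "s / D \<ge> ln (max 1 Bf) + 1" by auto
      have "2 * M * D \<le> s" using tb(3) st by (simp add: mult_ac)
      then show "s / D \<ge> 2 * M" using D by (simp add: field_simps)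
    qed
    define q where "q = complex_of_real (M + exp t)"
    have "norm (l (of_real (M + exp t)) - l (of_real (M + 1))) \<le> A * t"
      unfolding A_def by (rule log_growth_on_reals[OF l(1) ld]) (use tb in auto)
    then have 1: "norm (l q - l (of_real (M + 1))) \<le> A * t" by (simp add: q_def)
    \<comment> \<open>Both points have real part at least \<open>s / D\<close> and lie within
      \<open>(D + 3) * s\<close> of each other, while \<open>l\<close> has Lipschitz constant of
      order \<open>1 / s\<close> there. So the distance of their images is bounded uniformly in
      \<open>s\<close>.\<close>
    have 2: "norm (l (K x + c) - l q) \<le> 2 * A * D * (D + 3)"
    proof -
      have sDM: "s / D > M" using sD(1) sD(2) M0 by linarith
      have "s / D \<le> s" using D s0 by (simp add: field_simps)
      then have "norm (l (K x + c) - l q) \<le> A / (s / D - M) * norm (K x + c - q)"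
        unfolding A_def by (intro lipschitz_right_of[OF l(1) ld sDM]) (use Kx cr M0 in \<open>auto simp: q_def s_def\<close>)
      also have "\<dots> \<le> (2 * A * D / s) * ((D + 3) * s)"
      proof (rule mult_mono)
        have "A / (s / D - M) \<le> A / (s / D / 2)" using sD(1) sDM A s0 D by (intro divide_left_mono mult_pos_pos) auto
        also have "\<dots> = 2 * A * D / s" by simp
        finally show "A / (s / D - M) \<le> 2 * A * D / s" .
        have "norm (K x + c - q) \<le> norm (K x) + norm c + norm q" by norm
        also have "\<dots> \<le> D * s + s + (s + s)"
        proof -
          have "norm q = M + s" using M0 by (simp add: q_def s_def del: of_real_add)
          then show ?thesis using Kx(2) tb(4,8) st by linarith
        qed
        also have "\<dots> = (D + 3) * s" by (simp add: algebra_simps)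
        finally show "norm (K x + c - q) \<le> (D + 3) * s" .
      qed (use A D s0 in auto)
      also have "\<dots> = 2 * A * D * (D + 3)" using s0 by simp
      finally show ?thesis .
    qed
    have "norm (L x) \<le> A * t + B1"
    proof -
      have "L x = (l (K x + c) - l q) + (l q - l (of_real (M + 1))) + l (of_real (M + 1)) + of_real (of_int (2 * n2) * pi) * \<i>"
        using n2[OF xin] by simp
      then have "norm (L x) \<le> norm (l (K x + c) - l q) + norm (l q - l (of_real (M + 1))) + norm (l (of_real (M + 1))) + norm (complex_of_real (of_int (2 * n2) * pi) * \<i>)"
        by (metis (no_types, lifting) norm_triangle_le add_mono order_refl norm_triangle_ineq)
      then show ?thesis using 1 2 by (simp add: B1_def)
    qed
    also have "\<dots> \<le> (A + B1) * t" using B1 mult_left_mono[OF tb(2) B1] by (simp add: algebra_simps)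
    also have "\<dots> \<le> D' * t" using tb(2) by (intro mult_right_mono) (auto simp: D'_def)
    finally have up: "norm (L x) \<le> D' * t" .
    define z where "z = exp (L x)"
    have nfz: "norm (f z) = exp (Re (K x))" using K(2)[OF xin] by (metis z_def norm_exp_eq_Re)
    have nz: "norm z = exp (Re (L x))" by (simp add: z_def norm_exp_eq_Re)
    have Kbig: "Re (K x) > ln (max 1 Bf)" using Kx(1) sD(3) by linarith
    have zR: "norm z > max R 1"
    proof (rule ccontr)
      assume "\<not> ?thesis"
      then have "norm (f z) \<le> Bf" by (intro Bf) auto
      then have "exp (Re (K x)) \<le> max 1 Bf" by (simp add: nfz)
      then have "Re (K x) \<le> ln (max 1 Bf)" by (subst ln_ge_iff) auto
      then show False using Kbig by simp
    qed
    \<comment> \<open>In logarithmic coordinates finite order reads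
      \<open>ln (Re (K x)) \<le> C * Re (L x)\<close>. As \<open>Re (K x)\<close> is at least
      \<open>exp t / D\<close>, the left side is at least \<open>t - ln D\<close>.\<close>
    have "ln (ln (norm (f z))) \<le> C * ln (norm z)"
      by (rule CR) (use zR Kx(1) sD(2) in \<open>auto simp: nfz\<close>)
    then have "ln (Re (K x)) \<le> C * Re (L x)" by (simp add: nfz nz)
    also have "\<dots> \<le> C' * Re (L x)"
    proof (rule mult_right_mono)
      have "exp (Re (L x)) > 1" using zR by (simp add: nz)
      then show "0 \<le> Re (L x)" by simp
    qed (simp add: C'_def)
    finally have "ln (Re (K x)) \<le> C' * Re (L x)" .
    moreover have "ln (s / D) \<le> ln (Re (K x))" using Kx(1) sD(2) by (subst ln_le_cancel_iff) auto
    moreover have "ln (s / D) = t - ln D" using D by (simp add: ln_div s_def)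
    ultimately have "t / 2 \<le> C' * Re (L x)" using tb(6) by linarith
    then have "t / (2 * C') \<le> Re (L x)" using C' by (simp add: field_simps)
    moreover have "t / D' \<le> t / (2 * C')" using C' tb(2) D'1 by (intro divide_left_mono) (auto simp: D'_def)
    ultimately show ?thesis unfolding xe using up by simp
  qed
  show ?case using D'1 main by blast
qed

section \<open>Tails of rays\<close>

text \<open>The curves are limits of the pullbacks \<open>K j \<circ> K (j+1) \<circ> \<dots> \<circ> K (j+n)\<close> of the real axis along the
  model \<open>E\<close>. The growth bounds keep the first two pullbacks within bounded distance, and from
  then on each step contracts by a factor two.\<close>

lemma tail_curves:
  fixes K :: "nat \<Rightarrow> complex \<Rightarrow> complex" and E :: "real \<Rightarrow> real"
  assumes hol: "\<And>j. K j holomorphic_on rhp M"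
    and bd: "\<And>j x. x \<in> rhp M \<Longrightarrow> norm (deriv (K j) x) \<le> A / (Re x - M)"
    and A: "A \<ge> 0" and D: "D \<ge> 1"
    and grow: "\<And>j t. t \<ge> t0 \<Longrightarrow> Re (K j (of_real (E t))) \<ge> t / D \<and> norm (K j (of_real (E t))) \<le> D * t"
    and E: "continuous_on UNIV E" "\<And>t. E t \<ge> t"
  shows "\<exists>\<eta> t1. t1 \<ge> T \<and> (\<forall>j. continuous_on {t1..} (\<eta> j)) \<and>
    (\<forall>j. \<forall>t\<ge>t1. \<eta> j t = K j (\<eta> (Suc j) (E t)) \<and> Re (\<eta> j t) > M \<and> Re (\<eta> j t) \<ge> t / (2 * D) \<and> norm (\<eta> j t) \<le> 2 * D * t) \<and>
    (\<forall>j m. (\<forall>i. K (i + m) = K i) \<longrightarrow> \<eta> (j + m) = \<eta> j)"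
proof -
  \<comment> \<open>Bounds the correction from \<open>c 1\<close> to \<open>c 2\<close>. The one
    from \<open>c 0\<close> to \<open>c 1\<close> compares \<open>t\<close> with
    \<open>K j (E t)\<close>, which may drift apart linearly, so sums start at
    \<open>c 1\<close>.\<close>
  define B where "B = 2 * A * D * (D + 1)"
  have B: "B \<ge> 0" using A D by (simp add: B_def)
  define c where "c = rec_nat (\<lambda>j t. complex_of_real t) (\<lambda>n u j t. K j (u (Suc j) (E t)))"
  have c0: "c 0 j t = of_real t" and cS: "c (Suc n) j t = K j (c n (Suc j) (E t))" for n j t
    by (simp_all add: c_def)
  \<comment> \<open>Beyond \<open>t1\<close> the total correction \<open>2 * B\<close> uses up at
    most half of the lower bound \<open>t / D\<close>, and at real parts from
    \<open>t / (2 * D)\<close> on \<open>K j\<close> has Lipschitz constant at most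
    \<open>1 / 2\<close>.\<close>
  define TT where "TT = {T, t0, 1, 4 * B * D, 2 * D * \<bar>M\<bar> + 1, 2 * D * (M + 2 * A + 1)}"
  define t1 where "t1 = Max TT"
  have tT: "t \<ge> e" if "t \<ge> t1" "e \<in> TT" for t e
    using that Max_ge[of TT e] unfolding t1_def TT_def by (meson finite.emptyI finite.insertI order_trans)
  have tb: "t \<ge> T" "t \<ge> t0" "t \<ge> 1" "t \<ge> 4 * B * D" "t \<ge> 2 * D * \<bar>M\<bar> + 1" "t \<ge> 2 * D * (M + 2 * A + 1)"
    if "t \<ge> t1" for t
    by (rule tT[OF that], unfold TT_def, blast)+
  have td: "t / (2 * D) \<ge> 2 * B" "t / (2 * D) > \<bar>M\<bar>" "t / (2 * D) - M \<ge> 2 * A + 1" "t / D = t / (2 * D) + t / (2 * D)"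
    if t: "t \<ge> t1" for t
  proof -
    show "t / (2 * D) \<ge> 2 * B" using tb(4)[OF t] D by (simp add: pos_le_divide_eq mult_ac)
    have "\<bar>M\<bar> * (2 * D) < t" using tb(5)[OF t] by (simp add: mult_ac)
    then show "t / (2 * D) > \<bar>M\<bar>" using D by (simp add: pos_less_divide_eq)
    have "(M + 2 * A + 1) * (2 * D) \<le> t" using tb(6)[OF t] by (simp add: mult_ac)
    then have "M + 2 * A + 1 \<le> t / (2 * D)" using D by (subst pos_le_divide_eq) auto
    then show "t / (2 * D) - M \<ge> 2 * A + 1" by simp
    show "t / D = t / (2 * D) + t / (2 * D)" by simp
  qed
  have Et: "E t \<ge> t1" if "t \<ge> t1" for t using E(2)[of t] that by linarith
  have c1: "Re (c 1 j t) \<ge> t / D" "norm (c 1 j t) \<le> D * t" if "t \<ge> t1" for j t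
    using grow[OF tb(2)[OF that]] by (simp_all add: cS c0)
  have Q: "\<forall>j. \<forall>t\<ge>t1. norm (c (Suc (Suc n)) j t - c (Suc n) j t) \<le> B / 2 ^ n \<and>
      norm (c (Suc n) j t - c 1 j t) \<le> 2 * B * (1 - 1 / 2 ^ n)" for n
  proof (induction n)
    case 0
    have "norm (c 2 j t - c 1 j t) \<le> B" if t: "t \<ge> t1" for j t
    proof -
      define e where "e = E t"
      have e: "e \<ge> t1" using Et[OF t] by (simp add: e_def)
      have e0: "e > 0" using tb(3)[OF e] by simp
      have eD: "e / D > M" using td(2,4)[OF e] by linarith
      have "e / D \<le> e" using D e0 by (simp add: field_simps)
      then have "norm (K j (c 1 (Suc j) e) - K j (of_real e)) \<le> A / (e / D - M) * norm (c 1 (Suc j) e - of_real e)"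
        by (intro lipschitz_right_of[OF hol bd eD A]) (use c1[OF e] in auto)
      also have "\<dots> \<le> (2 * A * D / e) * ((D + 1) * e)"
      proof (rule mult_mono)
        have "A / (e / D - M) \<le> A / (e / (2 * D))"
          using td(2,4)[OF e] A e0 D eD by (intro divide_left_mono mult_pos_pos) auto
        then show "A / (e / D - M) \<le> 2 * A * D / e" by (simp add: mult_ac)
        have "norm (c 1 (Suc j) e - of_real e) \<le> norm (c 1 (Suc j) e) + norm (complex_of_real e)" by norm
        also have "\<dots> \<le> D * e + e" using c1(2)[OF e] e0 by simp
        finally show "norm (c 1 (Suc j) e - of_real e) \<le> (D + 1) * e" by (simp add: algebra_simps)
      qed (use A D e0 in auto)
      also have "\<dots> = B" using e0 by (simp add: B_def)
      finally show ?thesis by (simp add: numeral_2_eq_2 cS c0 e_def)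
    qed
    then show ?case by (simp add: numeral_2_eq_2)
  next
    case (Suc n)
    have main: "norm (c (Suc (Suc (Suc n))) j t - c (Suc (Suc n)) j t) \<le> B / 2 ^ Suc n" if t: "t \<ge> t1" for j t
    proof -
      define e where "e = E t"
      have e: "e \<ge> t1" using Et[OF t] by (simp add: e_def)
      define x where "x = c (Suc (Suc n)) (Suc j) e"
      define y where "y = c (Suc n) (Suc j) e"
      have xy: "norm (x - y) \<le> B / 2 ^ n" "norm (y - c 1 (Suc j) e) \<le> 2 * B * (1 - 1 / 2 ^ n)"
        using Suc[rule_format, OF e, of "Suc j"] by (simp_all add: x_def y_def)
      have "norm (x - c 1 (Suc j) e) \<le> norm (x - y) + norm (y - c 1 (Suc j) e)" by norm
      also have "\<dots> \<le> B / 2 ^ n + 2 * B * (1 - 1 / 2 ^ n)" using xy by simp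
      also have "\<dots> = 2 * B - B / 2 ^ n" by (simp add: algebra_simps)
      also have "\<dots> \<le> 2 * B" using B by simp
      finally have x1: "norm (x - c 1 (Suc j) e) \<le> 2 * B" .
      have "2 * B * (1 - 1 / 2 ^ n) \<le> 2 * B" using B by (intro mult_left_le) auto
      then have y1: "norm (y - c 1 (Suc j) e) \<le> 2 * B" using xy(2) by linarith
      have re: "Re z \<ge> e / (2 * D)" if "norm (z - c 1 (Suc j) e) \<le> 2 * B" for z
      proof -
        have "\<bar>Re z - Re (c 1 (Suc j) e)\<bar> \<le> norm (z - c 1 (Suc j) e)" using abs_Re_le_cmod[of "z - c 1 (Suc j) e"] by simp
        then show ?thesis using that c1(1)[OF e, of "Suc j"] td(1,4)[OF e] by linarith
      qed
      have "norm (K j x - K j y) \<le> A / (e / (2 * D) - M) * norm (x - y)"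
        by (intro lipschitz_right_of[OF hol bd _ A] re x1 y1) (use td(2)[OF e] in auto)
      also have "\<dots> \<le> 1 / 2 * (B / 2 ^ n)"
      proof (rule mult_mono)
        have "A * 2 \<le> e / (2 * D) - M" using td(3)[OF e] by simp
        then show "A / (e / (2 * D) - M) \<le> 1 / 2" using td(2)[OF e] by (subst pos_divide_le_eq) auto
      qed (use xy(1) in auto)
      finally show ?thesis by (simp add: cS x_def y_def e_def)
    qed
    have "norm (c (Suc (Suc n)) j t - c 1 j t) \<le> 2 * B * (1 - 1 / 2 ^ Suc n)" if t: "t \<ge> t1" for j t
    proof -
      have "norm (c (Suc (Suc n)) j t - c 1 j t) \<le> norm (c (Suc (Suc n)) j t - c (Suc n) j t) + norm (c (Suc n) j t - c 1 j t)" by norm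
      also have "\<dots> \<le> B / 2 ^ n + 2 * B * (1 - 1 / 2 ^ n)" using Suc[rule_format, OF t, of j] by linarith
      also have "\<dots> = 2 * B * (1 - 1 / 2 ^ Suc n)" by (simp add: algebra_simps)
      finally show ?thesis .
    qed
    then show ?case using main by blast
  qed
  have near: "norm (c (Suc n) j t - c 1 j t) \<le> 2 * B" if "t \<ge> t1" for n j t
  proof -
    have "2 * B * (1 - 1 / 2 ^ n) \<le> 2 * B" using B by (intro mult_left_le) auto
    then show ?thesis using Q[rule_format, OF that, of n j] by linarith
  qed
  have cre: "Re z \<ge> t / (2 * D) \<and> Re z > M \<and> norm z \<le> 2 * D * t" if "norm (z - c 1 j t) \<le> 2 * B" "t \<ge> t1" for z j t
  proof -
    have "Re z \<ge> t / (2 * D)"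
    proof -
      have "\<bar>Re z - Re (c 1 j t)\<bar> \<le> norm (z - c 1 j t)" using abs_Re_le_cmod[of "z - c 1 j t"] by simp
      then show ?thesis using that(1) c1(1)[OF that(2), of j] td(1,4)[OF that(2)] by linarith
    qed
    moreover have "norm z \<le> 2 * D * t"
    proof -
      have "norm z \<le> norm (z - c 1 j t) + norm (c 1 j t)" by norm
      also have "\<dots> \<le> t / (2 * D) + D * t" using that(1) c1(2)[OF that(2), of j] td(1)[OF that(2)] by linarith
      also have "t / (2 * D) \<le> D * t"
      proof -
        have "t \<le> D * t" using D tb(3)[OF that(2)] by simp
        moreover have "t / (2 * D) \<le> t" using D tb(3)[OF that(2)] by (simp add: field_simps)
        ultimately show ?thesis by linarith
      qed
      finally show ?thesis by simp
    qed
    ultimately show ?thesis using td(2)[OF that(2)] by linarith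
  qed
  have ccont: "continuous_on {t1..} (c n j)" for n j
  proof (induction n arbitrary: j)
    case 0
    have "c 0 j = complex_of_real" by (auto simp: c0)
    then show ?case by (auto intro: continuous_intros)
  next
    case (Suc n)
    have eq: "c (Suc n) j = (\<lambda>t. K j (c n (Suc j) (E t)))" by (auto simp: cS)
    have 1: "continuous_on {t1..} (\<lambda>t. c n (Suc j) (E t))"
      by (rule continuous_on_compose2[OF Suc continuous_on_subset[OF E(1)]]) (use Et in auto)
    have 2: "(\<lambda>t. c n (Suc j) (E t)) ` {t1..} \<subseteq> rhp M"
    proof (rule image_subsetI)
      fix t assume "t \<in> {t1..}"
      then have e: "E t \<ge> t1" using Et by simp
      have "Re (c n (Suc j) (E t)) > M"
      proof (cases n)
        case 0
        have "E t / (2 * D) \<le> E t" using D tb(3)[OF e] by (simp add: field_simps)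
        then show ?thesis using 0 td(2)[OF e] by (simp add: c0)
      next
        case (Suc k)
        then show ?thesis using cre[OF near[OF e] e] by blast
      qed
      then show "c n (Suc j) (E t) \<in> rhp M" by simp
    qed
    show ?case unfolding eq
      by (rule continuous_on_compose2[OF holomorphic_on_imp_continuous_on[OF hol] 1 2])
  qed
  define \<eta> where "\<eta> j t = c 1 j t + (\<Sum>i. c (Suc (Suc i)) j t - c (Suc i) j t)" for j t
  have ul: "uniform_limit {t1..} (\<lambda>n. c (Suc n) j) (\<eta> j) sequentially" for j
  proof -
    have "uniform_limit {t1..} (\<lambda>n t. \<Sum>i<n. c (Suc (Suc i)) j t - c (Suc i) j t) (\<lambda>t. \<Sum>i. c (Suc (Suc i)) j t - c (Suc i) j t) sequentially"
    proof (rule Weierstrass_m_test)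
      show "norm (c (Suc (Suc n)) j t - c (Suc n) j t) \<le> B * (1 / 2) ^ n" if "t \<in> {t1..}" for n t
        using Q[of n] that by (simp add: power_divide)
      show "summable (\<lambda>n. B * (1 / 2) ^ n)" by (intro summable_mult summable_geometric) simp
    qed
    moreover have "(\<Sum>i<n. c (Suc (Suc i)) j t - c (Suc i) j t) = c (Suc n) j t - c 1 j t" for n t
      by (induction n) auto
    ultimately show ?thesis by (simp add: uniform_limit_iff \<eta>_def dist_norm algebra_simps)
  qed
  have lim: "(\<lambda>n. c (Suc n) j t) \<longlonglongrightarrow> \<eta> j t" if "t \<ge> t1" for j t
    using tendsto_uniform_limitI[OF ul] that by simp
  have etan: "norm (\<eta> j t - c 1 j t) \<le> 2 * B" if "t \<ge> t1" for j t
  proof -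
    have "(\<lambda>n. norm (c (Suc n) j t - c 1 j t)) \<longlonglongrightarrow> norm (\<eta> j t - c 1 j t)"
      by (intro tendsto_intros lim that)
    then show ?thesis by (rule LIMSEQ_le_const2) (use near that in blast)
  qed
  have etac: "continuous_on {t1..} (\<eta> j)" for j
    by (rule uniform_limit_theorem[OF _ ul]) (auto intro!: always_eventually ccont)
  have rec: "\<eta> j t = K j (\<eta> (Suc j) (E t))" if t: "t \<ge> t1" for j t
  proof (rule LIMSEQ_unique)
    show "(\<lambda>n. c (Suc (Suc n)) j t) \<longlonglongrightarrow> \<eta> j t" using lim[OF t] by (rule LIMSEQ_Suc)
    have e: "E t \<ge> t1" using Et[OF t] .
    have "\<eta> (Suc j) (E t) \<in> rhp M" using cre[OF etan[OF e] e] by simp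
    then have "isCont (K j) (\<eta> (Suc j) (E t))"
      using hol[of j] by (metis continuous_on_eq_continuous_at holomorphic_on_imp_continuous_on open_rhp)
    then show "(\<lambda>n. c (Suc (Suc n)) j t) \<longlonglongrightarrow> K j (\<eta> (Suc j) (E t))"
      unfolding cS by (rule isCont_tendsto_compose) (use lim[OF e, of "Suc j"] in \<open>simp add: cS\<close>)
  qed
  \<comment> \<open>\<open>c n j\<close> depends only on the branches from \<open>K j\<close> on, so
    a period of \<open>K\<close> is a period of the limit curves.\<close>
  have shift: "\<eta> (j + m) = \<eta> j" if "\<forall>i. K (i + m) = K i" for j m
  proof -
    have "c n (i + m) t = c n i t" for n i t
    proof (induction n arbitrary: i t)
      case (Suc n)
      show ?case using Suc[of "Suc i"] that by (simp add: cS)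
    qed (simp add: c0)
    then show ?thesis by (auto simp: \<eta>_def)
  qed
  have "t1 \<ge> T" using tb(1)[of t1] by simp
  then show ?thesis using etac rec cre[OF etan] shift
    by (intro exI[of _ \<eta>] exI[of _ t1]) blast
qed

lemma iter_exp_ge: "iter_exp p t \<ge> t"
proof (induction p)
  case (Suc p)
  have "iter_exp (Suc p) t \<ge> iter_exp p t + 1" using exp_ge_add_one_self[of "iter_exp p t"] by (simp add: add.commute)
  then show ?case using Suc by linarith
qed simp

lemma continuous_iter_exp: "continuous_on A (iter_exp p)"
proof (induction p)
  case (Suc p)
  then show ?case by (auto simp: o_def intro: continuous_intros)
qed (simp add: id_def)

lemma iter_exp_strict_mono: "s < t \<Longrightarrow> iter_exp p s < iter_exp p t"
  by (induction p) auto

lemma iter_exp_ge_plus: "iter_exp p t \<ge> t + real p"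
proof (induction p)
  case (Suc p)
  have "iter_exp (Suc p) t \<ge> iter_exp p t + 1" using exp_ge_add_one_self[of "iter_exp p t"] by (simp add: add.commute)
  then show ?case using Suc by simp
qed simp

text \<open>The difference of the two orbits at least doubles, and one more exponential turns a
  difference above \<open>ln C\<close> into a ratio above \<open>C\<close>. This separates distinct
  parameters of the ray.\<close>

lemma iter_exp_unbounded_ratio:
  assumes st: "s < t" and s: "s \<ge> 1" and C: "C > 0"
  shows "\<exists>N. \<forall>n\<ge>N. iter_exp n t > C * iter_exp n s"
proof -
  define d where "d n = iter_exp n t - iter_exp n s" for n
  have d0: "d 0 > 0" using st by (simp add: d_def)
  have step: "d (Suc n) \<ge> 2 * d n" if "d n > 0" for n
  proof -
    have "1 \<le> iter_exp n s" using iter_exp_ge[of s n] s by linarith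
    then have e2: "exp (iter_exp n s) \<ge> 2" using exp_ge_add_one_self[of "iter_exp n s"] by linarith
    have "d (Suc n) = exp (iter_exp n s) * (exp (d n) - 1)"
      by (simp add: d_def algebra_simps flip: exp_add)
    moreover have "d n \<le> exp (d n) - 1" using exp_ge_add_one_self[of "d n"] by linarith
    then have "exp (iter_exp n s) * d n \<le> exp (iter_exp n s) * (exp (d n) - 1)"
      by (rule mult_left_mono) simp
    moreover have "exp (iter_exp n s) * d n \<ge> 2 * d n" using e2 that by (intro mult_right_mono) auto
    ultimately show ?thesis by linarith
  qed
  have grow: "d n \<ge> 2 ^ n * d 0 \<and> d n > 0" for n
  proof (induction n)
    case (Suc n)
    then show ?case using step[of n] by auto
  qed (use d0 in auto)
  obtain N where N: "\<bar>ln C\<bar> / d 0 < 2 ^ N" using real_arch_pow[of 2] by auto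
  have "iter_exp n t > C * iter_exp n s" if n: "n \<ge> Suc N" for n
  proof -
    obtain k where k: "n = Suc k" "k \<ge> N" using n by (cases n) auto
    have "\<bar>ln C\<bar> < 2 ^ N * d 0" using N d0 by (simp add: field_simps)
    also have "\<dots> \<le> 2 ^ k * d 0" using k d0 by (intro mult_right_mono power_increasing) auto
    also have "\<dots> \<le> d k" using grow by blast
    finally have "ln C < d k" by linarith
    then have "C < exp (d k)" using C by (metis exp_less_cancel_iff exp_ln)
    then have "C * exp (iter_exp k s) < exp (d k) * exp (iter_exp k s)" by simp
    also have "\<dots> = exp (iter_exp k t)" by (simp add: d_def flip: exp_add)
    finally show ?thesis by (simp add: k)
  qed
  then show ?thesis by blast
qed

section \<open>Leaves\<close>

text \<open>\<open>F\<close> will be an iterate of \<open>f\<close>; the disc of radius \<open>exp \<rho>\<close> contains the postsingular set, so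
  exponential lifts defined on \<open>rhp \<rho>\<close> can be lifted through \<open>F\<close> indefinitely.\<close>

locale escape_map =
  fixes F :: "complex \<Rightarrow> complex" and \<rho> M :: real and p :: nat
  assumes hol: "F holomorphic_on UNIV"
    and lift: "\<lbrakk>V holomorphic_on rhp \<rho>; \<And>x. x \<in> rhp \<rho> \<Longrightarrow> (F ^^ n) (V x) = exp x; \<zeta> \<in> rhp \<rho>; F y = V \<zeta>\<rbrakk>
      \<Longrightarrow> \<exists>W. W holomorphic_on rhp \<rho> \<and> W \<zeta> = y \<and> (\<forall>x\<in>rhp \<rho>. F (W x) = V x)"
    and inj: "\<lbrakk>W holomorphic_on rhp \<rho>; \<And>x. x \<in> rhp \<rho> \<Longrightarrow> F (W x) = exp x\<rbrakk> \<Longrightarrow> inj_on W (rhp \<rho>)"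
    and p: "p \<ge> 1"
    and grow: "\<lbrakk>L holomorphic_on rhp a; \<And>x. x \<in> rhp a \<Longrightarrow> F (exp (L x)) = exp x\<rbrakk> \<Longrightarrow>
      \<exists>D\<ge>1. \<exists>t0. \<forall>t\<ge>t0. Re (L (of_real (iter_exp p t))) \<ge> t / D \<and> norm (L (of_real (iter_exp p t))) \<le> D * t"
    and unbounded: "\<exists>z. norm (F z) > B"
    and M: "M \<ge> \<rho> + 1" "norm z \<le> exp (\<rho> + 1) \<Longrightarrow> norm (F z) \<le> exp M"
begin

lemma rhp_M_subset: "x \<in> rhp M \<Longrightarrow> x \<in> rhp \<rho>"
  using M(1) by simp

text \<open>By the choice of \<open>M\<close>, lifts over \<open>rhp M\<close> avoid the disc of
  radius \<open>exp (\<rho> + 1)\<close>, so their logarithms fall back into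
  \<open>rhp \<rho>\<close>, the domain of leaves. The margin 1 from the boundary line keeps later
  Lipschitz constants uniform.\<close>

lemma tract_log:
  assumes W: "W holomorphic_on rhp \<rho>" "\<And>x. x \<in> rhp \<rho> \<Longrightarrow> F (W x) = exp x"
  obtains L where "L holomorphic_on rhp M" "\<And>x. x \<in> rhp M \<Longrightarrow> exp (L x) = W x"
    "\<And>x. x \<in> rhp M \<Longrightarrow> Re (L x) > \<rho> + 1"
    "\<And>x. x \<in> rhp M \<Longrightarrow> norm (deriv L x) \<le> 12 * pi / (Re x - M)"
proof -
  have sub: "rhp M \<subseteq> rhp \<rho>" using rhp_M_subset by blast
  have large: "norm (W x) > exp (\<rho> + 1)" if x: "x \<in> rhp M" for x
  proof (rule ccontr)
    assume "\<not> ?thesis"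
    then have "norm (F (W x)) \<le> exp M" using M(2) by simp
    then show False using W(2)[OF rhp_M_subset[OF x]] x by simp
  qed
  have nz: "W x \<noteq> 0" if "x \<in> rhp M" for x using large[OF that] by (metis norm_zero not_exp_less_zero)
  have "of_real (M + 1) \<in> rhp M" by simp
  then obtain L where L: "L holomorphic_on rhp M" "\<And>x. x \<in> rhp M \<Longrightarrow> exp (L x) = W x"
    using holomorphic_logarithm_exists[OF convex_rhp open_rhp holomorphic_on_subset[OF W(1) sub] nz] by blast
  have "Re (L x) > \<rho> + 1" if "x \<in> rhp M" for x
    using large[OF that] L(2)[OF that] by (metis exp_less_cancel_iff norm_exp_eq_Re)
  moreover have "inj_on (\<lambda>x. exp (L x)) (rhp M)"
    using inj_on_subset[OF inj[OF W] sub] L(2) by (simp add: inj_on_def)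
  ultimately show ?thesis using that L log_deriv_bound[OF L(1)] by blast
qed

text \<open>Repeating the \<open>m\<close> branches periodically gives the sequence that
  \<open>tail_curves\<close> requires; being finitely many, they share growth constants.\<close>

lemma tail_curves_cyclic:
  assumes m: "m \<ge> 1" and L: "\<And>j. j < m \<Longrightarrow> L j holomorphic_on rhp M"
    and FL: "\<And>j x. j < m \<Longrightarrow> x \<in> rhp M \<Longrightarrow> F (exp (L j x)) = exp x"
    and bd: "\<And>j x. j < m \<Longrightarrow> x \<in> rhp M \<Longrightarrow> norm (deriv (L j) x) \<le> 12 * pi / (Re x - M)"
  shows "\<exists>\<eta> t1 D. D \<ge> 1 \<and> t1 \<ge> 1 \<and> (\<forall>j. continuous_on {t1..} (\<eta> j)) \<and>
    (\<forall>j. \<forall>t\<ge>t1. Re (\<eta> j t) > M \<and> Re (\<eta> j t) \<ge> t / (2 * D) \<and> norm (\<eta> j t) \<le> 2 * D * t) \<and>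
    (\<forall>j<m. \<forall>t\<ge>t1. \<eta> j t = L j (\<eta> (Suc j) (iter_exp p t))) \<and> \<eta> m = \<eta> 0"
proof -
  define K where "K j = L (j mod m)" for j
  have jm: "j mod m < m" for j using m by simp
  have "\<forall>j. \<exists>D t0. j < m \<longrightarrow> D \<ge> 1 \<and> (\<forall>t\<ge>t0. Re (L j (of_real (iter_exp p t))) \<ge> t / D \<and> norm (L j (of_real (iter_exp p t))) \<le> D * t)"
    using grow[OF L FL] by blast
  then obtain Dj tj where DT: "\<And>j. j < m \<Longrightarrow> Dj j \<ge> 1"
    "\<And>j t. j < m \<Longrightarrow> t \<ge> tj j \<Longrightarrow> Re (L j (of_real (iter_exp p t))) \<ge> t / Dj j \<and> norm (L j (of_real (iter_exp p t))) \<le> Dj j * t"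
    by metis
  define D where "D = Max (Dj ` {..<m})"
  define t0 where "t0 = Max (insert 1 (tj ` {..<m}))"
  have Dm: "Dj j \<le> D" "tj j \<le> t0" if "j < m" for j using that by (auto simp: D_def t0_def)
  have D1: "D \<ge> 1" using Dm(1)[of 0] DT(1)[of 0] m by linarith
  have t01: "t0 \<ge> 1" by (simp add: t0_def)
  have gr: "Re (K j (of_real (iter_exp p t))) \<ge> t / D \<and> norm (K j (of_real (iter_exp p t))) \<le> D * t" if t: "t \<ge> t0" for j t
  proof -
    have tt: "t \<ge> tj (j mod m)" "t \<ge> 1" using Dm(2)[OF jm] t t01 by (meson order_trans)+
    have "t / D \<le> t / Dj (j mod m)" using tt(2) Dm(1)[OF jm] DT(1)[OF jm] D1
      by (intro divide_left_mono mult_pos_pos) (auto intro: less_le_trans[OF zero_less_one])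
    moreover have "Dj (j mod m) * t \<le> D * t" using tt(2) Dm(1)[OF jm] by (intro mult_right_mono) auto
    ultimately show ?thesis using DT(2)[OF jm tt(1)] unfolding K_def by (meson order_trans)
  qed
  have "\<exists>\<eta> t1. t1 \<ge> 1 \<and> (\<forall>j. continuous_on {t1..} (\<eta> j)) \<and>
    (\<forall>j. \<forall>t\<ge>t1. \<eta> j t = K j (\<eta> (Suc j) (iter_exp p t)) \<and> Re (\<eta> j t) > M \<and> Re (\<eta> j t) \<ge> t / (2 * D) \<and> norm (\<eta> j t) \<le> 2 * D * t) \<and>
    (\<forall>j m. (\<forall>i. K (i + m) = K i) \<longrightarrow> \<eta> (j + m) = \<eta> j)"
    by (rule tail_curves[OF _ _ _ D1 gr continuous_iter_exp iter_exp_ge]) (use L bd jm in \<open>auto simp: K_def\<close>)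
  then obtain \<eta> t1 where *: "t1 \<ge> 1" "\<And>j. continuous_on {t1..} (\<eta> j)"
    "\<And>j t. t \<ge> t1 \<Longrightarrow> \<eta> j t = K j (\<eta> (Suc j) (iter_exp p t)) \<and> Re (\<eta> j t) > M \<and> Re (\<eta> j t) \<ge> t / (2 * D) \<and> norm (\<eta> j t) \<le> 2 * D * t"
    "\<And>j m. (\<forall>i. K (i + m) = K i) \<Longrightarrow> \<eta> (j + m) = \<eta> j"
    by blast
  have "\<eta> (0 + m) = \<eta> 0" by (rule *(4)) (simp add: K_def)
  moreover have "\<eta> j t = L j (\<eta> (Suc j) (iter_exp p t))" if "j < m" "t \<ge> t1" for j t
    using *(3)[OF that(2), of j] that(1) by (simp add: K_def)
  moreover have "\<forall>j. \<forall>t\<ge>t1. Re (\<eta> j t) > M \<and> Re (\<eta> j t) \<ge> t / (2 * D) \<and> norm (\<eta> j t) \<le> 2 * D * t"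
    using *(3) by blast
  ultimately have "D \<ge> 1 \<and> t1 \<ge> 1 \<and> (\<forall>j. continuous_on {t1..} (\<eta> j)) \<and>
    (\<forall>j. \<forall>t\<ge>t1. Re (\<eta> j t) > M \<and> Re (\<eta> j t) \<ge> t / (2 * D) \<and> norm (\<eta> j t) \<le> 2 * D * t) \<and>
    (\<forall>j<m. \<forall>t\<ge>t1. \<eta> j t = L j (\<eta> (Suc j) (iter_exp p t))) \<and> \<eta> m = \<eta> 0"
    using *(1,2) D1 by simp
  then show ?thesis by blast
qed

text \<open>A single branch, the case \<open>m = 1\<close>, already yields a curve that
  \<open>F\<close> maps into itself, moving the parameter by \<open>iter_exp p\<close> and hence its
  points to infinity.\<close>

lemma escaping_point: "\<exists>\<zeta>\<in>rhp \<rho>. \<forall>B. \<exists>N. \<forall>n\<ge>N. norm ((F ^^ n) (exp \<zeta>)) > B"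
proof -
  obtain z where z: "norm (F z) > exp \<rho>" using unbounded by blast
  have "F z \<noteq> 0" using z by (metis norm_zero not_exp_less_zero)
  then have e: "exp (Ln (F z)) = F z" by simp
  then have "exp (Re (Ln (F z))) > exp \<rho>" using z by (metis norm_exp_eq_Re)
  then have Lin: "Ln (F z) \<in> rhp \<rho>" by simp
  have "\<exists>W. W holomorphic_on rhp \<rho> \<and> W (Ln (F z)) = z \<and> (\<forall>x\<in>rhp \<rho>. F (W x) = exp x)"
    by (rule lift[where n = 0]) (use Lin e in \<open>auto intro: holomorphic_intros\<close>)
  then obtain W where W: "W holomorphic_on rhp \<rho>" "\<And>x. x \<in> rhp \<rho> \<Longrightarrow> F (W x) = exp x" by blast
  obtain L where L: "L holomorphic_on rhp M" "\<And>x. x \<in> rhp M \<Longrightarrow> exp (L x) = W x"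
    "\<And>x. x \<in> rhp M \<Longrightarrow> norm (deriv L x) \<le> 12 * pi / (Re x - M)" using tract_log[OF W] by metis
  have FL: "F (exp (L x)) = exp x" if "x \<in> rhp M" for x using L(2)[OF that] W(2)[OF rhp_M_subset[OF that]] by simp
  obtain \<eta> t1 D where 0: "D \<ge> 1 \<and> t1 \<ge> 1 \<and> (\<forall>j. continuous_on {t1..} (\<eta> j)) \<and>
    (\<forall>j. \<forall>t\<ge>t1. Re (\<eta> j t) > M \<and> Re (\<eta> j t) \<ge> t / (2 * D) \<and> norm (\<eta> j t) \<le> 2 * D * t) \<and>
    (\<forall>j<1. \<forall>t\<ge>t1. \<eta> j t = L (\<eta> (Suc j) (iter_exp p t))) \<and> \<eta> 1 = \<eta> 0"
    using tail_curves_cyclic[of 1 "\<lambda>_. L", OF order_refl L(1) FL L(3)] by metis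
  then have *: "D \<ge> 1" "t1 \<ge> 1"
    "\<And>j t. t \<ge> t1 \<Longrightarrow> Re (\<eta> j t) > M \<and> Re (\<eta> j t) \<ge> t / (2 * D)"
    "\<And>t. t \<ge> t1 \<Longrightarrow> \<eta> 0 t = L (\<eta> (Suc 0) (iter_exp p t))" "\<eta> (Suc 0) = \<eta> 0"
    by simp_all
  have orb: "iter_exp (p * n) t1 \<ge> t1 \<and> (F ^^ n) (exp (\<eta> 0 t1)) = exp (\<eta> 0 (iter_exp (p * n) t1))" for n
  proof (induction n)
    case (Suc n)
    define s where "s = iter_exp (p * n) t1"
    have s: "s \<ge> t1" using Suc by (simp add: s_def)
    have es: "iter_exp p s = iter_exp (p * Suc n) t1" by (simp add: s_def funpow_add)
    have ge: "iter_exp p s \<ge> t1" using iter_exp_ge[of s p] s by linarith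
    have "F (exp (\<eta> 0 s)) = F (exp (L (\<eta> 0 (iter_exp p s))))" using *(4)[OF s] *(5) by simp
    also have "\<dots> = exp (\<eta> 0 (iter_exp p s))" using FL *(3)[OF ge] by simp
    finally show ?case using Suc es ge by (simp add: s_def)
  qed simp
  have "\<exists>N. \<forall>n\<ge>N. norm ((F ^^ n) (exp (\<eta> 0 t1))) > B" for B
  proof -
    have "norm ((F ^^ n) (exp (\<eta> 0 t1))) > B" if n: "n \<ge> nat \<lceil>2 * D * \<bar>B\<bar>\<rceil>" for n
    proof -
      define s where "s = iter_exp (p * n) t1"
      have s: "s \<ge> t1" "(F ^^ n) (exp (\<eta> 0 t1)) = exp (\<eta> 0 s)" using orb[of n] by (simp_all add: s_def)
      have "n \<le> p * n" using p by simp
      then have "real n \<le> real (p * n)" by (rule of_nat_mono)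
      then have "s \<ge> real n" using iter_exp_ge_plus[of t1 "p * n"] *(2) unfolding s_def by linarith
      then have "s \<ge> 2 * D * \<bar>B\<bar>" using n by linarith
      then have "s / (2 * D) \<ge> \<bar>B\<bar>" using *(1) by (simp add: pos_le_divide_eq mult_ac)
      then have "Re (\<eta> 0 s) \<ge> \<bar>B\<bar>" using *(3)[OF s(1), of 0] by linarith
      then have "exp (Re (\<eta> 0 s)) > B" using exp_ge_add_one_self[of "Re (\<eta> 0 s)"] by linarith
      then show ?thesis using s(2) by simp
    qed
    then show ?thesis by blast
  qed
  moreover have "\<eta> 0 t1 \<in> rhp \<rho>" using *(3)[of t1 0] M(1) by simp
  ultimately show ?thesis by blast
qed

text \<open>Values off \<open>rhp \<rho>\<close> are arbitrary, so leaves are compared on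
  \<open>rhp \<rho>\<close> only. With \<open>V 0\<close> pinned to \<open>exp\<close>, a leaf is
  determined by its values at one point.\<close>

definition leaf :: "(nat \<Rightarrow> complex \<Rightarrow> complex) \<Rightarrow> bool" where
  "leaf V \<longleftrightarrow> (\<forall>n. V n holomorphic_on rhp \<rho>) \<and> (\<forall>x\<in>rhp \<rho>. V 0 x = exp x) \<and>
     (\<forall>n. \<forall>x\<in>rhp \<rho>. F (V (Suc n) x) = V n x)"

lemma leaf_funpow: "leaf V \<Longrightarrow> x \<in> rhp \<rho> \<Longrightarrow> (F ^^ n) (V (n + m) x) = V m x"
proof (induction n)
  case (Suc n)
  then show ?case by (simp add: leaf_def funpow_swap1)
qed simp

lemma leaf_exp: "leaf V \<Longrightarrow> x \<in> rhp \<rho> \<Longrightarrow> (F ^^ n) (V n x) = exp x"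
  using leaf_funpow[of V x n 0] by (simp add: leaf_def)

lemma leaf_hol: "leaf V \<Longrightarrow> V n holomorphic_on rhp \<rho>"
  by (simp add: leaf_def)

lemma leaf_deriv: "leaf V \<Longrightarrow> x \<in> rhp \<rho> \<Longrightarrow> deriv (F ^^ n) (V n x) \<noteq> 0"
  by (rule deriv_nonzero_of_exp[OF holomorphic_funpow[OF hol] leaf_hol open_rhp leaf_exp])

text \<open>\<open>V 1\<close> is a function of \<open>V (Suc n)\<close>, so injectivity passes from
  \<open>V 1\<close> to all later lifts. Index 0 is excluded because \<open>exp\<close> is not
  injective.\<close>

lemma leaf_inj: "leaf V \<Longrightarrow> inj_on (V (Suc n)) (rhp \<rho>)"
proof (rule inj_onI)
  fix x y assume V: "leaf V" and xy: "x \<in> rhp \<rho>" "y \<in> rhp \<rho>" "V (Suc n) x = V (Suc n) y"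
  then have "V 1 x = V 1 y" using leaf_funpow[OF V, of _ n 1] by (metis Suc_eq_plus1)
  moreover have "inj_on (V 1) (rhp \<rho>)"
    by (rule inj[OF leaf_hol[OF V]]) (use leaf_exp[OF V, of _ 1] in simp)
  ultimately show "x = y" using xy by (auto simp: inj_on_def)
qed

text \<open>Lift repeatedly, using \<open>b\<close> for the base values. \<open>P\<close> records
  \<open>(F ^^ n) (W x) = exp x\<close>, the premise of the assumption \<open>lift\<close>.\<close>

lemma leaf_ex:
  assumes \<zeta>: "\<zeta> \<in> rhp \<rho>" and b: "b 0 = exp \<zeta>" "\<And>n. F (b (Suc n)) = b n"
  shows "\<exists>V. leaf V \<and> (\<forall>n. V n \<zeta> = b n)"
proof -
  define P where "P n W \<longleftrightarrow> W holomorphic_on rhp \<rho> \<and> (\<forall>x\<in>rhp \<rho>. (F ^^ n) (W x) = exp x) \<and> W \<zeta> = b n \<and> (n = 0 \<longrightarrow> W = exp)" for n W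
  define Q where "Q n W W' \<longleftrightarrow> (\<forall>x\<in>rhp \<rho>. F (W' x) = W x)" for n :: nat and W W' :: "complex \<Rightarrow> complex"
  have "\<exists>V. \<forall>n. P n (V n) \<and> Q n (V n) (V (Suc n))"
  proof (rule dependent_nat_choice)
    show "\<exists>W. P 0 W" by (intro exI[of _ exp]) (auto simp: P_def b(1) intro: holomorphic_intros)
    fix W n assume W: "P n W"
    have "\<exists>W'. W' holomorphic_on rhp \<rho> \<and> W' \<zeta> = b (Suc n) \<and> (\<forall>x\<in>rhp \<rho>. F (W' x) = W x)"
      by (rule lift[where n = n]) (use W \<zeta> b in \<open>auto simp: P_def\<close>)
    then obtain W' where W': "W' holomorphic_on rhp \<rho>" "W' \<zeta> = b (Suc n)" "\<forall>x\<in>rhp \<rho>. F (W' x) = W x" by blast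
    then have "P (Suc n) W'" using W by (auto simp: P_def funpow_swap1)
    then show "\<exists>W'. P (Suc n) W' \<and> Q n W W'" using W' by (auto simp: Q_def)
  qed
  then obtain V where V: "\<And>n. P n (V n)" "\<And>n. Q n (V n) (V (Suc n))" by blast
  then have "V 0 = exp" by (simp add: P_def)
  then have "leaf V" using V by (auto simp: leaf_def P_def Q_def)
  then show ?thesis using V by (auto simp: P_def)
qed

lemma leaf_unique:
  assumes V: "leaf V" and W: "leaf W" and \<zeta>: "\<zeta> \<in> rhp \<rho>" "V n \<zeta> = W n \<zeta>" and x: "x \<in> rhp \<rho>"
  shows "V n x = W n x"
  by (rule exp_lift_unique[OF holomorphic_funpow[OF hol] leaf_hol[OF V] leaf_hol[OF W] leaf_exp[OF V] leaf_exp[OF W] \<zeta> x])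

text \<open>Needed both on half-planes, with \<open>g\<close> a logarithm, and on segments along
  which \<open>v\<close> is built from a local inverse. The derivative of \<open>F ^^ n\<close>
  cannot vanish at a leaf value, being a factor of the derivative of
  \<open>F ^^ (m + n)\<close>.\<close>

lemma leaf_unique_on:
  fixes u v :: "'a::topological_space \<Rightarrow> complex"
  assumes V: "leaf V" and X: "connected X" "continuous_on X g" "\<And>x. x \<in> X \<Longrightarrow> g x \<in> rhp \<rho>" "continuous_on X v"
    and eq: "\<And>x. x \<in> X \<Longrightarrow> (F ^^ n) (v x) = (F ^^ n) (V (n + m) (g x))"
    and x0: "x0 \<in> X" "V (n + m) (g x0) = v x0" and x: "x \<in> X"
  shows "V (n + m) (g x) = v x"
proof (rule lift_unique[where h = "F ^^ n" and X = X and u = "\<lambda>x. V (n + m) (g x)" and v = v and ?x0.0 = x0])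
  show "continuous_on X (\<lambda>x. V (n + m) (g x))"
    by (rule continuous_on_compose2[OF holomorphic_on_imp_continuous_on[OF leaf_hol[OF V]] X(2)]) (use X(3) in auto)
  show "deriv (F ^^ n) (V (n + m) (g x)) \<noteq> 0" if "x \<in> X" for x
  proof
    assume z: "deriv (F ^^ n) (V (n + m) (g x)) = 0"
    have "deriv ((F ^^ m) \<circ> (F ^^ n)) (V (n + m) (g x)) =
        deriv (F ^^ m) ((F ^^ n) (V (n + m) (g x))) * deriv (F ^^ n) (V (n + m) (g x))"
      using holomorphic_funpow[OF hol] by (intro deriv_chain) (auto simp: holomorphic_on_open field_differentiable_def)
    then have "deriv (F ^^ (m + n)) (V (n + m) (g x)) = 0" using z by (simp add: funpow_add)
    then show False using leaf_deriv[OF V X(3)[OF that], of "n + m"] by (simp add: add.commute)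
  qed
qed (use X eq x0 x holomorphic_funpow[OF hol] in auto)

text \<open>Here \<open>V'\<close> is \<open>V\<close> without its first lift, written in the coordinate \<open>L = ln (V 1)\<close>.\<close>

definition linked :: "(nat \<Rightarrow> complex \<Rightarrow> complex) \<Rightarrow> (complex \<Rightarrow> complex) \<Rightarrow> (nat \<Rightarrow> complex \<Rightarrow> complex) \<Rightarrow> bool" where
  "linked V L V' \<longleftrightarrow> L holomorphic_on rhp M \<and>
     (\<forall>x\<in>rhp M. exp (L x) = V 1 x \<and> Re (L x) > \<rho> + 1 \<and> norm (deriv L x) \<le> 12 * pi / (Re x - M)) \<and>
     (\<forall>n. \<forall>x\<in>rhp M. V' n (L x) = V (Suc n) x)"

text \<open>The points \<open>V (Suc n) x0\<close> form a backward orbit of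
  \<open>exp (L x0)\<close>. The leaf through it agrees with the shifted lifts on all of
  \<open>rhp M\<close> by uniqueness.\<close>

lemma leaf_step:
  assumes V: "leaf V"
  shows "\<exists>V' L. leaf V' \<and> linked V L V'"
proof -
  have V1: "V 1 holomorphic_on rhp \<rho>" "\<And>x. x \<in> rhp \<rho> \<Longrightarrow> F (V 1 x) = exp x"
    using leaf_hol[OF V] leaf_exp[OF V, of _ 1] by simp_all
  obtain L where L: "L holomorphic_on rhp M" "\<And>x. x \<in> rhp M \<Longrightarrow> exp (L x) = V 1 x"
    "\<And>x. x \<in> rhp M \<Longrightarrow> Re (L x) > \<rho> + 1"
    "\<And>x. x \<in> rhp M \<Longrightarrow> norm (deriv L x) \<le> 12 * pi / (Re x - M)" using tract_log[OF V1] by metis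
  define x0 where "x0 = complex_of_real (M + 1)"
  have x0: "x0 \<in> rhp M" by (simp add: x0_def)
  have Lr: "L x \<in> rhp \<rho>" if "x \<in> rhp M" for x using L(3)[OF that] by simp
  have "\<exists>V'. leaf V' \<and> (\<forall>n. V' n (L x0) = V (Suc n) x0)"
    by (rule leaf_ex[OF Lr[OF x0]]) (use V L(2)[OF x0] rhp_M_subset[OF x0] in \<open>auto simp: leaf_def\<close>)
  then obtain V' where V': "leaf V'" "\<And>n. V' n (L x0) = V (Suc n) x0" by blast
  have "V' (n + 0) (L x) = V (Suc n) x" if x: "x \<in> rhp M" for n x
  proof (rule leaf_unique_on[OF V'(1), where X = "rhp M" and g = L and v = "V (Suc n)" and ?x0.0 = x0])
    show "continuous_on (rhp M) L" using L(1) by (rule holomorphic_on_imp_continuous_on)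
    show "continuous_on (rhp M) (V (Suc n))"
      using leaf_hol[OF V, of "Suc n"] rhp_M_subset
      by (meson continuous_on_subset holomorphic_on_imp_continuous_on subsetI)
    show "(F ^^ n) (V (Suc n) x) = (F ^^ n) (V' (n + 0) (L x))" if "x \<in> rhp M" for x
      using leaf_funpow[OF V rhp_M_subset[OF that], of n 1] leaf_exp[OF V'(1) Lr[OF that], of n] L(2)[OF that] by simp
  qed (use x0 V'(2) x Lr in auto)
  then show ?thesis using V'(1) L by (intro exI[of _ V'] exI[of _ L]) (simp add: linked_def)
qed

lemma leaf_shift:
  assumes "leaf V"
  shows "leaf (\<lambda>n x. V n (x + of_real (of_int (2 * k) * pi) * \<i>))"
proof -
  have "(\<lambda>x. V n (x + of_real (of_int (2 * k) * pi) * \<i>)) holomorphic_on rhp \<rho>" for n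
    by (rule holomorphic_on_compose_gen[OF _ leaf_hol[OF assms], unfolded o_def]) (auto intro!: holomorphic_intros)
  moreover have "exp (x + of_real (of_int (2 * k) * pi) * \<i>) = exp x" for x by (subst exp_eq) blast
  ultimately show ?thesis using assms by (auto simp: leaf_def)
qed

end

section \<open>Contraction of late lifts\<close>

text \<open>A distortion estimate: as \<open>X\<close> is injective and omits \<open>c\<close>, a
  logarithm of \<open>X - c\<close> is Lipschitz with a constant that does not depend on
  \<open>X\<close>.\<close>

lemma log_lipschitz:
  assumes X: "X holomorphic_on rhp a" "inj_on X (rhp a)" "\<And>x. x \<in> rhp a \<Longrightarrow> X x \<noteq> c"
    and s: "s > a" and xy: "Re x \<ge> s" "Re y \<ge> s"
  shows "norm (X x - c) \<le> exp (12 * pi / (s - a) * norm (x - y)) * norm (X y - c)"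
proof -
  have Xc: "(\<lambda>x. X x - c) holomorphic_on rhp a" by (intro holomorphic_intros X)
  obtain l where l: "l holomorphic_on rhp a" "\<And>x. x \<in> rhp a \<Longrightarrow> exp (l x) = X x - c"
    using holomorphic_logarithm_exists[OF convex_rhp open_rhp Xc, of "of_real (a + 1)"] X(3) by auto
  have inj: "inj_on (\<lambda>x. exp (l x)) (rhp a)"
    using X(2) l(2) by (simp add: inj_on_def)
  have xin: "x \<in> rhp a" "y \<in> rhp a" using s xy by auto
  have "norm (l x - l y) \<le> 12 * pi / (s - a) * norm (x - y)"
    by (rule lipschitz_right_of[OF l(1) log_deriv_bound[OF l(1) inj] s _ xy]) simp_all
  then have "Re (l x) \<le> 12 * pi / (s - a) * norm (x - y) + Re (l y)"
    using abs_Re_le_cmod[of "l x - l y"] by simp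
  then have "exp (Re (l x)) \<le> exp (12 * pi / (s - a) * norm (x - y)) * exp (Re (l y))"
    by (simp flip: exp_add)
  moreover have "norm (X x - c) = exp (Re (l x))" "norm (X y - c) = exp (Re (l y))"
    using l(2) xin by (metis norm_exp_eq_Re)+
  ultimately show ?thesis by simp
qed

text \<open>Otherwise a subsequence has a nonconstant limit, so its members share a value near an escaping
  point \<open>exp \<zeta>\<close>; by \<open>X(4)\<close> the orbit of \<open>exp \<zeta>\<close> would then return to a bounded set infinitely often.\<close>

lemma (in escape_map) contraction_seq:
  assumes X: "\<And>k. X k holomorphic_on rhp \<rho>" "\<And>k. inj_on (X k) (rhp \<rho>)"
    "\<And>k x. x \<in> rhp \<rho> \<Longrightarrow> X k x \<noteq> z0" "\<And>k x. x \<in> rhp \<rho> \<Longrightarrow> (F ^^ n k) (X k x) = exp x"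
    and n: "\<And>k. n k \<ge> k" and Q: "compact Q" "Q \<subseteq> {x. Re x \<ge> s}" "s > \<rho>"
    and xy: "\<And>k. x k \<in> Q" "\<And>k. y k \<in> Q" and bd: "\<And>k. norm (X k (x k) - z0) \<le> \<delta>" and \<kappa>: "\<kappa> > 0"
  shows "\<exists>k. norm (X k (y k) - X k (x k)) < \<kappa>"
proof (rule ccontr)
  assume "\<not> ?thesis"
  then have far: "norm (X k (y k) - X k (x k)) \<ge> \<kappa>" for k by (simp add: not_less)
  \<comment> \<open>Each \<open>X k\<close> omits \<open>z0\<close> and takes one value within
    \<open>\<delta>\<close> of it; \<open>log_lipschitz\<close> then bounds all \<open>X k\<close>
    on a compact set together, as Montel's theorem demands.\<close>
  have bdX: "\<exists>B. \<forall>h\<in>range X. \<forall>z\<in>K. norm (h z) \<le> B" if K: "compact K" "K \<subseteq> rhp \<rho>" for K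
  proof (cases "K = {}")
    case False
    have "continuous_on K Re" by (intro continuous_intros)
    then obtain k0 where k0: "k0 \<in> K" "\<And>z. z \<in> K \<Longrightarrow> Re k0 \<le> Re z"
      using continuous_attains_inf[OF K(1) False] by blast
    define s' where "s' = min s (Re k0)"
    have s': "s' > \<rho>" using k0(1) K(2) Q(3) by (auto simp: s'_def)
    obtain B1 where B1: "\<And>z. z \<in> K \<Longrightarrow> norm z \<le> B1" using compact_imp_bounded[OF K(1)] unfolding bounded_iff by blast
    obtain B2 where B2: "\<And>z. z \<in> Q \<Longrightarrow> norm z \<le> B2" using compact_imp_bounded[OF Q(1)] unfolding bounded_iff by blast
    have "norm (X k z) \<le> exp (12 * pi / (s' - \<rho>) * (B1 + B2)) * \<delta> + norm z0" if z: "z \<in> K" for k z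
    proof -
      have "norm (X k z - z0) \<le> exp (12 * pi / (s' - \<rho>) * norm (z - x k)) * norm (X k (x k) - z0)"
        by (rule log_lipschitz[OF X(1,2,3) s']) (use k0(2)[OF z] xy(1)[of k] Q(2) in \<open>auto simp: s'_def\<close>)
      also have "\<dots> \<le> exp (12 * pi / (s' - \<rho>) * (B1 + B2)) * \<delta>"
      proof (rule mult_mono)
        have "norm (z - x k) \<le> norm z + norm (x k)" by norm
        also have "\<dots> \<le> B1 + B2" using B1[OF z] B2[OF xy(1)] by (rule add_mono)
        finally have "12 * pi / (s' - \<rho>) * norm (z - x k) \<le> 12 * pi / (s' - \<rho>) * (B1 + B2)"
          using s' by (intro mult_left_mono) auto
        then show "exp (12 * pi / (s' - \<rho>) * norm (z - x k)) \<le> exp (12 * pi / (s' - \<rho>) * (B1 + B2))" by simp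
      qed (use bd in auto)
      finally have "norm (X k z - z0) \<le> exp (12 * pi / (s' - \<rho>) * (B1 + B2)) * \<delta>" .
      moreover have "norm (X k z) \<le> norm (X k z - z0) + norm z0" by norm
      ultimately show ?thesis by linarith
    qed
    then show ?thesis by blast
  qed auto
  have holX: "h holomorphic_on rhp \<rho>" if "h \<in> range X" for h using that X(1) by blast
  obtain g r where g: "g holomorphic_on rhp \<rho>" and r: "strict_mono (r :: nat \<Rightarrow> nat)"
    and lim: "\<And>x. x \<in> rhp \<rho> \<Longrightarrow> (\<lambda>n. X (r n) x) \<longlonglongrightarrow> g x"
    and ul: "\<And>K. compact K \<Longrightarrow> K \<subseteq> rhp \<rho> \<Longrightarrow> uniform_limit K (X \<circ> r) g sequentially"
  proof (rule Montel[OF open_rhp holX bdX order_refl], goal_cases)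
    case (4 g r)
    then show ?case using that by blast
  qed assumption+
  have Qsub: "Q \<subseteq> rhp \<rho>" using Q(2,3) by force
  have nc: "\<not> g constant_on rhp \<rho>"
  proof
    assume "g constant_on rhp \<rho>"
    then obtain c where c: "\<And>x. x \<in> rhp \<rho> \<Longrightarrow> g x = c" by (auto simp: constant_on_def)
    have "\<forall>\<^sub>F k in sequentially. \<forall>z\<in>Q. dist ((X \<circ> r) k z) (g z) < \<kappa> / 2"
      using ul[OF Q(1) Qsub] \<kappa> unfolding uniform_limit_iff by (meson half_gt_zero)
    then obtain k where k: "\<forall>z\<in>Q. dist ((X \<circ> r) k z) (g z) < \<kappa> / 2" using eventually_happens by fastforce
    have "norm (X (r k) (y (r k)) - c) < \<kappa> / 2" "norm (X (r k) (x (r k)) - c) < \<kappa> / 2"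
      using k xy Qsub c by (force simp: dist_norm)+
    moreover have "norm (X (r k) (y (r k)) - X (r k) (x (r k))) \<le> norm (X (r k) (y (r k)) - c) + norm (X (r k) (x (r k)) - c)" by norm
    ultimately show False using far[of "r k"] by linarith
  qed
  obtain \<zeta> where \<zeta>: "\<zeta> \<in> rhp \<rho>" and esc: "\<And>B. \<exists>N. \<forall>n\<ge>N. norm ((F ^^ n) (exp \<zeta>)) > B" using escaping_point by blast
  define d where "d = Re \<zeta> - \<rho>"
  have d: "d > 0" using \<zeta> by (simp add: d_def)
  have bsub: "ball \<zeta> d \<subseteq> rhp \<rho>" unfolding d_def by (rule ball_subset_rhp)
  \<comment> \<open>Hurwitz: \<open>g - g \<zeta>\<close> is nonconstant with a zero at
    \<open>\<zeta>\<close>, so the differences \<open>X (r k) z - X (r j) \<zeta>\<close> must have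
    zeros near \<open>\<zeta>\<close>. Hence maps of very different depth share a value.\<close>
  have hit: "\<exists>K. \<forall>k\<ge>K. \<forall>j\<ge>K. X (r j) \<zeta> \<in> X (r k) ` ball \<zeta> d"
  proof (rule ccontr)
    assume "\<not> ?thesis"
    then have "\<forall>K. \<exists>k j. k \<ge> K \<and> j \<ge> K \<and> X (r j) \<zeta> \<notin> X (r k) ` ball \<zeta> d" by blast
    then obtain a b where ab: "\<And>K. a K \<ge> K" "\<And>K. b K \<ge> K" "\<And>K. X (r (b K)) \<zeta> \<notin> X (r (a K)) ` ball \<zeta> d" by metis
    have fa: "filterlim a sequentially sequentially" "filterlim b sequentially sequentially"
      using ab(1,2) by (auto intro!: filterlim_at_top_mono[OF filterlim_ident] always_eventually)
    have blim: "(\<lambda>K. X (r (b K)) \<zeta>) \<longlonglongrightarrow> g \<zeta>"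
      using filterlim_compose[OF lim[OF \<zeta>] fa(2)] .
    have "(\<lambda>z. g z - g \<zeta>) \<zeta> \<noteq> 0"
    proof (rule Hurwitz_no_zeros[where \<F> = "\<lambda>K z. X (r (a K)) z - X (r (b K)) \<zeta>" and S = "ball \<zeta> d" and g = "\<lambda>z. g z - g \<zeta>" and ?z0.0 = \<zeta>])
      show "(\<lambda>z. X (r (a K)) z - X (r (b K)) \<zeta>) holomorphic_on ball \<zeta> d" for K
        by (intro holomorphic_intros holomorphic_on_subset[OF X(1) bsub])
      show "(\<lambda>z. g z - g \<zeta>) holomorphic_on ball \<zeta> d"
        by (intro holomorphic_intros holomorphic_on_subset[OF g bsub])
      show "uniform_limit K (\<lambda>Ka z. X (r (a Ka)) z - X (r (b Ka)) \<zeta>) (\<lambda>z. g z - g \<zeta>) sequentially"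
        if "compact K" "K \<subseteq> ball \<zeta> d" for K
      proof (rule uniform_limit_minus[where f = "\<lambda>Ka z. X (r (a Ka)) z" and g = "\<lambda>Ka z. X (r (b Ka)) \<zeta>" and l = g and m = "\<lambda>z. g \<zeta>"])
        have "uniform_limit K (X \<circ> r) g sequentially" using that bsub by (intro ul) auto
        then show "uniform_limit K (\<lambda>Ka z. X (r (a Ka)) z) g sequentially"
          using fa(1) by (auto simp: uniform_limit_iff o_def filterlim_iff)
        show "uniform_limit K (\<lambda>Ka z. X (r (b Ka)) \<zeta>) (\<lambda>z. g \<zeta>) sequentially"
          using blim by (auto simp: uniform_limit_iff tendsto_iff elim!: eventually_mono)
      qed
      show "\<not> (\<lambda>z. g z - g \<zeta>) constant_on ball \<zeta> d"
      proof
        assume "(\<lambda>z. g z - g \<zeta>) constant_on ball \<zeta> d"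
        then obtain c where "\<forall>z\<in>ball \<zeta> d. g z - g \<zeta> = c" unfolding constant_on_def by blast
        then have c: "\<And>z. z \<in> ball \<zeta> d \<Longrightarrow> g z = c + g \<zeta>" by (simp add: diff_eq_eq)
        have "g z = c + g \<zeta>" if "z \<in> rhp \<rho>" for z
        proof (rule analytic_continuation_open[of "ball \<zeta> d" "rhp \<rho>" g "\<lambda>_. c + g \<zeta>"])
          show "g z = c + g \<zeta>" if "z \<in> ball \<zeta> d" for z using c[OF that] .
        qed (use g bsub d that in simp_all)
        then show False using nc unfolding constant_on_def by blast
      qed
      show "X (r (a K)) z - X (r (b K)) \<zeta> \<noteq> 0" if "z \<in> ball \<zeta> d" for K z
        using ab(3)[of K] that by force
    qed (use d in auto)
    then show False by simp
  qed
  then obtain K where K: "\<And>k j. k \<ge> K \<Longrightarrow> j \<ge> K \<Longrightarrow> X (r j) \<zeta> \<in> X (r k) ` ball \<zeta> d" by blast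
  obtain N where N: "\<forall>i\<ge>N. norm ((F ^^ i) (exp \<zeta>)) > exp (Re \<zeta> + d)" using esc by blast
  \<comment> \<open>The depth \<open>n (r k)\<close> exceeds \<open>n (r K)\<close> by at least
    \<open>N\<close>. Applying \<open>F ^^ n (r k)\<close> to the shared value exhibits
    \<open>exp w\<close> as a late iterate of \<open>exp \<zeta>\<close>, too large for
    \<open>w\<close> in \<open>ball \<zeta> d\<close>.\<close>
  define k where "k = max K (n (r K) + N)"
  obtain w where w: "w \<in> ball \<zeta> d" "X (r K) \<zeta> = X (r k) w" using K[of k K] by (auto simp: k_def)
  have "n (r k) \<ge> k" using n[of "r k"] seq_suble[OF r, of k] by linarith
  then have nk: "n (r k) \<ge> n (r K) + N" by (simp add: k_def)
  define i where "i = n (r k) - n (r K)"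
  have i: "n (r k) = i + n (r K)" "i \<ge> N" using nk by (auto simp: i_def)
  have "exp w = (F ^^ (i + n (r K))) (X (r K) \<zeta>)" using X(4)[of w "r k"] w bsub i(1) by auto
  also have "\<dots> = (F ^^ i) (exp \<zeta>)" using X(4)[OF \<zeta>, of "r K"] by (simp add: funpow_add)
  finally have "norm (exp w) > exp (Re \<zeta> + d)" using N i(2) by simp
  then have "Re w > Re \<zeta> + d" by simp
  moreover have "\<bar>Re w - Re \<zeta>\<bar> \<le> norm (w - \<zeta>)" using abs_Re_le_cmod[of "w - \<zeta>"] by simp
  ultimately show False using w(1) by (simp add: dist_norm norm_minus_commute)
qed

text \<open>The common features of repelling and parabolic points. The local inverse
  \<open>\<phi>\<close> must attract those points whose orbit leaves the disc of radius
  \<open>exp \<rho>\<close>. One application of \<open>\<phi>\<close> takes them from the ball of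
  radius \<open>(1 + \<epsilon>) * \<delta>\<close> into \<open>cball z0 \<delta>\<close>; this
  slack pays for moving base points in \<open>reach_invariant\<close>.\<close>

locale exit_point = escape_map F \<rho> M p for F \<rho> M p +
  fixes z0 :: complex and \<phi> :: "complex \<Rightarrow> complex" and \<delta> \<epsilon> :: real
  assumes fixed: "F z0 = z0" and pos: "0 < \<delta>" "0 < \<epsilon>" "\<epsilon> \<le> 1" and small: "norm z0 + 2 * \<delta> \<le> exp \<rho>"
    and phi_cont: "continuous_on (ball z0 (2 * \<delta>)) \<phi>"
    and phi_inv: "x \<in> ball z0 (2 * \<delta>) \<Longrightarrow> F (\<phi> x) = x"
    and attract: "\<lbrakk>y \<in> ball z0 ((1 + \<epsilon>) * \<delta>); norm ((F ^^ j) y) > exp \<rho>; n \<ge> 1\<rbrakk> \<Longrightarrow> (\<phi> ^^ n) y \<in> cball z0 \<delta>"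
    and attract_lim: "\<lbrakk>y \<in> ball z0 ((1 + \<epsilon>) * \<delta>); norm ((F ^^ j) y) > exp \<rho>\<rbrakk> \<Longrightarrow> (\<lambda>n. (\<phi> ^^ n) y) \<longlonglongrightarrow> z0"
    and escape: "\<exists>x\<in>ball z0 \<delta>. \<exists>n. norm ((F ^^ n) x) > B"
begin

definition escaping :: "complex set" where
  "escaping = {y \<in> ball z0 ((1 + \<epsilon>) * \<delta>). \<exists>j. norm ((F ^^ j) y) > exp \<rho>}"

lemma cball_subset: "cball z0 \<delta> \<subseteq> ball z0 ((1 + \<epsilon>) * \<delta>)" and ball_subset2: "ball z0 ((1 + \<epsilon>) * \<delta>) \<subseteq> ball z0 (2 * \<delta>)"
proof -
  have "\<delta> < (1 + \<epsilon>) * \<delta>" using pos by simp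
  then show "cball z0 \<delta> \<subseteq> ball z0 ((1 + \<epsilon>) * \<delta>)" by auto
  have "(1 + \<epsilon>) * \<delta> \<le> 2 * \<delta>" using pos by (intro mult_right_mono) auto
  then show "ball z0 ((1 + \<epsilon>) * \<delta>) \<subseteq> ball z0 (2 * \<delta>)" by (rule subset_ball)
qed

lemma escaping_phi_ball: "y \<in> escaping \<Longrightarrow> (\<phi> ^^ n) y \<in> ball z0 (2 * \<delta>)"
  using attract[of y _ n] cball_subset ball_subset2 unfolding escaping_def by (cases n) fastforce+

lemma escaping_phi_cball: "y \<in> escaping \<Longrightarrow> n \<ge> 1 \<Longrightarrow> (\<phi> ^^ n) y \<in> cball z0 \<delta>"
  using attract by (auto simp: escaping_def)

lemma escaping_funpow_phi: "y \<in> escaping \<Longrightarrow> (F ^^ n) ((\<phi> ^^ n) y) = y"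
proof (induction n)
  case (Suc n)
  have "(F ^^ Suc n) ((\<phi> ^^ Suc n) y) = (F ^^ n) (F (\<phi> ((\<phi> ^^ n) y)))" by (simp add: funpow_swap1)
  then show ?case using phi_inv[OF escaping_phi_ball[OF Suc.prems]] Suc by simp
qed simp

lemma escaping_phi_cont: "continuous_on escaping (\<phi> ^^ n)"
proof (induction n)
  case (Suc n)
  have "continuous_on escaping (\<lambda>y. \<phi> ((\<phi> ^^ n) y))"
    by (rule continuous_on_compose2[OF phi_cont Suc]) (use escaping_phi_ball in blast)
  then show ?case by (simp add: o_def)
qed (simp add: id_def)

text \<open>\<open>F ^^ n\<close> maps \<open>V n x\<close> to \<open>exp x\<close>, outside the
  disc: every leaf value near \<open>z0\<close> is attracted by \<open>\<phi>\<close>.\<close>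

lemma leaf_escaping:
  assumes "leaf V" "x \<in> rhp \<rho>" "V n x \<in> ball z0 ((1 + \<epsilon>) * \<delta>)"
  shows "V n x \<in> escaping"
  using assms leaf_exp[OF assms(1,2), of n] by (auto simp: escaping_def intro!: exI[of _ n])

text \<open>The fixed point never leaves the disc of radius \<open>exp \<rho>\<close>, a leaf value
  does. Omitting \<open>z0\<close> allows logarithms of \<open>V n x - z0\<close>.\<close>

lemma leaf_omits:
  assumes "leaf V" "x \<in> rhp \<rho>"
  shows "V n x \<noteq> z0"
proof
  assume "V n x = z0"
  moreover have "(F ^^ n) z0 = z0" by (induction n) (simp_all add: fixed)
  ultimately have "exp x = z0" using leaf_exp[OF assms, of n] by simp
  then have "norm z0 = exp (Re x)" by (metis norm_exp_eq_Re)
  then have "norm z0 > exp \<rho>" using assms(2) by simp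
  then show False using small pos by simp
qed

text \<open>While \<open>V n\<close> stays near \<open>z0\<close>, both sides lift it through
  \<open>F ^^ k\<close> along the segment, so agreement at one end carries over to the
  other.\<close>

lemma leaf_segment:
  assumes V: "leaf V" and seg: "closed_segment a b \<subseteq> rhp \<rho>"
    and near: "\<And>\<xi>. \<xi> \<in> closed_segment a b \<Longrightarrow> V n \<xi> \<in> ball z0 ((1 + \<epsilon>) * \<delta>)"
    and a: "V (n + k) a = (\<phi> ^^ k) (V n a)"
  shows "V (n + k) b = (\<phi> ^^ k) (V n b)"
proof -
  have e: "V n \<xi> \<in> escaping" if "\<xi> \<in> closed_segment a b" for \<xi>
    using leaf_escaping[OF V _ near[OF that]] seg that by blast
  have "V (k + n) b = (\<phi> ^^ k) (V n b)"
  proof (rule leaf_unique_on[OF V, where X = "closed_segment a b" and g = "\<lambda>x. x" and v = "\<lambda>\<xi>. (\<phi> ^^ k) (V n \<xi>)" and ?x0.0 = a])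
    show "continuous_on (closed_segment a b) (\<lambda>\<xi>. (\<phi> ^^ k) (V n \<xi>))"
      by (rule continuous_on_compose2[OF escaping_phi_cont continuous_on_subset[OF holomorphic_on_imp_continuous_on[OF leaf_hol[OF V]] seg]])
        (use e in blast)
    show "(F ^^ k) ((\<phi> ^^ k) (V n x)) = (F ^^ k) (V (k + n) x)" if "x \<in> closed_segment a b" for x
      using escaping_funpow_phi[OF e[OF that]] leaf_funpow[OF V, of x k n] seg that by auto
    show "V (k + n) a = (\<phi> ^^ k) (V n a)" using a by (simp add: add.commute)
  qed (use seg in auto)
  then show ?thesis by (simp add: add.commute)
qed

text \<open>A leaf that reaches the fixed point within \<open>n\<close> steps is determined by the point \<open>V n \<zeta>\<close>, which ranges
  over a compact set.\<close>

definition reach :: "(nat \<Rightarrow> complex \<Rightarrow> complex) \<Rightarrow> nat \<Rightarrow> bool" where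
  "reach V n \<longleftrightarrow> (\<exists>\<zeta>. Re \<zeta> \<ge> M + 1 \<and> V n \<zeta> \<in> cball z0 \<delta> \<and> (\<forall>k. V (n + k) \<zeta> = (\<phi> ^^ k) (V n \<zeta>)))"

text \<open>The larger ball suffices at time \<open>n\<close>, since one application of
  \<open>\<phi>\<close> leads into \<open>cball z0 \<delta>\<close>; this costs the step in
  \<open>Suc j\<close>.\<close>

lemma reachI:
  assumes V: "leaf V" and \<zeta>: "Re \<zeta> \<ge> M + 1" and y: "V n \<zeta> \<in> ball z0 ((1 + \<epsilon>) * \<delta>)"
    and k: "\<And>k. V (n + k) \<zeta> = (\<phi> ^^ k) (V n \<zeta>)"
  shows "reach V (n + Suc j)"
proof -
  have \<zeta>H: "\<zeta> \<in> rhp \<rho>" using \<zeta> M(1) by simp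
  have "(\<phi> ^^ Suc j) (V n \<zeta>) \<in> cball z0 \<delta>"
    by (rule escaping_phi_cball[OF leaf_escaping[OF V \<zeta>H y]]) simp
  then have "V (n + Suc j) \<zeta> \<in> cball z0 \<delta>" using k[of "Suc j"] by simp
  moreover have "V (n + Suc j + i) \<zeta> = (\<phi> ^^ i) (V (n + Suc j) \<zeta>)" for i
  proof -
    have "V (n + Suc j + i) \<zeta> = (\<phi> ^^ (i + Suc j)) (V n \<zeta>)" using k[of "i + Suc j"] by (simp only: ac_simps)
    then show ?thesis using k[of "Suc j"] by (simp only: funpow_add comp_apply)
  qed
  ultimately show ?thesis using \<zeta> by (auto simp: reach_def)
qed

lemma reach_mono:
  assumes V: "leaf V" and r: "reach V n" and nm: "n \<le> m"
  shows "reach V m"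
proof (cases "m = n")
  case False
  then obtain j where "m = n + Suc j" using nm less_iff_Suc_add by (metis add_Suc_right le_neq_implies_less)
  then show ?thesis using r reachI[OF V] cball_subset unfolding reach_def by blast
qed (use r in simp)

lemma not_reach_0:
  assumes "leaf V"
  shows "\<not> reach V 0"
proof
  assume "reach V 0"
  then obtain \<zeta> where \<zeta>: "Re \<zeta> \<ge> M + 1" "V 0 \<zeta> \<in> cball z0 \<delta>" by (auto simp: reach_def)
  then have "V 0 \<zeta> = exp \<zeta>" using assms M(1) by (simp add: leaf_def)
  then have "exp (Re \<zeta>) \<le> norm z0 + \<delta>" using \<zeta>(2) norm_triangle_sub[of "exp \<zeta>" z0] by (simp add: dist_norm norm_minus_commute)
  moreover have "exp (Re \<zeta>) > exp \<rho>" using \<zeta>(1) M(1) by simp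
  ultimately show False using small pos by simp
qed

text \<open>Uniform over all leaves: translations by multiples of \<open>2 * pi * \<i>\<close> bring
  a sequence of counterexamples into the fixed rectangle \<open>Q\<close>, where
  \<open>contraction_seq\<close> applies.\<close>

lemma contraction:
  assumes \<kappa>: "\<kappa> > 0"
  shows "\<exists>N. \<forall>n\<ge>N. \<forall>V x y. leaf V \<and> Re x \<in> {\<rho> + 1..M + 1} \<and> Re y \<in> {\<rho> + 1..M + 1} \<and> Im x = Im y \<and>
     V n x \<in> cball z0 \<delta> \<longrightarrow> norm (V n y - V n x) < \<kappa>"
proof (rule ccontr)
  assume "\<not> ?thesis"
  then have "\<forall>N. \<exists>n V x y. n \<ge> N \<and> leaf V \<and> Re x \<in> {\<rho> + 1..M + 1} \<and> Re y \<in> {\<rho> + 1..M + 1} \<and> Im x = Im y \<and>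
     V n x \<in> cball z0 \<delta> \<and> \<not> norm (V n y - V n x) < \<kappa>" by blast
  \<comment> \<open>Raised to \<open>Suc N\<close> to make every index positive, because
    \<open>V 0 = exp\<close> is not injective.\<close>
  then have "\<forall>N. \<exists>n V x y. n \<ge> Suc N \<and> leaf V \<and> Re x \<in> {\<rho> + 1..M + 1} \<and> Re y \<in> {\<rho> + 1..M + 1} \<and> Im x = Im y \<and>
     V n x \<in> cball z0 \<delta> \<and> \<not> norm (V n y - V n x) < \<kappa>" by blast
  then obtain n V x y where *: "\<And>N. n N \<ge> Suc N" "\<And>N. leaf (V N)" "\<And>N. Re (x N) \<in> {\<rho> + 1..M + 1}" "\<And>N. Re (y N) \<in> {\<rho> + 1..M + 1}"
    "\<And>N. Im (x N) = Im (y N)" "\<And>N. V N (n N) (x N) \<in> cball z0 \<delta>" "\<And>N. \<not> norm (V N (n N) (y N) - V N (n N) (x N)) < \<kappa>"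
    by metis
  define q where "q N = \<lfloor>Im (x N) / (2 * pi)\<rfloor>" for N
  define sh where "sh N = complex_of_real (of_int (2 * q N) * pi) * \<i>" for N
  define W where "W N m z = V N m (z + sh N)" for N m z
  have W: "leaf (W N)" for N using leaf_shift[OF *(2)[of N], of "q N"] by (simp add: W_def[abs_def] sh_def)
  define Q where "Q = cbox (Complex (\<rho> + 1) 0) (Complex (M + 1) (2 * pi))"
  have im: "Im (x N) - of_int (2 * q N) * pi \<in> {0..2 * pi}" for N
  proof -
    have "of_int (q N) \<le> Im (x N) / (2 * pi)" "Im (x N) / (2 * pi) < of_int (q N) + 1" by (auto simp: q_def)
    then show ?thesis by (simp add: field_simps)
  qed
  have xQ: "x N - sh N \<in> Q" "y N - sh N \<in> Q" for N
    using im[of N] *(3,4)[of N] *(5)[of N] by (auto simp: Q_def in_cbox_complex_iff sh_def)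
  have "\<exists>k. norm (W k (n k) (y k - sh k) - W k (n k) (x k - sh k)) < \<kappa>"
  proof (rule contraction_seq[where X = "\<lambda>k. W k (n k)" and s = "\<rho> + 1" and Q = Q and \<delta> = \<delta> and ?z0.0 = z0 and n = n])
    show "inj_on (W k (n k)) (rhp \<rho>)" for k
      using leaf_inj[OF W, of k "n k - 1"] *(1)[of k] by simp
    show "norm (W k (n k) (x k - sh k) - z0) \<le> \<delta>" for k
      using *(6)[of k] by (simp add: W_def dist_norm norm_minus_commute)
    show "n k \<ge> k" for k using *(1)[of k] by simp
    show "Q \<subseteq> {x. \<rho> + 1 \<le> Re x}" by (auto simp: Q_def in_cbox_complex_iff)
  qed (use leaf_hol[OF W] leaf_omits[OF W] leaf_exp[OF W] xQ \<kappa> in \<open>auto simp: Q_def\<close>)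
  then show False using *(7) by (simp add: W_def)
qed

end

section \<open>Periodic leaves\<close>

context exit_point
begin

text \<open>Dropping the first lift saves a step: for \<open>n = Suc m\<close>, \<open>V' m\<close>
  at \<open>a = L \<zeta>\<close> equals \<open>V n \<zeta>\<close>. But \<open>a\<close> may lie
  left of the line \<open>Re = M + 1\<close>. Moving it horizontally to that line changes
  \<open>V' m\<close> by less than \<open>\<epsilon> * \<delta>\<close>, and the saved step is spent
  on one \<open>\<phi>\<close> that returns to \<open>cball z0 \<delta>\<close>. So the count stays
  at \<open>n\<close>.\<close>

lemma reach_invariant:
  "\<exists>C. \<forall>V L V' n. leaf V \<and> leaf V' \<and> linked V L V' \<and> reach V n \<and> n \<ge> C \<longrightarrow> reach V' n"
proof -
  have "\<epsilon> * \<delta> > 0" using pos by simp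
  from contraction[OF this] obtain N where N: "\<And>n V x y. n \<ge> N \<Longrightarrow> leaf V \<Longrightarrow> Re x \<in> {\<rho> + 1..M + 1} \<Longrightarrow>
     Re y \<in> {\<rho> + 1..M + 1} \<Longrightarrow> Im x = Im y \<Longrightarrow> V n x \<in> cball z0 \<delta> \<Longrightarrow> norm (V n y - V n x) < \<epsilon> * \<delta>"
    by blast
  have "reach V' n" if V: "leaf V" and V': "leaf V'" and l: "linked V L V'" and r: "reach V n" and n: "n \<ge> N + 1" for V L V' n
  proof -
    obtain \<zeta> where \<zeta>: "Re \<zeta> \<ge> M + 1" and cb: "V n \<zeta> \<in> cball z0 \<delta>" and chain: "\<And>k. V (n + k) \<zeta> = (\<phi> ^^ k) (V n \<zeta>)"
      using r by (auto simp: reach_def)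
    have \<zeta>M: "\<zeta> \<in> rhp M" using \<zeta> by simp
    define a where "a = L \<zeta>"
    have aR: "Re a > \<rho> + 1" using l \<zeta>M by (simp add: linked_def a_def)
    have Va: "V' i a = V (Suc i) \<zeta>" for i using l \<zeta>M by (simp add: linked_def a_def)
    obtain m where m: "n = Suc m" using n by (cases n) auto
    have Vm: "V' m a = V n \<zeta>" "\<And>i. V' (m + i) a = V (n + i) \<zeta>" by (simp_all add: Va m)
    have chain': "V' (m + i) a = (\<phi> ^^ i) (V' m a)" for i using chain by (simp add: Vm)
    define b where "b = Complex (max (M + 1) (Re a)) (Im a)"
    have near: "V' m \<xi> \<in> ball z0 ((1 + \<epsilon>) * \<delta>) \<and> \<xi> \<in> rhp \<rho>" if "\<xi> \<in> closed_segment a b" for \<xi>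
    proof (cases "Re a \<ge> M + 1")
      case True
      then have "a = b" by (simp add: b_def max_absorb2)
      then have "\<xi> = a" using that by simp
      then show ?thesis using cb cball_subset aR by (auto simp: Vm)
    next
      case False
      obtain u where u: "0 \<le> u" "u \<le> 1" "\<xi> = (1 - u) *\<^sub>R a + u *\<^sub>R b" using \<open>\<xi> \<in> closed_segment a b\<close> by (auto simp: in_segment)
      have im: "Im \<xi> = Im a" by (simp add: u(3) b_def algebra_simps)
      have re: "Re \<xi> = Re a + u * (M + 1 - Re a)" using False by (simp add: u(3) b_def max_absorb1 algebra_simps)
      have "u * (M + 1 - Re a) \<le> 1 * (M + 1 - Re a)" "0 \<le> u * (M + 1 - Re a)" using u False by (intro mult_right_mono mult_nonneg_nonneg; simp)+
      then have "Re \<xi> \<in> {\<rho> + 1..M + 1}" using re aR by auto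
      moreover have "Re a \<in> {\<rho> + 1..M + 1}" using aR False by auto
      ultimately have "norm (V' m \<xi> - V' m a) < \<epsilon> * \<delta>"
        using n cb by (intro N[OF _ V']) (auto simp: m Vm im)
      moreover have "norm (V' m \<xi> - z0) \<le> norm (V' m \<xi> - V' m a) + norm (V' m a - z0)" by norm
      ultimately have "norm (V' m \<xi> - z0) < \<epsilon> * \<delta> + \<delta>" using cb by (simp add: Vm dist_norm norm_minus_commute)
      then show ?thesis using \<open>Re \<xi> \<in> _\<close> by (auto simp: dist_norm norm_minus_commute algebra_simps)
    qed
    have "V' (m + i) b = (\<phi> ^^ i) (V' m b)" for i
      by (rule leaf_segment[OF V' _ _ chain']) (use near in auto)
    then have "reach V' (m + Suc 0)"
      using near[of b] by (intro reachI[OF V', of b]) (auto simp: b_def)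
    then show ?thesis by (simp add: m)
  qed
  then show ?thesis by blast
qed

text \<open>The leaf is given by the orbit from \<open>x\<close> to \<open>(F ^^ N) x\<close> read
  backwards, continued by the \<open>\<phi>\<close>-iterates of \<open>x\<close>; these are
  preimages since \<open>x\<close> is in \<open>escaping\<close>.\<close>

lemma leaf_through:
  assumes x: "x \<in> cball z0 \<delta>" and N: "norm ((F ^^ N) x) \<ge> exp (M + 1)"
  shows "\<exists>V \<zeta>. leaf V \<and> Re \<zeta> \<ge> M + 1 \<and> V N \<zeta> = x \<and> (\<forall>k. V (N + k) \<zeta> = (\<phi> ^^ k) x)"
proof -
  have nz: "(F ^^ N) x \<noteq> 0" using N by (metis exp_gt_zero norm_zero not_less)
  define \<zeta> where "\<zeta> = Ln ((F ^^ N) x)"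
  have e: "exp \<zeta> = (F ^^ N) x" using nz by (simp add: \<zeta>_def)
  then have "exp (Re \<zeta>) \<ge> exp (M + 1)" using N by (metis norm_exp_eq_Re)
  then have \<zeta>: "Re \<zeta> \<ge> M + 1" by simp
  then have \<zeta>H: "\<zeta> \<in> rhp \<rho>" using M(1) by simp
  have "norm ((F ^^ N) x) = exp (Re \<zeta>)" using e by (metis norm_exp_eq_Re)
  then have "norm ((F ^^ N) x) > exp \<rho>" using \<zeta>H by simp
  then have xe: "x \<in> escaping" using x cball_subset by (auto simp: escaping_def)
  define b where "b n = (if n \<le> N then (F ^^ (N - n)) x else (\<phi> ^^ (n - N)) x)" for n
  have "F (b (Suc n)) = b n" for n
  proof (cases "n < N")
    case True
    then have "N - n = Suc (N - Suc n)" by simp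
    then show ?thesis using True by (simp add: b_def)
  next
    case False
    then have "Suc n - N = Suc (n - N)" by simp
    then have "F (b (Suc n)) = (\<phi> ^^ (n - N)) x" using False phi_inv[OF escaping_phi_ball[OF xe]] by (simp add: b_def)
    then show ?thesis using False by (auto simp: b_def)
  qed
  then obtain V where V: "leaf V" "\<And>n. V n \<zeta> = b n" using leaf_ex[OF \<zeta>H, of b] e by (auto simp: b_def)
  have "V N \<zeta> = x" by (simp add: V(2) b_def)
  moreover have "V (N + k) \<zeta> = (\<phi> ^^ k) x" for k by (cases k) (simp_all add: V(2) b_def)
  ultimately show ?thesis using V(1) \<zeta> by blast
qed

text \<open>The values \<open>Vs i N (Z i)\<close> accumulate at some \<open>x\<close>. For the leaf
  \<open>V\<close> through \<open>x\<close>, \<open>V N\<close> is open near \<open>\<zeta>\<close>,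
  so late leaves share a value and all later lifts with \<open>V\<close> nearby and are translates
  of \<open>V\<close>. Two translates of \<open>V\<close> are translates of each other.\<close>

lemma leaf_compactness:
  assumes Vs: "\<And>i::nat. leaf (Vs i)" "\<And>i. reach (Vs i) N"
  shows "\<exists>i j k. i < j \<and> (\<forall>n. \<forall>x\<in>rhp \<rho>. Vs j n x = Vs i n (x + of_real (of_int (2 * k) * pi) * \<i>))"
proof -
  have "\<forall>i. \<exists>\<zeta>. Re \<zeta> \<ge> M + 1 \<and> Vs i N \<zeta> \<in> cball z0 \<delta> \<and> (\<forall>k. Vs i (N + k) \<zeta> = (\<phi> ^^ k) (Vs i N \<zeta>))"
    using Vs(2) by (simp add: reach_def)
  then obtain Z where Z: "\<And>i. Re (Z i) \<ge> M + 1" "\<And>i. Vs i N (Z i) \<in> cball z0 \<delta>"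
    "\<And>i k. Vs i (N + k) (Z i) = (\<phi> ^^ k) (Vs i N (Z i))" by metis
  have ZH: "Z i \<in> rhp \<rho>" for i using Z(1)[of i] M(1) by simp
  define X where "X i = Vs i N (Z i)" for i
  have "\<forall>i. X i \<in> cball z0 \<delta>" using Z(2) by (simp add: X_def)
  then obtain x r where x: "x \<in> cball z0 \<delta>" and r: "strict_mono r" and lim: "(\<lambda>i. X (r i)) \<longlonglongrightarrow> x"
    using compact_cball[of z0 \<delta>] unfolding compact_def by (auto simp: o_def dest!: spec[of _ X])
  have FX: "(F ^^ N) (X i) = exp (Z i)" for i using leaf_exp[OF Vs(1) ZH] by (simp add: X_def)
  have "(\<lambda>i. (F ^^ N) (X (r i))) \<longlonglongrightarrow> (F ^^ N) x"
    by (rule isCont_tendsto_compose[OF continuous_funpow(2)[OF hol] lim])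
  then have "(\<lambda>i. norm ((F ^^ N) (X (r i)))) \<longlonglongrightarrow> norm ((F ^^ N) x)" by (rule tendsto_norm)
  then have "norm ((F ^^ N) x) \<ge> exp (M + 1)"
    by (rule LIMSEQ_le_const) (use FX Z(1) in auto)
  then obtain V \<zeta> where V: "leaf V" "Re \<zeta> \<ge> M + 1" "V N \<zeta> = x" "\<And>k. V (N + k) \<zeta> = (\<phi> ^^ k) x"
    using leaf_through[OF x] by blast
  have \<zeta>H: "\<zeta> \<in> rhp \<rho>" using V(2) M(1) by simp
  have N0: "N \<noteq> 0" using not_reach_0 Vs by metis
  have contV: "continuous_on (rhp \<rho>) (V N)" using leaf_hol[OF V(1)] by (rule holomorphic_on_imp_continuous_on)
  then have "open (V N -` ball z0 ((1 + \<epsilon>) * \<delta>) \<inter> rhp \<rho>)"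
    using continuous_on_open_vimage[OF open_rhp] by blast
  moreover have "\<zeta> \<in> V N -` ball z0 ((1 + \<epsilon>) * \<delta>) \<inter> rhp \<rho>" using \<zeta>H V(3) x cball_subset by auto
  ultimately obtain s where s: "s > 0" "ball \<zeta> s \<subseteq> V N -` ball z0 ((1 + \<epsilon>) * \<delta>) \<inter> rhp \<rho>"
    using open_contains_ball by blast
  have "inj_on (V N) (rhp \<rho>)" using leaf_inj[OF V(1), of "N - 1"] N0 by simp
  then have "inj_on (V N) (ball \<zeta> s)" using s(2) inj_on_subset by blast
  moreover have "V N holomorphic_on ball \<zeta> s" using leaf_hol[OF V(1), of N] s(2) holomorphic_on_subset by blast
  ultimately have "open (V N ` ball \<zeta> s)" by (intro open_mapping_thm3) auto
  moreover have "x \<in> V N ` ball \<zeta> s" using V(3) s(1) by auto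
  ultimately have "\<forall>\<^sub>F i in sequentially. X (r i) \<in> V N ` ball \<zeta> s"
    using lim by (simp add: tendsto_def)
  then obtain i0 where i0: "\<And>i. i \<ge> i0 \<Longrightarrow> X (r i) \<in> V N ` ball \<zeta> s" by (auto simp: eventually_sequentially)
  have main: "\<exists>k::int. \<forall>n. \<forall>x\<in>rhp \<rho>. Vs (r i) n (x + of_real (of_int (2 * k) * pi) * \<i>) = V n x" if i: "i \<ge> i0" for i
  proof -
    obtain w where w: "w \<in> ball \<zeta> s" "X (r i) = V N w" using i0[OF i] by blast
    have seg: "closed_segment \<zeta> w \<subseteq> ball \<zeta> s" using w(1) s(1) by (intro closed_segment_subset) auto
    have wH: "w \<in> rhp \<rho>" using w(1) s(2) by blast
    have chain: "V (N + k) w = (\<phi> ^^ k) (V N w)" for k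
      by (rule leaf_segment[OF V(1)]) (use seg s(2) V(3,4) in auto)
    \<comment> \<open>Both are the image of the shared value under \<open>f\<close>'s iterate
      \<open>F ^^ N\<close>; the ambiguity of the logarithm is the translation sought.\<close>
    have "exp (Z (r i)) = exp w" using FX[of "r i"] w(2) leaf_exp[OF V(1) wH, of N] by simp
    then obtain k :: int where k: "Z (r i) = w + of_real (of_int (2 * k) * pi) * \<i>" unfolding exp_eq by blast
    define W where "W n x = Vs (r i) n (x + of_real (of_int (2 * k) * pi) * \<i>)" for n x
    have W: "leaf W" unfolding W_def[abs_def] by (rule leaf_shift[OF Vs(1)])
    have at: "W (N + j) w = V (N + j) w" for j
      using chain[of j] Z(3)[of "r i" j] w(2) unfolding W_def k[symmetric] by (simp add: X_def)
    have "W n w = V n w" for n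
    proof (cases "n \<ge> N")
      case True
      then show ?thesis using at[of "n - N"] by simp
    next
      case False
      then have "N = (N - n) + n" by simp
      then show ?thesis using at[of 0] leaf_funpow[OF W wH, of "N - n" n] leaf_funpow[OF V(1) wH, of "N - n" n] by simp
    qed
    then have "W n x = V n x" if "x \<in> rhp \<rho>" for n x using leaf_unique[OF W V(1) wH _ that] by blast
    then show ?thesis unfolding W_def by blast
  qed
  obtain k1 :: int where k1: "\<And>n x. x \<in> rhp \<rho> \<Longrightarrow> Vs (r i0) n (x + of_real (of_int (2 * k1) * pi) * \<i>) = V n x"
    using main[OF order_refl] by blast
  obtain k2 :: int where k2: "\<And>n x. x \<in> rhp \<rho> \<Longrightarrow> Vs (r (Suc i0)) n (x + of_real (of_int (2 * k2) * pi) * \<i>) = V n x"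
    using main[OF le_SucI[OF order_refl]] by blast
  have "Vs (r (Suc i0)) n x = Vs (r i0) n (x + of_real (of_int (2 * (k1 - k2)) * pi) * \<i>)" if "x \<in> rhp \<rho>" for n x
  proof -
    define y where "y = x - of_real (of_int (2 * k2) * pi) * \<i>"
    have y: "y \<in> rhp \<rho>" using that by (simp add: y_def)
    have "x = y + of_real (of_int (2 * k2) * pi) * \<i>" by (simp add: y_def)
    then have "Vs (r (Suc i0)) n x = V n y" using k2[OF y, of n] by (simp only:)
    moreover have "x + of_real (of_int (2 * (k1 - k2)) * pi) * \<i> = y + of_real (of_int (2 * k1) * pi) * \<i>"
      by (simp add: y_def algebra_simps)
    then have "Vs (r i0) n (x + of_real (of_int (2 * (k1 - k2)) * pi) * \<i>) = V n y" using k1[OF y, of n] by (simp only:)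
    ultimately show ?thesis by simp
  qed
  moreover have "r i0 < r (Suc i0)" using r by (simp add: strict_mono_def)
  ultimately show ?thesis by blast
qed

text \<open>An escaping point near \<open>z0\<close> provides the first leaf; the bound
  \<open>N = max n C\<close> then persists, so \<open>leaf_compactness\<close> applies to the
  sequence of successors. Putting the translation into the last logarithm of the cycle closes it
  exactly.\<close>

lemma periodic_leaf:
  "\<exists>m W L N. m \<ge> 1 \<and> (\<forall>a. leaf (W a)) \<and> (\<forall>a<m. linked (W a) (L a) (W (Suc a))) \<and> W m = W 0 \<and> reach (W 0) N"
proof -
  obtain C where C: "\<And>V L V' n. leaf V \<Longrightarrow> leaf V' \<Longrightarrow> linked V L V' \<Longrightarrow> reach V n \<Longrightarrow> n \<ge> C \<Longrightarrow> reach V' n"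
    using reach_invariant by blast
  obtain x n where x: "x \<in> ball z0 \<delta>" "norm ((F ^^ n) x) > exp (M + 1)" using escape by blast
  then obtain V0 \<zeta> where V0: "leaf V0" "Re \<zeta> \<ge> M + 1" "V0 n \<zeta> = x" "\<And>k. V0 (n + k) \<zeta> = (\<phi> ^^ k) x"
    using leaf_through[of x n] by auto
  then have r0: "reach V0 n" using x(1) by (auto simp: reach_def intro!: exI[of _ \<zeta>])
  define N where "N = max n C"
  have "reach V0 N" using reach_mono[OF V0(1) r0] by (simp add: N_def)
  define P where "P i V \<longleftrightarrow> leaf V \<and> reach V N" for i :: nat and V
  define Q where "Q i V V' \<longleftrightarrow> (\<exists>L. linked V L V')" for i :: nat and V V'
  have "\<exists>Vs. \<forall>i. P i (Vs i) \<and> Q i (Vs i) (Vs (Suc i))"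
  proof (rule dependent_nat_choice)
    show "\<exists>V. P 0 V" using V0(1) \<open>reach V0 N\<close> by (auto simp: P_def)
    fix V i assume V: "P i V"
    then have "leaf V" by (simp add: P_def)
    from leaf_step[OF this] obtain V' L where V': "leaf V'" "linked V L V'" by blast
    then have "reach V' N" using C[of V V' L N] V by (auto simp: P_def N_def)
    then show "\<exists>V'. P (Suc i) V' \<and> Q i V V'" using V' by (auto simp: P_def Q_def)
  qed
  then obtain Vs where Vs: "\<And>i. leaf (Vs i)" "\<And>i. reach (Vs i) N" "\<And>i. \<exists>L. linked (Vs i) L (Vs (Suc i))"
    by (auto simp: P_def Q_def)
  from Vs(3) obtain Ls where Ls: "\<And>i. linked (Vs i) (Ls i) (Vs (Suc i))" by metis
  obtain i j and k :: int where ijk: "i < j \<and> (\<forall>n. \<forall>x\<in>rhp \<rho>. Vs j n x = Vs i n (x + of_real (of_int (2 * k) * pi) * \<i>))"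
    using leaf_compactness[of Vs N, OF Vs(1,2)] by (elim exE)
  then have ij: "i < j" by (rule conjunct1)
  have k: "Vs j n x = Vs i n (x + of_real (of_int (2 * k) * pi) * \<i>)" if "x \<in> rhp \<rho>" for n x
    using ijk[THEN conjunct2, rule_format, OF that] .
  define m where "m = j - i"
  have m: "m \<ge> 1" "i + m = j" using ij by (auto simp: m_def)
  define c where "c = of_real (of_int (2 * k) * pi) * \<i>"
  have ec: "exp (x + c) = exp x" for x unfolding c_def by (subst exp_eq) blast
  have cr: "Re c = 0" by (simp add: c_def)
  define W where "W a = (if a = m then Vs i else Vs (i + a))" for a
  \<comment> \<open>Adding a multiple of \<open>2 * pi * \<i>\<close> changes neither the
    exponential, the real part nor the derivative, so \<open>linked\<close> is preserved.\<close>
  define L where "L a = (if a = m - 1 then (\<lambda>x. Ls (i + a) x + c) else Ls (i + a))" for a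
  have "linked (W a) (L a) (W (Suc a))" if a: "a < m" for a
  proof (cases "Suc a = m")
    case False
    then show ?thesis using a Ls[of "i + a"] by (auto simp: W_def L_def)
  next
    case True
    have am: "a = m - 1" "Suc (i + a) = j" using True m by auto
    have l: "linked (Vs (i + a)) (Ls (i + a)) (Vs j)" using Ls[of "i + a"] am(2) by metis
    have eq: "L a = (\<lambda>x. Ls (i + a) x + c)" "W a = Vs (i + a)" "W (Suc a) = Vs i" using am a True by (auto simp: L_def W_def)
    have lh: "Ls (i + a) holomorphic_on rhp M" using l by (simp add: linked_def)
    have dl: "deriv (\<lambda>x. Ls (i + a) x + c) x = deriv (Ls (i + a)) x" if "x \<in> rhp M" for x
    proof (rule DERIV_imp_deriv)
      have "(Ls (i + a) has_field_derivative deriv (Ls (i + a)) x) (at x)" by (rule holomorphic_derivI[OF lh open_rhp that])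
      then show "((\<lambda>x. Ls (i + a) x + c) has_field_derivative deriv (Ls (i + a)) x) (at x)"
        by (auto intro!: derivative_eq_intros)
    qed
    have "Vs i n (Ls (i + a) x + c) = Vs (i + a) (Suc n) x" if "x \<in> rhp M" for n x
    proof -
      have "Ls (i + a) x \<in> rhp \<rho>" using l that by (force simp: linked_def)
      then have "Vs i n (Ls (i + a) x + c) = Vs j n (Ls (i + a) x)" using k[of "Ls (i + a) x" n] by (simp only: c_def)
      then show ?thesis using l that by (simp add: linked_def)
    qed
    then show ?thesis unfolding eq linked_def using l dl by (auto simp: linked_def ec cr intro!: holomorphic_intros)
  qed
  moreover have "leaf (W a)" for a using Vs(1) by (simp add: W_def)
  moreover have "W m = W 0" by (simp add: W_def)
  moreover have "reach (W 0) N" using Vs(2) by (simp add: W_def)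
  ultimately show ?thesis using m(1) by blast
qed

end

section \<open>Rays from periodic leaves\<close>

lemma continuous_on_dyadic_glue:
  fixes \<theta> :: "real \<Rightarrow> 'a::topological_space"
  assumes c: "\<And>j::nat. continuous_on {2 ^ j..2 ^ Suc j} \<theta>"
  shows "continuous_on {1..} \<theta>"
proof -
  have n: "continuous_on {1..2 ^ n} \<theta>" for n :: nat
  proof (induction n)
    case (Suc n)
    have "{1..2 ^ Suc n} = {1..2 ^ n} \<union> {2 ^ n..2 ^ Suc n :: real}"
      by (rule ivl_disj_un_two_touch(4)[symmetric]) auto
    then show ?case using continuous_on_closed_Un[OF _ _ Suc c] by simp
  qed simp
  show ?thesis unfolding continuous_on_eq_continuous_within
  proof
    fix s :: real assume s: "s \<in> {1..}"
    obtain k where k: "s < 2 ^ k" using real_arch_pow[of 2 s] by auto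
    have "continuous (at s within {1..2 ^ k}) \<theta>"
      using n[of k] s k by (simp add: continuous_on_eq_continuous_within)
    moreover have "at s within {1..2 ^ k} = at s within {1..}"
      by (rule at_within_nhd[of s "{..<2 ^ k}"]) (use s k in auto)
    ultimately show "continuous (at s within {1..}) \<theta>" by simp
  qed
qed

lemma strict_mono_dyadic_glue:
  fixes \<theta> :: "real \<Rightarrow> real"
  assumes m: "\<And>j::nat. strict_mono_on {2 ^ j..2 ^ Suc j} \<theta>"
  shows "strict_mono_on {1..} \<theta>"
proof -
  have n: "strict_mono_on {1..2 ^ n} \<theta>" for n :: nat
  proof (induction n)
    case 0 then show ?case by (auto simp: strict_mono_on_def)
  next
    case (Suc n)
    show ?case
    proof (rule strict_mono_onI)
      fix s t :: real assume st: "s \<in> {1..2 ^ Suc n}" "t \<in> {1..2 ^ Suc n}" "s < t"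
      have p1: "(1::real) \<le> 2 ^ n" by simp
      consider "t \<le> 2 ^ n" | "2 ^ n \<le> s" | "s < 2 ^ n" "2 ^ n < t" by linarith
      then show "\<theta> s < \<theta> t"
      proof cases
        case 1 then show ?thesis using Suc st by (auto simp: strict_mono_on_def)
      next
        case 2 then show ?thesis using m[of n] st by (auto simp: strict_mono_on_def)
      next
        case 3
        then have "\<theta> s < \<theta> (2 ^ n)" "\<theta> (2 ^ n) < \<theta> t"
          using Suc m[of n] st p1 by (auto simp: strict_mono_on_def)
        then show ?thesis by simp
      qed
    qed
  qed
  show ?thesis
  proof (rule strict_mono_onI)
    fix s t :: real assume st: "s \<in> {1..}" "t \<in> {1..}" "s < t"
    obtain k where "t < 2 ^ k" using real_arch_pow[of 2 t] by auto
    then show "\<theta> s < \<theta> t" using n[of k] st by (auto simp: strict_mono_on_def)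
  qed
qed

lemma dyadic_between:
  fixes s :: real
  assumes "s \<ge> 1"
  shows "\<exists>j::nat. 2 ^ j \<le> s \<and> s < 2 ^ Suc j"
proof -
  define k where "k = (LEAST k. s < 2 ^ k)"
  have ex: "\<exists>k. s < 2 ^ k" using real_arch_pow[of 2 s] by auto
  have k: "s < 2 ^ k" unfolding k_def using LeastI_ex[OF ex] .
  have "k \<noteq> 0"
  proof
    assume "k = 0"
    then show False using k assms by (simp add: \<open>k = 0\<close>)
  qed
  then obtain j where j: "k = Suc j" by (cases k) auto
  have "\<not> s < 2 ^ j" using not_less_Least[of j "\<lambda>k. s < 2 ^ k"] j by (simp add: k_def)
  then show ?thesis using k j by (intro exI[of _ j]) (simp add: not_less)
qed

text \<open>Conjugates \<open>Q\<close> to doubling: on a fundamental interval \<open>\<theta>\<close> is affine.\<close>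

lemma doubling_parametrization:
  fixes Q :: "real \<Rightarrow> real"
  assumes cont: "continuous_on UNIV Q" and mono: "\<And>s t. s < t \<Longrightarrow> Q s < Q t" and Q: "\<And>t. Q t \<ge> t + 1"
  shows "\<exists>\<theta> :: real \<Rightarrow> real. continuous_on {1..} \<theta> \<and> strict_mono_on {1..} \<theta> \<and> \<theta> 1 = t1 \<and> (\<forall>s\<ge>1. \<theta> (2 * s) = Q (\<theta> s)) \<and>
    filterlim \<theta> at_top at_top"
proof -
  define b where "b u = t1 + (u - 1) * (Q t1 - t1)" for u
  have b: "b 1 = t1" "b 2 = Q t1" "continuous_on A b" for A by (auto simp: b_def intro!: continuous_intros)
  have bm: "b u < b v" if "u < v" for u v
    using that Q[of t1] unfolding b_def by (intro add_strict_left_mono mult_strict_right_mono) auto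
  have Qc: "continuous_on UNIV (Q ^^ j)" for j
  proof (induction j)
    case (Suc j)
    have "continuous_on UNIV (\<lambda>x. Q ((Q ^^ j) x))" by (rule continuous_on_compose2[OF cont Suc]) auto
    then show ?case by (simp add: o_def)
  qed (simp add: id_def)
  have Qm: "(Q ^^ j) s < (Q ^^ j) t" if "s < t" for j s t
    by (induction j) (use that mono in auto)
  \<comment> \<open>On \<open>{2 ^ j..2 ^ Suc j}\<close> this is \<open>Q ^^ j\<close> after a
    rescaled \<open>b\<close>; the pieces fit because \<open>b 2 = Q (b 1)\<close>.\<close>
  define \<theta> where "\<theta> s = (let j = (LEAST j. s < 2 ^ Suc j) in (Q ^^ j) (b (s / 2 ^ j)))" for s :: real
  have \<theta>j: "\<theta> s = (Q ^^ j) (b (s / 2 ^ j))" if "s \<in> {2 ^ j..2 ^ Suc j}" for s j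
  proof -
    have half: "\<theta> s = (Q ^^ j) (b (s / 2 ^ j))" if "2 ^ j \<le> s" "s < 2 ^ Suc j" for s j
    proof -
      have "(LEAST j. s < 2 ^ Suc j) = j"
      proof (rule Least_equality)
        fix i assume i: "s < 2 ^ Suc i"
        show "j \<le> i"
        proof (rule ccontr)
          assume "\<not> j \<le> i"
          then have "(2::real) ^ Suc i \<le> 2 ^ j" by (intro power_increasing) auto
          then show False using i that by linarith
        qed
      qed (use that in auto)
      then show ?thesis by (simp add: \<theta>_def)
    qed
    show ?thesis
    proof (cases "s = 2 ^ Suc j")
      case True
      have "\<theta> s = (Q ^^ Suc j) (b (s / 2 ^ Suc j))" by (rule half) (use True in auto)
      also have "\<dots> = (Q ^^ j) (b (s / 2 ^ j))" using True b by (simp add: funpow_swap1)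
      finally show ?thesis .
    qed (use half that in auto)
  qed
  have c: "continuous_on {2 ^ j..2 ^ Suc j} \<theta>" for j
  proof -
    have "continuous_on {2 ^ j..2 ^ Suc j} (\<lambda>s. b (s / 2 ^ j))"
      by (rule continuous_on_compose2[OF b(3)[of UNIV]]) (auto intro!: continuous_intros)
    then have "continuous_on {2 ^ j..2 ^ Suc j} (\<lambda>s. (Q ^^ j) (b (s / 2 ^ j)))"
      by (rule continuous_on_compose2[OF Qc]) auto
    then show ?thesis by (rule continuous_on_eq) (use \<theta>j in simp)
  qed
  have m: "strict_mono_on {2 ^ j..2 ^ Suc j} \<theta>" for j
  proof (rule strict_mono_onI)
    fix s t :: real assume st: "s \<in> {2 ^ j..2 ^ Suc j}" "t \<in> {2 ^ j..2 ^ Suc j}" "s < t"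
    have "b (s / 2 ^ j) < b (t / 2 ^ j)" by (rule bm) (use st in \<open>simp add: divide_strict_right_mono\<close>)
    then show "\<theta> s < \<theta> t" using \<theta>j[OF st(1)] \<theta>j[OF st(2)] Qm by simp
  qed
  have sm: "strict_mono_on {1..} \<theta>" by (rule strict_mono_dyadic_glue[OF m])
  have 1: "\<theta> 1 = t1" using \<theta>j[of 1 0] b by simp
  have dbl: "\<theta> (2 * s) = Q (\<theta> s)" if "s \<ge> 1" for s
  proof -
    obtain j where j: "2 ^ j \<le> s" "s < 2 ^ Suc j" using dyadic_between[OF \<open>s \<ge> 1\<close>] by blast
    have "\<theta> (2 * s) = (Q ^^ Suc j) (b (2 * s / 2 ^ Suc j))" by (rule \<theta>j) (use j in auto)
    then show ?thesis using \<theta>j[of s j] j by simp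
  qed
  have pw: "\<theta> (2 ^ n) \<ge> t1 + real n" for n
  proof (induction n)
    case (Suc n)
    have "\<theta> (2 ^ Suc n) = Q (\<theta> (2 ^ n))" using dbl[of "2 ^ n"] by simp
    then show ?case using Suc Q[of "\<theta> (2 ^ n)"] by simp
  qed (simp add: 1)
  have "filterlim \<theta> at_top at_top"
    unfolding filterlim_at_top
  proof
    fix Z :: real
    define n where "n = nat \<lceil>Z - t1\<rceil>"
    have "\<theta> s \<ge> Z" if s: "s \<ge> 2 ^ n" for s
    proof -
      have "\<theta> (2 ^ n) \<le> \<theta> s" using sm s by (cases "s = 2 ^ n") (auto simp: strict_mono_on_def order_trans[of 1 "2 ^ n" s] intro!: less_imp_le)
      moreover have "t1 + real n \<ge> Z" unfolding n_def by linarith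
      ultimately show ?thesis using pw[of n] by linarith
    qed
    then show "\<forall>\<^sub>F s in at_top. Z \<le> \<theta> s" by (auto simp: eventually_at_top_linorder)
  qed
  moreover have "continuous_on {1..} \<theta>" by (rule continuous_on_dyadic_glue[OF c])
  ultimately show ?thesis using sm 1 dbl by (intro exI[of _ \<theta>] conjI) simp_all
qed

context exit_point
begin

text \<open>Logarithms lead from leaf \<open>a\<close> to leaf \<open>Suc a\<close>, while curves
  are pulled back along the cycle in the opposite order; hence the reversed index in
  \<open>K\<close>. One full turn trades \<open>m\<close> further lifts for
  \<open>iter_exp (p * m)\<close> in the parameter.\<close>

lemma leaf_cycle_curve:
  "\<exists>m G \<eta> t1 D. m \<ge> 1 \<and> t1 \<ge> 1 \<and> D \<ge> 1 \<and> leaf G \<and> (\<exists>N. reach G N) \<and> continuous_on {t1..} \<eta> \<and>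
     (\<forall>t\<ge>t1. Re (\<eta> t) > M \<and> Re (\<eta> t) \<ge> t / (2 * D) \<and> norm (\<eta> t) \<le> 2 * D * t) \<and>
     (\<forall>t\<ge>t1. \<forall>n. G n (\<eta> t) = G (n + m) (\<eta> (iter_exp (p * m) t)))"
proof -
  obtain m W L N where m: "m \<ge> 1" and W: "\<And>a. leaf (W a)" "\<And>a. a < m \<Longrightarrow> linked (W a) (L a) (W (Suc a))"
    "W m = W 0" "reach (W 0) N" using periodic_leaf by blast
  define K where "K j = L (m - 1 - j)" for j
  have K: "linked (W (m - 1 - j)) (K j) (W (m - j))" if "j < m" for j
    using W(2)[of "m - 1 - j"] that by (simp add: K_def Suc_diff_Suc)
  have FK: "F (exp (K j x)) = exp x" if "j < m" "x \<in> rhp M" for j x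
  proof -
    have "exp (K j x) = W (m - 1 - j) 1 x" using K[OF that(1)] that(2) by (simp add: linked_def)
    then show ?thesis using leaf_exp[OF W(1) rhp_M_subset[OF that(2)], of 1 "m - 1 - j"] by simp
  qed
  have KH: "K j holomorphic_on rhp M" if "j < m" for j using K[OF that] by (simp add: linked_def)
  have Kd: "norm (deriv (K j) x) \<le> 12 * pi / (Re x - M)" if "j < m" "x \<in> rhp M" for j x
    using K[OF that(1)] that(2) by (simp add: linked_def)
  have "\<exists>\<eta> t1 D. D \<ge> 1 \<and> t1 \<ge> 1 \<and> (\<forall>j. continuous_on {t1..} (\<eta> j)) \<and>
    (\<forall>j. \<forall>t\<ge>t1. Re (\<eta> j t) > M \<and> Re (\<eta> j t) \<ge> t / (2 * D) \<and> norm (\<eta> j t) \<le> 2 * D * t) \<and>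
    (\<forall>j<m. \<forall>t\<ge>t1. \<eta> j t = K j (\<eta> (Suc j) (iter_exp p t))) \<and> \<eta> m = \<eta> 0"
    by (rule tail_curves_cyclic[OF m KH FK Kd])
  then obtain \<eta> t1 D where \<eta>: "D \<ge> 1 \<and> t1 \<ge> 1 \<and> (\<forall>j. continuous_on {t1..} (\<eta> j)) \<and>
    (\<forall>j. \<forall>t\<ge>t1. Re (\<eta> j t) > M \<and> Re (\<eta> j t) \<ge> t / (2 * D) \<and> norm (\<eta> j t) \<le> 2 * D * t) \<and>
    (\<forall>j<m. \<forall>t\<ge>t1. \<eta> j t = K j (\<eta> (Suc j) (iter_exp p t))) \<and> \<eta> m = \<eta> 0"
    by (elim exE)
  have step: "W (m - j) n (\<eta> j t) = W (m - Suc j) (Suc n) (\<eta> (Suc j) (iter_exp p t))" if "j < m" "t \<ge> t1" for j n t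
  proof -
    have "iter_exp p t \<ge> t1" using iter_exp_ge[of t p] that by linarith
    then have "\<eta> (Suc j) (iter_exp p t) \<in> rhp M" using \<eta> by simp
    moreover have "\<eta> j t = K j (\<eta> (Suc j) (iter_exp p t))" using \<eta> that by blast
    ultimately show ?thesis using K[OF that(1)] by (simp add: linked_def)
  qed
  have it: "W m n (\<eta> 0 t) = W (m - j) (n + j) (\<eta> j (iter_exp (p * j) t)) \<and> iter_exp (p * j) t \<ge> t1" if "j \<le> m" "t \<ge> t1" for j n t
    using that
  proof (induction j)
    case (Suc j)
    define s where "s = iter_exp (p * j) t"
    have s: "s \<ge> t1" "W m n (\<eta> 0 t) = W (m - j) (n + j) (\<eta> j s)" using Suc by (simp_all add: s_def)
    have es: "iter_exp p s = iter_exp (p * Suc j) t" by (simp add: s_def funpow_add)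
    show ?case using step[of j s "n + j"] Suc.prems s es iter_exp_ge[of s p] by simp
  qed simp
  have "W 0 n (\<eta> 0 t) = W 0 (n + m) (\<eta> 0 (iter_exp (p * m) t))" if "t \<ge> t1" for n t
    using it[OF order_refl that, of n] W(3) \<eta> by simp
  then have "m \<ge> 1 \<and> t1 \<ge> 1 \<and> D \<ge> 1 \<and> leaf (W 0) \<and> (\<exists>N. reach (W 0) N) \<and> continuous_on {t1..} (\<eta> 0) \<and>
     (\<forall>t\<ge>t1. Re (\<eta> 0 t) > M \<and> Re (\<eta> 0 t) \<ge> t / (2 * D) \<and> norm (\<eta> 0 t) \<le> 2 * D * t) \<and>
     (\<forall>t\<ge>t1. \<forall>n. W 0 n (\<eta> 0 t) = W 0 (n + m) (\<eta> 0 (iter_exp (p * m) t)))"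
    using m W(1,4) \<eta> by blast
  then show ?thesis by blast
qed

text \<open>Convergence at the one point \<open>\<zeta>\<close> spreads to compact sets because the
  factor in \<open>log_lipschitz\<close> is the same for all lifts.\<close>

lemma leaf_uniform_limit:
  assumes V: "leaf V" and r: "reach V N" and K: "compact K" "K \<subseteq> rhp M" and e: "e > 0"
  shows "\<exists>N. \<forall>n\<ge>N. \<forall>x\<in>K. norm (V n x - z0) < e"
proof -
  obtain \<zeta> where \<zeta>: "Re \<zeta> \<ge> M + 1" "V N \<zeta> \<in> cball z0 \<delta>" "\<And>k. V (N + k) \<zeta> = (\<phi> ^^ k) (V N \<zeta>)"
    using r by (auto simp: reach_def)
  have \<zeta>H: "\<zeta> \<in> rhp \<rho>" using \<zeta>(1) M(1) by simp
  have "(\<lambda>k. (\<phi> ^^ k) (V N \<zeta>)) \<longlonglongrightarrow> z0"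
    by (rule attract_lim[of _ N]) (use \<zeta>(2) cball_subset leaf_exp[OF V \<zeta>H, of N] \<zeta>H in auto)
  then have "(\<lambda>k. V (k + N) \<zeta>) \<longlonglongrightarrow> z0" using \<zeta>(3) by (simp add: add.commute)
  then have lim: "(\<lambda>k. V k \<zeta>) \<longlonglongrightarrow> z0" by (rule LIMSEQ_offset)
  obtain B where B: "\<And>x. x \<in> K \<Longrightarrow> norm x \<le> B" using compact_imp_bounded[OF K(1)] unfolding bounded_iff by blast
  define C where "C = exp (12 * pi / (M - \<rho>) * (B + norm \<zeta>))"
  have C: "C > 0" by (simp add: C_def)
  then have "e / C > 0" using e by simp
  then obtain N1 where N1: "\<And>n. n \<ge> N1 \<Longrightarrow> dist (V n \<zeta>) z0 < e / C" using lim unfolding lim_sequentially by blast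
  have "norm (V n x - z0) < e" if n: "n \<ge> Suc N1" and x: "x \<in> K" for n x
  proof -
    obtain k where k: "n = Suc k" using n by (cases n) auto
    have "norm (V n x - z0) \<le> exp (12 * pi / (M - \<rho>) * norm (x - \<zeta>)) * norm (V n \<zeta> - z0)"
      unfolding k by (rule log_lipschitz[OF leaf_hol[OF V] leaf_inj[OF V] leaf_omits[OF V]]) (use M(1) K(2) x \<zeta>(1) in force)+
    also have "\<dots> \<le> C * norm (V n \<zeta> - z0)"
    proof (rule mult_right_mono)
      have "norm (x - \<zeta>) \<le> norm x + norm \<zeta>" by norm
      also have "\<dots> \<le> B + norm \<zeta>" using B[OF x] by simp
      finally have "12 * pi / (M - \<rho>) * norm (x - \<zeta>) \<le> 12 * pi / (M - \<rho>) * (B + norm \<zeta>)"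
        using M(1) by (intro mult_left_mono) auto
      then show "exp (12 * pi / (M - \<rho>) * norm (x - \<zeta>)) \<le> C" by (simp add: C_def)
    qed simp
    also have "\<dots> < C * (e / C)" using N1[of n] n C by (intro mult_strict_left_mono) (auto simp: dist_norm)
    finally show ?thesis using C by simp
  qed
  then show ?thesis by blast
qed

theorem ray_exists: "\<exists>g. periodic_ray F g \<and> lands_at g z0"
proof -
  obtain m G \<eta> t1 D N where m: "m \<ge> 1" and t1: "t1 \<ge> 1" and D: "D \<ge> 1" and G: "leaf G" and reachG: "reach G N"
    and \<eta>c: "continuous_on {t1..} \<eta>"
    and \<eta>: "\<And>t. t \<ge> t1 \<Longrightarrow> Re (\<eta> t) > M \<and> Re (\<eta> t) \<ge> t / (2 * D) \<and> norm (\<eta> t) \<le> 2 * D * t"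
    and rec: "\<And>t n. t \<ge> t1 \<Longrightarrow> G n (\<eta> t) = G (n + m) (\<eta> (iter_exp (p * m) t))"
    using leaf_cycle_curve by blast
  define Q where "Q = iter_exp (p * m)"
  have pm: "p * m \<ge> 1" using p m by simp
  have Q1: "Q t \<ge> t + 1" for t
  proof -
    have "real (p * m) \<ge> 1" using pm by (metis of_nat_1 of_nat_mono)
    then show ?thesis using iter_exp_ge_plus[of t "p * m"] unfolding Q_def by linarith
  qed
  have Qc: "continuous_on UNIV Q" unfolding Q_def by (rule continuous_iter_exp)
  have Qm: "Q s < Q t" if "s < t" for s t unfolding Q_def by (rule iter_exp_strict_mono[OF that])
  obtain \<theta> :: "real \<Rightarrow> real" where \<theta>c: "continuous_on {1..} \<theta>" and \<theta>m: "strict_mono_on {1..} \<theta>" and \<theta>1: "\<theta> 1 = t1"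
    and \<theta>2: "\<And>s. s \<ge> 1 \<Longrightarrow> \<theta> (2 * s) = Q (\<theta> s)" and \<theta>l: "filterlim \<theta> at_top at_top"
    using doubling_parametrization[OF Qc Qm Q1, of t1] by blast
  have \<theta>t: "\<theta> s \<ge> t1" if "s \<ge> 1" for s
    using \<theta>m that \<theta>1 by (cases "s = 1") (auto simp: strict_mono_on_def intro!: less_imp_le)
  \<comment> \<open>The ray at parameter \<open>s\<close>: go \<open>k\<close> doublings out along
    the curve, then back through \<open>m * k\<close> lifts of the leaf. By the recurrence this is
    independent of \<open>k\<close> once \<open>2 ^ k * s \<ge> 1\<close>.\<close>
  define H where "H k s = G (m * k) (\<eta> (\<theta> (2 ^ k * s)))" for k :: nat and s :: real
  have \<eta>H: "\<eta> t \<in> rhp \<rho>" "\<eta> t \<in> rhp M" if "t \<ge> t1" for t using \<eta>[OF that] M(1) by auto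
  have Hstep: "H (Suc k) s = H k s" if "2 ^ k * s \<ge> 1" for k s
  proof -
    have "\<theta> (2 ^ Suc k * s) = Q (\<theta> (2 ^ k * s))" using \<theta>2[OF that] by (simp add: mult_ac)
    then show ?thesis using rec[OF \<theta>t[OF that], of "m * k"] by (simp add: H_def Q_def add.commute)
  qed
  have Hadd: "H (k + i) s = H k s" if "2 ^ k * s \<ge> 1" for k i s
  proof (induction i)
    case (Suc i)
    have "2 ^ (k + i) * s = 2 ^ i * (2 ^ k * s)" by (simp add: power_add)
    also have "\<dots> \<ge> 1 * 1" using that by (intro mult_mono) auto
    finally show ?case using Hstep[of "k + i" s] Suc by simp
  qed simp
  have Heq: "H k s = H j s" if "2 ^ k * s \<ge> 1" "2 ^ j * s \<ge> 1" for k j s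
    using Hadd[OF that(1), of "j - k"] Hadd[OF that(2), of "k - j"] by (cases "k \<le> j") auto
  have exk: "\<exists>k::nat. 2 ^ k * s \<ge> 1" if "s > 0" for s :: real
  proof -
    obtain k where "1 / s < 2 ^ k" using real_arch_pow[of 2 "1 / s"] by auto
    then show ?thesis using that by (intro exI[of _ k]) (simp add: field_simps)
  qed
  define g where "g s = H (SOME k. 2 ^ k * s \<ge> 1) s" for s :: real
  have gH: "g s = H k s" if "2 ^ k * s \<ge> 1" for k s
    unfolding g_def by (rule Heq[OF someI that]) (rule that)
  have g1: "g s = exp (\<eta> (\<theta> s))" if "s \<ge> 1" for s
    using gH[of 0 s] that G \<eta>H[OF \<theta>t[OF that]] by (simp add: H_def leaf_def)
  have dbl: "g (2 * s) = (F ^^ m) (g s)" if "s > 0" for s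
  proof -
    obtain k where k: "2 ^ k * s \<ge> 1" using exk[OF \<open>s > 0\<close>] by blast
    have k': "2 ^ Suc k * s \<ge> 1" "2 ^ k * (2 * s) \<ge> 1" using k that by auto
    have "(F ^^ m) (g s) = (F ^^ m) (G (m + m * k) (\<eta> (\<theta> (2 ^ Suc k * s))))"
      using gH[OF k'(1)] by (simp add: H_def)
    also have "\<dots> = G (m * k) (\<eta> (\<theta> (2 ^ Suc k * s)))"
      by (rule leaf_funpow[OF G \<eta>H(1)[OF \<theta>t[OF k'(1)]]])
    also have "\<dots> = g (2 * s)" using gH[OF k'(2)] by (simp add: H_def mult_ac)
    finally show ?thesis by simp
  qed
  have cont: "continuous_on {0<..} g"
  proof -
    have "isCont g s" if s: "s > 0" for s
    proof -
      obtain k where k: "2 ^ k * (s / 2) \<ge> 1" using exk[of "s / 2"] s by auto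
      define U where "U = {s / 2<..}"
      have U1: "2 ^ k * x \<ge> 1" if "x \<in> U" for x
      proof -
        have "2 ^ k * (s / 2) \<le> 2 ^ k * x" using that by (intro mult_left_mono) (auto simp: U_def)
        then show ?thesis using k by linarith
      qed
      have "continuous_on U (\<lambda>x. \<theta> (2 ^ k * x))"
        by (rule continuous_on_compose2[OF \<theta>c]) (use U1 in \<open>auto intro!: continuous_intros\<close>)
      then have "continuous_on U (\<lambda>x. \<eta> (\<theta> (2 ^ k * x)))"
        by (rule continuous_on_compose2[OF \<eta>c]) (use U1 \<theta>t in auto)
      then have "continuous_on U (H k)" unfolding H_def[abs_def]
        by (rule continuous_on_compose2[OF holomorphic_on_imp_continuous_on[OF leaf_hol[OF G]]]) (use U1 \<theta>t \<eta>H in blast)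
      then have "continuous_on U g" by (rule continuous_on_eq) (rule gH[OF U1, symmetric])
      then show ?thesis using s by (simp add: U_def continuous_on_eq_continuous_at)
    qed
    then show ?thesis by (simp add: continuous_on_eq_continuous_at)
  qed
  have lim: "filterlim g at_infinity at_top"
    unfolding filterlim_at_infinity[OF order_refl]
  proof (intro allI impI)
    fix r :: real assume "0 < r"
    have "\<forall>\<^sub>F s in at_top. \<theta> s \<ge> 2 * D * r" using \<theta>l by (simp add: filterlim_at_top)
    moreover have "\<forall>\<^sub>F s in at_top. s \<ge> (1::real)" by (rule eventually_ge_at_top)
    ultimately show "\<forall>\<^sub>F s in at_top. r \<le> norm (g s)"
    proof eventually_elim
      case (elim s)
      have "r \<le> \<theta> s / (2 * D)" using elim(1) D by (simp add: pos_le_divide_eq mult_ac)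
      also have "\<dots> \<le> Re (\<eta> (\<theta> s))" using \<eta>[OF \<theta>t[OF elim(2)]] by simp
      also have "\<dots> \<le> exp (Re (\<eta> (\<theta> s)))" using exp_ge_add_one_self[of "Re (\<eta> (\<theta> s))"] by linarith
      finally show ?case using g1[OF elim(2)] by simp
    qed
  qed
  have gpow: "g (2 ^ k * s) = (F ^^ (m * k)) (g s)" if "s > 0" for k s
  proof (induction k)
    case (Suc k)
    have "g (2 ^ Suc k * s) = (F ^^ m) (g (2 ^ k * s))" using dbl[of "2 ^ k * s"] that by (simp add: mult_ac)
    then show ?case using Suc by (simp add: funpow_add)
  qed simp
  have \<theta>pow: "\<theta> (2 ^ i * s) = iter_exp (p * m * i) (\<theta> s)" if "s \<ge> 1" for i s
  proof (induction i)
    case (Suc i)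
    have "2 ^ i * s \<ge> 1 * 1" using that by (intro mult_mono) auto
    then have "\<theta> (2 ^ Suc i * s) = Q (\<theta> (2 ^ i * s))" using \<theta>2[of "2 ^ i * s"] by (simp add: mult_ac)
    then show ?case using Suc by (simp add: Q_def funpow_add)
  qed simp
  \<comment> \<open>Equality of two points persists under iteration. But
    \<open>Re (\<eta> t)\<close> lies between \<open>t / (2 * D)\<close> and
    \<open>2 * D * t\<close>, so the two parameters far out would keep a ratio of at most
    \<open>4 * D * D\<close>, which iterated exponentials exceed.\<close>
  have noteq: "g s \<noteq> g t" if st: "0 < s" "s < t" for s t
  proof
    assume eq: "g s = g t"
    obtain k where k: "2 ^ k * s \<ge> 1" using exk[OF st(1)] by blast
    have kt: "2 ^ k * s < 2 ^ k * t" using st by simp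
    have k3: "2 ^ k * t \<ge> 1" using k kt by linarith
    define a where "a = \<theta> (2 ^ k * s)"
    define b where "b = \<theta> (2 ^ k * t)"
    have ab: "a < b" unfolding a_def b_def by (rule strict_mono_onD[OF \<theta>m _ _ kt]) (use k k3 in simp_all)
    have a1: "a \<ge> 1" using \<theta>t[OF k] t1 by (simp add: a_def)
    have "4 * D * D > 0" using D by simp
    then obtain N where N: "\<And>n. n \<ge> N \<Longrightarrow> iter_exp n b > 4 * D * D * iter_exp n a"
      using iter_exp_unbounded_ratio[OF ab a1] by blast
    define n where "n = p * m * N"
    have "n \<ge> N" using pm by (simp add: n_def)
    have k2: "2 ^ N * (2 ^ k * s) \<ge> 1" "2 ^ N * (2 ^ k * t) \<ge> 1"
    proof -
      have "2 ^ N * (2 ^ k * s) \<ge> 1 * 1" using k by (intro mult_mono) auto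
      moreover have "2 ^ N * (2 ^ k * t) \<ge> 1 * 1" using k3 by (intro mult_mono) auto
      ultimately show "2 ^ N * (2 ^ k * s) \<ge> 1" "2 ^ N * (2 ^ k * t) \<ge> 1" by auto
    qed
    have \<theta>n: "\<theta> (2 ^ N * (2 ^ k * s)) = iter_exp n a" "\<theta> (2 ^ N * (2 ^ k * t)) = iter_exp n b"
      using \<theta>pow[OF k, of N] \<theta>pow[OF k3, of N] by (simp_all add: a_def b_def n_def)
    have "g (2 ^ (N + k) * s) = g (2 ^ (N + k) * t)" using gpow[of s "N + k"] gpow[of t "N + k"] eq st by simp
    then have "g (2 ^ N * (2 ^ k * s)) = g (2 ^ N * (2 ^ k * t))" by (simp add: power_add mult_ac)
    then have "exp (\<eta> (iter_exp n a)) = exp (\<eta> (iter_exp n b))" using g1[OF k2(1)] g1[OF k2(2)] \<theta>n by simp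
    then have "exp (Re (\<eta> (iter_exp n a))) = exp (Re (\<eta> (iter_exp n b)))" by (metis norm_exp_eq_Re)
    then have Req: "Re (\<eta> (iter_exp n a)) = Re (\<eta> (iter_exp n b))" by simp
    have t: "iter_exp n a \<ge> t1" "iter_exp n b \<ge> t1" using \<theta>t[OF k2(1)] \<theta>t[OF k2(2)] \<theta>n by simp_all
    have "iter_exp n b / (2 * D) \<le> Re (\<eta> (iter_exp n b))" using \<eta>[OF t(2)] by simp
    also have "\<dots> \<le> 2 * D * iter_exp n a" using Req \<eta>[OF t(1)] complex_Re_le_cmod[of "\<eta> (iter_exp n a)"] by linarith
    finally have "iter_exp n b \<le> 2 * D * iter_exp n a * (2 * D)" using D by (subst (asm) pos_divide_le_eq) auto
    then show False using N[OF \<open>n \<ge> N\<close>] by (simp add: mult_ac)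
  qed
  have injg: "inj_on g {0<..}"
  proof (rule inj_onI)
    fix s t assume "s \<in> {0<..}" "t \<in> {0<..}" "g s = g t"
    then show "s = t" using noteq[of s t] noteq[of t s] by (cases s t rule: linorder_cases) auto
  qed
  have land: "(g \<longlongrightarrow> z0) (at_right 0)"
  proof (rule tendstoI)
    fix e :: real assume e: "e > 0"
    define K where "K = (\<lambda>s. \<eta> (\<theta> s)) ` {1..2}"
    have Kc: "compact K"
      unfolding K_def
    proof (rule compact_continuous_image)
      have "continuous_on {1..2} \<theta>" by (rule continuous_on_subset[OF \<theta>c]) auto
      then show "continuous_on {1..2} (\<lambda>s. \<eta> (\<theta> s))"
        by (rule continuous_on_compose2[OF \<eta>c]) (use \<theta>t in auto)
    qed simp
    have Ks: "K \<subseteq> rhp M" using \<eta>H(2) \<theta>t by (auto simp: K_def)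
    obtain N1 where N1: "\<And>n x. n \<ge> N1 \<Longrightarrow> x \<in> K \<Longrightarrow> norm (G n x - z0) < e"
      using leaf_uniform_limit[OF G reachG Kc Ks e] by blast
    have "dist (g s) z0 < e" if s: "0 < s" "s < 1 / 2 ^ N1" for s
    proof -
      \<comment> \<open>Minimality puts \<open>2 ^ k * s\<close> into \<open>{1..2}\<close>, so
        \<open>g s\<close> is the value of a deep lift at a point of the compact set
        \<open>K\<close>.\<close>
      define k where "k = (LEAST k. 2 ^ k * s \<ge> 1)"
      have k: "2 ^ k * s \<ge> 1" unfolding k_def by (rule LeastI_ex[OF exk[OF s(1)]])
      have "k > N1"
      proof (rule ccontr)
        assume "\<not> N1 < k"
        then have "(2::real) ^ k \<le> 2 ^ N1" by (intro power_increasing) auto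
        then have "2 ^ k * s \<le> 2 ^ N1 * s" using s(1) by (intro mult_right_mono) auto
        also have "\<dots> < 1" using s(2) by (simp add: field_simps)
        finally show False using k by simp
      qed
      then obtain j where j: "k = Suc j" by (cases k) auto
      have "\<not> 2 ^ j * s \<ge> 1" using not_less_Least[of j "\<lambda>k. 2 ^ k * s \<ge> 1"] j by (simp add: k_def)
      then have "2 ^ k * s \<in> {1..2}" using k j by auto
      then have "\<eta> (\<theta> (2 ^ k * s)) \<in> K" by (auto simp: K_def)
      moreover have "m * k \<ge> N1" using \<open>k > N1\<close> m by (metis less_imp_le mult_le_mono nat_mult_1 le_trans order_refl)
      ultimately show ?thesis using N1 gH[OF k] by (simp add: H_def dist_norm)
    qed
    then show "\<forall>\<^sub>F s in at_right 0. dist (g s) z0 < e"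
      by (auto simp: eventually_at_right_field intro!: exI[of _ "1 / 2 ^ N1"])
  qed
  have "periodic_ray F g" unfolding periodic_ray_def using cont injg lim m dbl by blast
  then show ?thesis using land by (auto simp: lands_at_def)
qed

end

section \<open>Local dynamics at repelling and parabolic fixed points\<close>

text \<open>Only points that leave a neighbourhood of \<open>z0\<close> under iteration have to shrink under the local inverse
  \<open>\<phi>\<close>: near a parabolic point the others lie in attracting petals.\<close>

definition local_exit :: "(complex \<Rightarrow> complex) \<Rightarrow> complex \<Rightarrow> bool" where
  "local_exit F z0 \<longleftrightarrow> (\<exists>\<phi> \<delta> \<epsilon>. 0 < \<delta> \<and> \<delta> \<le> 1 / 2 \<and> 0 < \<epsilon> \<and> \<epsilon> \<le> 1 \<and>
     continuous_on (ball z0 (2 * \<delta>)) \<phi> \<and> (\<forall>x\<in>ball z0 (2 * \<delta>). F (\<phi> x) = x) \<and>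
     (\<forall>y\<in>ball z0 ((1 + \<epsilon>) * \<delta>). (\<exists>j. (F ^^ j) y \<notin> ball z0 1) \<longrightarrow>
        (\<forall>n\<ge>1. (\<phi> ^^ n) y \<in> cball z0 \<delta>) \<and> (\<lambda>n. (\<phi> ^^ n) y) \<longlonglongrightarrow> z0) \<and>
     (\<exists>y x. y \<noteq> z0 \<and> x \<longlonglongrightarrow> z0 \<and> (\<forall>n. (F ^^ n) (x n) = y)))"

lemma local_inverse:
  assumes F: "F holomorphic_on UNIV" "F z0 = z0" "deriv F z0 \<noteq> 0"
  obtains \<phi> r where "r > 0" "\<phi> holomorphic_on ball z0 r" "\<And>x. x \<in> ball z0 r \<Longrightarrow> F (\<phi> x) = x"
    "\<phi> z0 = z0" "deriv F z0 * deriv \<phi> z0 = 1"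
proof -
  obtain s where s: "s > 0" "open (F ` ball z0 s)" "inj_on F (ball z0 s)"
    using has_complex_derivative_locally_invertible[OF F(1) UNIV_I open_UNIV F(3)] by metis
  obtain g where g: "g holomorphic_on F ` ball z0 s" "\<And>z. z \<in> ball z0 s \<Longrightarrow> deriv F z * deriv g (F z) = 1"
    "\<And>z. z \<in> ball z0 s \<Longrightarrow> g (F z) = z"
    using holomorphic_has_inverse[OF holomorphic_on_subset[OF F(1) subset_UNIV] open_ball s(3)] by metis
  have z0: "z0 \<in> ball z0 s" using s(1) by simp
  then have "z0 \<in> F ` ball z0 s" using F(2) by (metis imageI)
  then obtain r where r: "r > 0" "ball z0 r \<subseteq> F ` ball z0 s" using s(2) open_contains_ball by blast
  show ?thesis
  proof (rule that[OF r(1)])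
    show "g holomorphic_on ball z0 r" using g(1) r(2) by (rule holomorphic_on_subset)
    show "F (g x) = x" if "x \<in> ball z0 r" for x using r(2) g(3) that by auto
    show "g z0 = z0" "deriv F z0 * deriv g z0 = 1" using g(2,3)[OF z0] F(2) by auto
  qed
qed

lemma local_exit_repelling:
  assumes F: "F holomorphic_on UNIV" "F z0 = z0" and rep: "norm (deriv F z0) > 1"
  shows "local_exit F z0"
proof -
  have "deriv F z0 \<noteq> 0" using rep by auto
  from local_inverse[OF F this] obtain \<phi> r where r: "r > 0" and \<phi>: "\<phi> holomorphic_on ball z0 r"
    "\<And>x. x \<in> ball z0 r \<Longrightarrow> F (\<phi> x) = x" "\<phi> z0 = z0" "deriv F z0 * deriv \<phi> z0 = 1" by metis
  have "norm (deriv F z0) * norm (deriv \<phi> z0) = 1" using \<phi>(4) by (metis norm_mult norm_one)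
  then have nd: "norm (deriv \<phi> z0) < 1"
  proof -
    have "norm (deriv \<phi> z0) > 0" using \<open>norm (deriv F z0) * norm (deriv \<phi> z0) = 1\<close> by (metis mult_zero_right norm_ge_zero order_le_less zero_neq_one)
    then have "1 * norm (deriv \<phi> z0) < norm (deriv F z0) * norm (deriv \<phi> z0)" using rep by (rule mult_strict_right_mono[rotated])
    then show ?thesis using \<open>norm (deriv F z0) * norm (deriv \<phi> z0) = 1\<close> by simp
  qed
  define \<kappa> where "\<kappa> = (1 + norm (deriv \<phi> z0)) / 2"
  have \<kappa>: "\<kappa> < 1" "\<kappa> \<ge> 1 / 2" "norm (deriv \<phi> z0) < \<kappa>" using nd by (auto simp: \<kappa>_def)
  have "(\<phi> has_field_derivative deriv \<phi> z0) (at z0)" using \<phi>(1) r by (intro holomorphic_derivI[of \<phi> "ball z0 r"]) auto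
  then have "((\<lambda>x. (\<phi> x - \<phi> z0) / (x - z0)) \<longlongrightarrow> deriv \<phi> z0) (at z0)"
    by (simp add: has_field_derivative_iff)
  then have "((\<lambda>x. norm ((\<phi> x - \<phi> z0) / (x - z0))) \<longlongrightarrow> norm (deriv \<phi> z0)) (at z0)" by (rule tendsto_norm)
  then have "\<forall>\<^sub>F x in at z0. norm ((\<phi> x - \<phi> z0) / (x - z0)) < \<kappa>" using \<kappa>(3) by (rule order_tendstoD)
  then obtain d where d: "d > 0" "\<And>x. x \<noteq> z0 \<Longrightarrow> dist x z0 < d \<Longrightarrow> norm ((\<phi> x - \<phi> z0) / (x - z0)) < \<kappa>"
    unfolding eventually_at by auto
  have contr: "norm (\<phi> x - z0) \<le> \<kappa> * norm (x - z0)" if "x \<in> ball z0 d" for x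
  proof (cases "x = z0")
    case False
    then have "norm ((\<phi> x - z0) / (x - z0)) < \<kappa>" using d(2)[of x] that \<phi>(3) by (simp add: dist_commute)
    then show ?thesis using False by (simp add: norm_divide field_simps)
  qed (use \<phi>(3) in simp)
  define \<delta> where "\<delta> = min (1 / 2) (min (d / 2) (r / 2))"
  have \<delta>: "0 < \<delta>" "\<delta> \<le> 1 / 2" "2 * \<delta> \<le> d" "2 * \<delta> \<le> r" using d r by (auto simp: \<delta>_def)
  \<comment> \<open>Chosen so that \<open>\<kappa> * (1 + \<epsilon>) = 1\<close>: one contraction
    takes the larger ball into the smaller. \<open>\<kappa> \<ge> 1 / 2\<close> gives
    \<open>\<epsilon> \<le> 1\<close>.\<close>
  define \<epsilon> where "\<epsilon> = 1 / \<kappa> - 1"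
  have \<epsilon>: "0 < \<epsilon>" "\<epsilon> \<le> 1" "\<kappa> * (1 + \<epsilon>) = 1" using \<kappa> by (auto simp: \<epsilon>_def field_simps)
  have le2: "(1 + \<epsilon>) * \<delta> \<le> 2 * \<delta>" using \<epsilon> \<delta> by (intro mult_right_mono) auto
  have it: "norm ((\<phi> ^^ n) y - z0) \<le> \<kappa> ^ n * norm (y - z0) \<and> (\<phi> ^^ n) y \<in> ball z0 (2 * \<delta>)" if y: "y \<in> ball z0 (2 * \<delta>)" for y n
  proof (induction n)
    case (Suc n)
    have "norm ((\<phi> ^^ Suc n) y - z0) \<le> \<kappa> * norm ((\<phi> ^^ n) y - z0)" using contr[of "(\<phi> ^^ n) y"] Suc \<delta>(3) by simp
    also have "\<dots> \<le> \<kappa> * (\<kappa> ^ n * norm (y - z0))" using Suc \<kappa> by (intro mult_left_mono) auto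
    finally have 1: "norm ((\<phi> ^^ Suc n) y - z0) \<le> \<kappa> ^ Suc n * norm (y - z0)" by simp
    also have "\<dots> \<le> 1 * norm (y - z0)" using \<kappa> by (intro mult_right_mono power_le_one) auto
    finally show ?case using 1 y by (auto simp: dist_norm norm_minus_commute simp del: funpow.simps)
  qed (use y in simp)
  have lim: "(\<lambda>n. (\<phi> ^^ n) y) \<longlonglongrightarrow> z0" if y: "y \<in> ball z0 (2 * \<delta>)" for y
  proof -
    have "(\<lambda>n. \<kappa> ^ n * norm (y - z0)) \<longlonglongrightarrow> 0 * norm (y - z0)"
      using \<kappa> by (intro tendsto_intros LIMSEQ_realpow_zero) auto
    then have "(\<lambda>n. \<kappa> ^ n * norm (y - z0)) \<longlonglongrightarrow> 0" by simp
    then have "(\<lambda>n. (\<phi> ^^ n) y - z0) \<longlonglongrightarrow> 0"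
      by (rule Lim_null_comparison[rotated]) (use it[OF y] in simp)
    then show ?thesis by (simp add: LIM_zero_iff)
  qed
  have cb: "(\<phi> ^^ n) y \<in> cball z0 \<delta>" if y: "y \<in> ball z0 ((1 + \<epsilon>) * \<delta>)" "n \<ge> 1" for y n
  proof -
    have y2: "y \<in> ball z0 (2 * \<delta>)" using y le2 by auto
    have "norm ((\<phi> ^^ n) y - z0) \<le> \<kappa> ^ n * norm (y - z0)" using it[OF y2] by blast
    also have "\<dots> \<le> \<kappa> * ((1 + \<epsilon>) * \<delta>)"
      using \<kappa> y power_decreasing[of 1 n \<kappa>] by (intro mult_mono) (auto simp: dist_norm norm_minus_commute)
    also have "\<dots> = \<delta>" using \<epsilon>(3) by (simp flip: mult.assoc)
    finally show ?thesis by (simp add: dist_norm norm_minus_commute)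
  qed
  have inv: "F (\<phi> x) = x" if "x \<in> ball z0 (2 * \<delta>)" for x using \<phi>(2) that \<delta>(4) by auto
  define y where "y = z0 + of_real \<delta>"
  have y: "y \<in> ball z0 (2 * \<delta>)" "y \<noteq> z0" using \<delta> by (auto simp: y_def dist_norm)
  have "(F ^^ n) ((\<phi> ^^ n) y) = y" for n
  proof (induction n)
    case (Suc n)
    have "(F ^^ Suc n) ((\<phi> ^^ Suc n) y) = (F ^^ n) (F (\<phi> ((\<phi> ^^ n) y)))" by (simp add: funpow_swap1)
    then show ?case using inv[of "(\<phi> ^^ n) y"] it[OF y(1)] Suc by simp
  qed simp
  then have orbit: "\<exists>y x. y \<noteq> z0 \<and> x \<longlonglongrightarrow> z0 \<and> (\<forall>n. (F ^^ n) (x n) = y)"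
    using y lim by blast
  have "continuous_on (ball z0 (2 * \<delta>)) \<phi>"
    using \<phi>(1) \<delta>(4) by (meson continuous_on_subset holomorphic_on_imp_continuous_on subset_ball)
  moreover have "\<forall>y\<in>ball z0 ((1 + \<epsilon>) * \<delta>). (\<forall>n\<ge>1. (\<phi> ^^ n) y \<in> cball z0 \<delta>) \<and> (\<lambda>n. (\<phi> ^^ n) y) \<longlonglongrightarrow> z0"
    using cb lim le2 by (meson subset_ball subsetD)
  ultimately show ?thesis
    unfolding local_exit_def using \<delta>(1,2) \<epsilon>(1,2) inv orbit by blast
qed

text \<open>The coordinate \<open>v = -1 / (q a (z - z0)^q)\<close> conjugates a parabolic map to a perturbation of the unit
  translation, on all petals simultaneously.\<close>

lemma parabolic_coordinate_limit:
  fixes k :: "complex \<Rightarrow> complex"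
  assumes q: "q \<ge> 1" and a: "k z0 \<noteq> 0" and k: "isCont k z0"
    and F: "\<forall>\<^sub>F z in at z0. F z = z + (z - z0) ^ Suc q * k z"
  shows "((\<lambda>z. - 1 / (of_nat q * k z0 * (F z - z0) ^ q) - (- 1 / (of_nat q * k z0 * (z - z0) ^ q))) \<longlongrightarrow> 1) (at z0)"
proof -
  \<comment> \<open>As \<open>F z - z0 = (z - z0) * (1 + s z)\<close>, the increment is a multiple
    of the difference quotient of \<open>inverse ((1 + s) ^ q)\<close> at 0, where the derivative is
    \<open>- q\<close>.\<close>
  define s where "s z = (z - z0) ^ q * k z" for z
  have klim: "(k \<longlongrightarrow> k z0) (at z0)" using k by (simp add: isCont_def)
  have "((\<lambda>z. (z - z0) ^ q * k z) \<longlongrightarrow> (z0 - z0) ^ q * k z0) (at z0)"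
    by (intro tendsto_intros klim)
  then have s0: "(s \<longlongrightarrow> 0) (at z0)" using q by (simp add: s_def[abs_def] zero_power)
  have knz: "\<forall>\<^sub>F z in at z0. k z \<noteq> 0" using klim a by (rule tendsto_imp_eventually_ne)
  have znz: "\<forall>\<^sub>F z in at z0. z \<noteq> z0" by (simp add: eventually_at_filter)
  have snz: "\<forall>\<^sub>F z in at z0. s z \<noteq> 0" using knz znz by eventually_elim (simp add: s_def)
  have s1: "\<forall>\<^sub>F z in at z0. 1 + s z \<noteq> 0"
  proof -
    have "((\<lambda>z. 1 + s z) \<longlongrightarrow> 1 + 0) (at z0)" by (intro tendsto_intros s0)
    then show ?thesis by (rule tendsto_imp_eventually_ne) simp
  qed
  have sat: "filterlim s (at 0) (at z0)" using s0 snz by (simp add: filterlim_at)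
  have "((\<lambda>s::complex. inverse ((1 + s) ^ q)) has_field_derivative - of_nat q) (at 0)"
    by (auto intro!: derivative_eq_intros)
  then have "((\<lambda>s::complex. (inverse ((1 + s) ^ q) - 1) / s) \<longlongrightarrow> - of_nat q) (at 0)"
    by (simp add: has_field_derivative_iff)
  from filterlim_compose[OF this sat]
  have "((\<lambda>z. (inverse ((1 + s z) ^ q) - 1) / s z) \<longlongrightarrow> - of_nat q) (at z0)" .
  then have "((\<lambda>z. - (k z / (of_nat q * k z0)) * ((inverse ((1 + s z) ^ q) - 1) / s z)) \<longlongrightarrow>
      - (k z0 / (of_nat q * k z0)) * (- of_nat q)) (at z0)"
    using a q by (intro tendsto_intros klim) auto
  then have "((\<lambda>z. - (k z / (of_nat q * k z0)) * ((inverse ((1 + s z) ^ q) - 1) / s z)) \<longlongrightarrow> 1) (at z0)"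
    using a q by simp
  then show ?thesis
  proof (rule Lim_transform_eventually)
    show "\<forall>\<^sub>F z in at z0. - (k z / (of_nat q * k z0)) * ((inverse ((1 + s z) ^ q) - 1) / s z) =
      - 1 / (of_nat q * k z0 * (F z - z0) ^ q) - (- 1 / (of_nat q * k z0 * (z - z0) ^ q))"
      using F knz znz s1
    proof eventually_elim
      case (elim z)
      have "F z - z0 = (z - z0) * (1 + s z)" by (simp add: elim(1) s_def algebra_simps)
      then have e: "(F z - z0) ^ q = (z - z0) ^ q * (1 + s z) ^ q" by (simp add: power_mult_distrib)
      define w where "w = (z - z0) ^ q"
      have w: "w \<noteq> 0" using elim(3) by (simp add: w_def)
      define u where "u = (1 + s z) ^ q"
      have u: "u \<noteq> 0" using elim(4) by (simp add: u_def)
      have "k z / s z = 1 / w" using elim(2) w by (simp add: s_def w_def)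
      moreover have "- (k z / (of_nat q * k z0)) * ((inverse u - 1) / s z) = - (1 / (of_nat q * k z0)) * (inverse u - 1) * (k z / s z)"
        by simp
      ultimately have "- (k z / (of_nat q * k z0)) * ((inverse u - 1) / s z) = - (1 / (of_nat q * k z0)) * (inverse u - 1) * (1 / w)"
        by simp
      also have "\<dots> = - 1 / (of_nat q * k z0 * (w * u)) - (- 1 / (of_nat q * k z0 * w))"
        using a q w u by (simp add: field_simps)
      finally show ?case unfolding e w_def[symmetric] u_def[symmetric] .
    qed
  qed
qed

text \<open>In this region a large \<open>v\<close> has very negative real part,
  \<open>- 2 * Re v \<ge> norm v / 2\<close>, so subtracting 1 lengthens it by at least
  \<open>1 / 4\<close>; half of that absorbs the error.\<close>

lemma parabolic_drift:
  fixes v w :: complex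
  assumes C: "C \<ge> 1" and v: "norm v \<ge> 8 * C" and nt: "Re v + \<bar>Im v\<bar> \<le> C" and w: "norm (w - v + 1) \<le> 1 / 8"
  shows "norm w \<ge> norm v + 1 / 8"
proof -
  have n: "norm v \<le> \<bar>Re v\<bar> + \<bar>Im v\<bar>" by (rule cmod_le)
  have re: "Re v \<le> 0" using n v nt C by linarith
  then have "- 2 * Re v \<ge> norm v - C" using n nt by linarith
  then have r: "- 2 * Re v \<ge> norm v / 2" using v C by linarith
  have "(norm (v - 1))\<^sup>2 = (norm v)\<^sup>2 - 2 * Re v + 1"
    by (simp only: cmod_power2) (simp add: power2_eq_square algebra_simps)
  then have "(norm v + 1 / 4)\<^sup>2 \<le> (norm (v - 1))\<^sup>2" using r by (simp add: power2_eq_square algebra_simps)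
  then have "norm v + 1 / 4 \<le> norm (v - 1)" by (rule power2_le_imp_le) simp
  moreover have "norm (v - 1) \<le> norm w + norm (w - v + 1)"
    using norm_triangle_ineq4[of w "w - v + 1"] by (simp add: algebra_simps)
  ultimately show ?thesis using w by linarith
qed

text \<open>In the coordinate \<open>v\<close>, \<open>F\<close> adds about 1. The region
  \<open>Re v + \<bar>Im v\<bar> > C\<close>, covering the attracting directions, is forward
  invariant and close to \<open>z0\<close>, so an orbit that exits never meets it. On its complement
  \<open>\<phi>\<close> increases \<open>norm v\<close> at a definite rate, that is, moves points to
  \<open>z0\<close>.\<close>

lemma local_exit_parabolic:
  assumes F: "F holomorphic_on UNIV" "F z0 = z0" "deriv F z0 = 1" and nid: "\<not> (\<forall>z. F z = z)"
  shows "local_exit F z0"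
proof -
  have "deriv F z0 \<noteq> 0" using F(3) by simp
  from local_inverse[OF F(1,2) this] obtain \<phi> r where r: "r > 0" and \<phi>: "\<phi> holomorphic_on ball z0 r"
    "\<And>x. x \<in> ball z0 r \<Longrightarrow> F (\<phi> x) = x" "\<phi> z0 = z0" by metis
  obtain r2 where r2: "r2 > 0" "inj_on F (ball z0 r2)"
    using has_complex_derivative_locally_injective[OF F(1) UNIV_I open_UNIV \<open>deriv F z0 \<noteq> 0\<close>] by metis
  define h where "h z = F z - z" for z
  have h: "h holomorphic_on UNIV" unfolding h_def[abs_def] by (intro holomorphic_intros F)
  have h0: "h z0 = 0" by (simp add: h_def F)
  have hnc: "\<not> h constant_on UNIV"
  proof
    assume "h constant_on UNIV"
    then have "h z = h z0" for z by (auto simp: constant_on_def)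
    then show False using nid h0 by (simp add: h_def)
  qed
  obtain k r3 n where n: "0 < n" "0 < r3" and k: "k holomorphic_on ball z0 r3"
    "\<And>w. w \<in> ball z0 r3 \<Longrightarrow> h w = (w - z0) ^ n * k w" "\<And>w. w \<in> ball z0 r3 \<Longrightarrow> k w \<noteq> 0"
    using holomorphic_factor_zero_nonconstant[OF h open_UNIV connected_UNIV UNIV_I h0 hnc] by metis
  have z03: "z0 \<in> ball z0 r3" using n by simp
  have "n \<noteq> 1"
  proof
    assume "n = 1"
    have "(k has_field_derivative deriv k z0) (at z0)" by (rule holomorphic_derivI[OF k(1) open_ball z03])
    then have "((\<lambda>w. (w - z0) * k w) has_field_derivative k z0) (at z0)" by (auto intro!: derivative_eq_intros)
    then have "(h has_field_derivative k z0) (at z0)"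
      by (rule has_field_derivative_transform_within_open[OF _ open_ball z03]) (use k(2) \<open>n = 1\<close> in simp)
    moreover have "(h has_field_derivative deriv F z0 - 1) (at z0)"
      unfolding h_def[abs_def] by (intro DERIV_diff DERIV_ident holomorphic_derivI[OF F(1)]) auto
    ultimately have "k z0 = 0" using DERIV_unique F(3) by fastforce
    then show False using k(3)[OF z03] by simp
  qed
  then obtain q where q: "n = Suc q" "q \<ge> 1" using n(1) by (cases n) auto
  define a where "a = k z0"
  have a: "a \<noteq> 0" using k(3)[OF z03] by (simp add: a_def)
  define v where "v z = - 1 / (of_nat q * a * (z - z0) ^ q)" for z
  have Fk: "\<forall>\<^sub>F z in at z0. F z = z + (z - z0) ^ Suc q * k z"
  proof -
    have "\<forall>\<^sub>F z in at z0. z \<in> ball z0 r3" using z03 by (intro eventually_at_in_open') auto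
    then show ?thesis
    proof eventually_elim
      case (elim z)
      have "F z - z = (z - z0) ^ Suc q * k z" using k(2)[OF elim] unfolding h_def q(1) .
      then show ?case by (simp add: algebra_simps)
    qed
  qed
  have "isCont k z0" using k(1) z03 by (metis continuous_on_eq_continuous_at holomorphic_on_imp_continuous_on open_ball)
  from parabolic_coordinate_limit[OF q(2) k(3)[OF z03] this Fk]
  have lim1: "((\<lambda>z. v (F z) - v z) \<longlongrightarrow> 1) (at z0)" by (simp only: v_def a_def)
  have zr: "\<forall>\<^sub>F z in at z0. z \<in> ball z0 r" using r by (intro eventually_at_in_open') auto
  have znz: "\<forall>\<^sub>F z in at z0. z \<noteq> z0" by (simp add: eventually_at_filter)
  have \<phi>nz: "\<phi> z \<noteq> z0" if "z \<in> ball z0 r" "z \<noteq> z0" for z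
    using \<phi>(2)[OF that(1)] F(2) that(2) by auto
  have "isCont \<phi> z0" using \<phi>(1) r by (metis centre_in_ball continuous_on_eq_continuous_at holomorphic_on_imp_continuous_on open_ball)
  then have "(\<phi> \<longlongrightarrow> z0) (at z0)" using \<phi>(3) by (simp add: isCont_def)
  moreover have "\<forall>\<^sub>F z in at z0. \<phi> z \<noteq> z0" using zr znz by eventually_elim (rule \<phi>nz)
  ultimately have "filterlim \<phi> (at z0) (at z0)" by (simp add: filterlim_at)
  from filterlim_compose[OF lim1 this] have "((\<lambda>z. v (F (\<phi> z)) - v (\<phi> z)) \<longlongrightarrow> 1) (at z0)" .
  then have lim2: "((\<lambda>z. v z - v (\<phi> z)) \<longlongrightarrow> 1) (at z0)"
  proof (rule Lim_transform_eventually)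
    show "\<forall>\<^sub>F z in at z0. v (F (\<phi> z)) - v (\<phi> z) = v z - v (\<phi> z)"
      using zr by eventually_elim (simp add: \<phi>(2))
  qed
  have "\<forall>\<^sub>F z in at z0. dist (v (F z) - v z) 1 < 1 / 4" using lim1 by (rule tendstoD) simp
  moreover have "\<forall>\<^sub>F z in at z0. dist (v z - v (\<phi> z)) 1 < 1 / 8" using lim2 by (rule tendstoD) simp
  ultimately have "\<forall>\<^sub>F z in at z0. dist (v (F z) - v z) 1 < 1 / 4 \<and> dist (v z - v (\<phi> z)) 1 < 1 / 8" by (rule eventually_conj)
  then obtain d1 where d1: "d1 > 0" "\<And>z. z \<noteq> z0 \<Longrightarrow> dist z z0 < d1 \<Longrightarrow> dist (v (F z) - v z) 1 < 1 / 4 \<and> dist (v z - v (\<phi> z)) 1 < 1 / 8"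
    unfolding eventually_at by auto
  define \<delta>0 where "\<delta>0 = min 1 (min d1 (min r r2))"
  have \<delta>0: "\<delta>0 > 0" "\<delta>0 \<le> 1" "\<delta>0 \<le> r" using d1 r r2 by (auto simp: \<delta>0_def)
  have near: "norm (v (F z) - v z - 1) < 1 / 4" "norm (v (\<phi> z) - v z + 1) < 1 / 8" "F z \<noteq> z0" "\<phi> z \<noteq> z0" "F (\<phi> z) = z"
    if "z \<noteq> z0" "norm (z - z0) < \<delta>0" for z
  proof -
    have d: "dist z z0 < d1" "z \<in> ball z0 r" "z \<in> ball z0 r2" using that by (auto simp: \<delta>0_def dist_norm norm_minus_commute)
    show "norm (v (F z) - v z - 1) < 1 / 4" using d1(2)[OF that(1) d(1)] by (simp add: dist_norm)
    have "norm (- (v z - v (\<phi> z) - 1)) < 1 / 8" using d1(2)[OF that(1) d(1)] unfolding norm_minus_cancel by (simp add: dist_norm)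
    then show "norm (v (\<phi> z) - v z + 1) < 1 / 8" by (simp add: algebra_simps)
    show "F z \<noteq> z0" using r2 d(3) that(1) F(2) by (metis centre_in_ball inj_onD)
    show "\<phi> z \<noteq> z0" "F (\<phi> z) = z" using \<phi>nz \<phi>(2) d(2) that(1) by auto
  qed
  define A where "A = norm (of_nat q * a)"
  have A: "A > 0" using q a by (simp add: A_def)
  \<comment> \<open>The modulus of \<open>v\<close> on the circle of radius \<open>d\<close>. It
    decreases in \<open>d\<close>, which translates bounds on \<open>v\<close> into distances from
    \<open>z0\<close>.\<close>
  define vd where "vd d = 1 / (A * d ^ q)" for d
  have nv: "norm (v z) = vd (norm (z - z0))" for z
    by (simp add: v_def vd_def A_def norm_divide norm_mult norm_power)
  have vd_less: "vd e < vd d" if "0 < d" "d < e" for d e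
  proof -
    have "d ^ q < e ^ q" using that q(2) by (intro power_strict_mono) auto
    then show ?thesis using A that unfolding vd_def by (intro divide_strict_left_mono mult_strict_left_mono mult_pos_pos) auto
  qed
  have in_ball: "norm (z - z0) < d" if "norm (v z) > vd d" "z \<noteq> z0" "d > 0" for z d
  proof (rule ccontr)
    assume "\<not> ?thesis"
    then have "vd (norm (z - z0)) \<le> vd d" using vd_less[of d "norm (z - z0)"] that(3) by (cases "norm (z - z0) = d") auto
    then show False using that(1) nv by simp
  qed
  have in_cball: "norm (z - z0) \<le> d" if "norm (v z) \<ge> vd d" "z \<noteq> z0" "d > 0" for z d
    using vd_less[of d "norm (z - z0)"] that nv[of z] by fastforce
  have v_large: "norm (v z) > vd d" if "norm (z - z0) < d" "z \<noteq> z0" for z d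
    using vd_less[of "norm (z - z0)" d] that nv[of z] by simp
  \<comment> \<open>Since \<open>Re v + \<bar>Im v\<bar> \<le> 2 * norm v\<close>, the entry
    \<open>2 * vd \<delta>0\<close> confines the trapped region to the ball of radius
    \<open>\<delta>0\<close>.\<close>
  define C where "C = max 1 (2 * vd \<delta>0)"
  have C: "C \<ge> 1" "C \<ge> 2 * vd \<delta>0" by (auto simp: C_def)
  have trapped: "(F ^^ j) z \<in> ball z0 1" if z: "z \<noteq> z0" "Re (v z) + \<bar>Im (v z)\<bar> > C" for z j
  proof -
    have inb: "norm (x - z0) < \<delta>0" if "x \<noteq> z0" "Re (v x) + \<bar>Im (v x)\<bar> > C" for x
    proof (rule in_ball[OF _ that(1) \<delta>0(1)])
      have "C < 2 * norm (v x)" using that(2) complex_Re_le_cmod[of "v x"] abs_Im_le_cmod[of "v x"] by linarith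
      then show "vd \<delta>0 < norm (v x)" using C(2) by linarith
    qed
    have "(F ^^ j) z \<noteq> z0 \<and> Re (v ((F ^^ j) z)) + \<bar>Im (v ((F ^^ j) z))\<bar> > C"
    proof (induction j)
      case (Suc j)
      define x where "x = (F ^^ j) z"
      have x: "x \<noteq> z0" "Re (v x) + \<bar>Im (v x)\<bar> > C" using Suc by (simp_all add: x_def)
      note nx = near[OF x(1) inb[OF x]]
      have "\<bar>Re (v (F x) - v x - 1)\<bar> < 1 / 4" "\<bar>Im (v (F x) - v x - 1)\<bar> < 1 / 4"
        using abs_Re_le_cmod abs_Im_le_cmod nx(1) by (meson le_less_trans)+
      then have "\<bar>Re (v (F x)) - Re (v x) - 1\<bar> < 1 / 4" "\<bar>Im (v (F x)) - Im (v x)\<bar> < 1 / 4" by simp_all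
      \<comment> \<open>\<open>Re v\<close> gains at least \<open>3 / 4\<close> and
        \<open>\<bar>Im v\<bar>\<close> loses at most \<open>1 / 4\<close>.\<close>
      then have "Re (v (F x)) + \<bar>Im (v (F x))\<bar> > C" using x(2) by linarith
      then show ?case using nx(3) by (simp add: x_def)
    qed (use z in simp)
    then have "norm ((F ^^ j) z - z0) < \<delta>0" using inb by blast
    then show ?thesis using \<delta>0(2) by (simp add: dist_norm norm_minus_commute)
  qed
  \<comment> \<open>With \<open>2 * \<delta> \<le> 1\<close> this gives
    \<open>vd (2 * \<delta>) \<ge> 8 * C\<close>, the threshold in
    \<open>parabolic_drift\<close>.\<close>
  define \<delta> where "\<delta> = min \<delta>0 (1 / (8 * C * A)) / 2"
  have \<delta>: "\<delta> > 0" "2 * \<delta> \<le> \<delta>0" "\<delta> \<le> 1 / 2" using \<delta>0 A C by (auto simp: \<delta>_def)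
  have vd2: "vd (2 * \<delta>) \<ge> 8 * C"
  proof -
    have "(2 * \<delta>) ^ q \<le> (2 * \<delta>) ^ 1" using \<delta> \<delta>0 q by (intro power_decreasing) auto
    also have "\<dots> \<le> 1 / (8 * C * A)" by (simp add: \<delta>_def)
    finally have "A * (2 * \<delta>) ^ q \<le> A * (1 / (8 * C * A))" using A by (intro mult_left_mono) auto
    also have "\<dots> = 1 / (8 * C)" using A by simp
    finally have "1 / (1 / (8 * C)) \<le> vd (2 * \<delta>)" unfolding vd_def
      using A \<delta> C by (intro divide_left_mono mult_pos_pos zero_less_power) auto
    then show ?thesis by simp
  qed
  have it: "(\<phi> ^^ n) y \<noteq> z0 \<and> norm (v ((\<phi> ^^ n) y)) \<ge> norm (v y) + real n / 8 \<and> (\<exists>j. (F ^^ j) ((\<phi> ^^ n) y) \<notin> ball z0 1)"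
    if y: "y \<in> ball z0 (2 * \<delta>)" and nt: "\<exists>j. (F ^^ j) y \<notin> ball z0 1" for y n
  proof (induction n)
    case 0
    have "y \<noteq> z0"
    proof
      assume "y = z0"
      moreover have "(F ^^ j) z0 = z0" for j by (induction j) (simp_all add: F)
      ultimately show False using nt by simp
    qed
    then show ?case using nt by simp
  next
    case (Suc n)
    define x where "x = (\<phi> ^^ n) y"
    obtain j where j: "(F ^^ j) x \<notin> ball z0 1" using Suc by (auto simp: x_def)
    have x: "x \<noteq> z0" "norm (v x) \<ge> norm (v y) + real n / 8" using Suc by (simp_all add: x_def)
    have "norm (v x) > vd (2 * \<delta>)"
    proof (cases "y = z0")
      case True
      have "(F ^^ j) z0 = z0" for j by (induction j) (simp_all add: F)
      then show ?thesis using nt True by simp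
    next
      case False
      then have "norm (v y) > vd (2 * \<delta>)" using y by (intro v_large) (auto simp: dist_norm norm_minus_commute)
      then show ?thesis using x(2) by (smt (verit) divide_nonneg_nonneg of_nat_0_le_iff)
    qed
    then have xb: "norm (x - z0) < 2 * \<delta>" and x8: "norm (v x) \<ge> 8 * C" using in_ball[OF _ x(1)] \<delta>(1) vd2 by auto
    have "norm (x - z0) < \<delta>0" using xb \<delta>(2) by simp
    note nx = near[OF x(1) this]
    have "Re (v x) + \<bar>Im (v x)\<bar> \<le> C" using trapped[OF x(1)] j by (meson not_le)
    then have "norm (v (\<phi> x)) \<ge> norm (v x) + 1 / 8"
      by (rule parabolic_drift[OF C(1) x8]) (use nx(2) in simp)
    moreover have "(F ^^ Suc j) (\<phi> x) \<notin> ball z0 1" using j nx(5) by (simp add: funpow_swap1)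
    then have "\<exists>j. (F ^^ j) (\<phi> x) \<notin> ball z0 1" by blast
    ultimately show ?case using nx(4) x(2) by (simp add: x_def field_simps)
  qed
  have lim: "x \<longlonglongrightarrow> z0" if x: "\<And>n. x n \<noteq> z0" "\<And>n. norm (v (x n)) \<ge> real n / 8" for x :: "nat \<Rightarrow> complex"
  proof (rule metric_LIMSEQ_I)
    fix \<eta> :: real assume \<eta>: "\<eta> > 0"
    define N where "N = nat \<lceil>8 * vd \<eta>\<rceil> + 1"
    have "dist (x n) z0 < \<eta>" if "n \<ge> N" for n
    proof -
      have "real n / 8 > vd \<eta>" using that unfolding N_def by linarith
      then have "norm (v (x n)) > vd \<eta>" using x(2)[of n] by linarith
      then show ?thesis using in_ball[OF _ x(1) \<eta>] by (simp add: dist_norm)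
    qed
    then show "\<exists>N. \<forall>n\<ge>N. dist (x n) z0 < \<eta>" by blast
  qed
  \<comment> \<open>By continuity of \<open>vd\<close>, enlarging the radius \<open>\<delta>\<close>
    slightly lowers \<open>norm v\<close> by at most \<open>1 / 8\<close>, the gain from one
    application of \<open>\<phi>\<close>.\<close>
  obtain \<epsilon> where \<epsilon>: "0 < \<epsilon>" "\<epsilon> \<le> 1" "vd ((1 + \<epsilon>) * \<delta>) + 1 / 8 \<ge> vd \<delta>"
  proof -
    have "((\<lambda>e. vd ((1 + e) * \<delta>)) \<longlongrightarrow> vd ((1 + 0) * \<delta>)) (at_right 0)"
      unfolding vd_def using A \<delta>(1) by (intro tendsto_intros) auto
    then have "\<forall>\<^sub>F e in at_right 0. vd ((1 + e) * \<delta>) > vd \<delta> - 1 / 8"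
      by (rule order_tendstoD) simp
    moreover have "\<forall>\<^sub>F e in at_right (0::real). e \<in> {0<..<1}" by (rule eventually_at_right_real) simp
    ultimately have "\<forall>\<^sub>F e in at_right 0. vd ((1 + e) * \<delta>) > vd \<delta> - 1 / 8 \<and> e \<in> {0<..<1}" by (rule eventually_conj)
    then obtain e where "vd ((1 + e) * \<delta>) > vd \<delta> - 1 / 8" "e \<in> {0<..<1}"
      using eventually_happens'[OF trivial_limit_at_right_real] by blast
    then show ?thesis using that by force
  qed
  have le2: "(1 + \<epsilon>) * \<delta> \<le> 2 * \<delta>" using \<epsilon> \<delta> by (intro mult_right_mono) auto
  have attr: "(\<forall>n\<ge>1. (\<phi> ^^ n) y \<in> cball z0 \<delta>) \<and> (\<lambda>n. (\<phi> ^^ n) y) \<longlonglongrightarrow> z0"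
    if y: "y \<in> ball z0 ((1 + \<epsilon>) * \<delta>)" and nt: "\<exists>j. (F ^^ j) y \<notin> ball z0 1" for y
  proof
    have y2: "y \<in> ball z0 (2 * \<delta>)" using y le2 by auto
    note ity = it[OF y2 nt]
    have ynz: "y \<noteq> z0" using ity[of 0] by simp
    show "(\<lambda>n. (\<phi> ^^ n) y) \<longlonglongrightarrow> z0"
    proof (rule lim)
      show "(\<phi> ^^ n) y \<noteq> z0" for n using ity by blast
      show "norm (v ((\<phi> ^^ n) y)) \<ge> real n / 8" for n using ity[of n] norm_ge_zero[of "v y"] by linarith
    qed
    show "\<forall>n\<ge>1. (\<phi> ^^ n) y \<in> cball z0 \<delta>"
    proof (intro allI impI)
      fix n :: nat assume n: "n \<ge> 1"
      have "norm (v y) > vd ((1 + \<epsilon>) * \<delta>)" using y ynz by (intro v_large) (auto simp: dist_norm norm_minus_commute)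
      moreover have "norm (v ((\<phi> ^^ n) y)) \<ge> norm (v y) + real n / 8" using ity by blast
      moreover have "real n / 8 \<ge> 1 / 8" using n by simp
      ultimately have "norm (v ((\<phi> ^^ n) y)) \<ge> vd \<delta>" using \<epsilon>(3) by linarith
      then show "(\<phi> ^^ n) y \<in> cball z0 \<delta>" using in_cball[of \<delta> "(\<phi> ^^ n) y"] ity[of n] \<delta>(1)
        by (simp add: dist_norm norm_minus_commute)
    qed
  qed
  have inv: "F (\<phi> x) = x" if "x \<in> ball z0 (2 * \<delta>)" for x using \<phi>(2)[of x] that \<delta>(2) \<delta>0(3) by auto
  have orbit: "\<exists>y x. y \<noteq> z0 \<and> x \<longlonglongrightarrow> z0 \<and> (\<forall>n. (F ^^ n) (x n) = y)"
  proof -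
    define T where "T = vd (2 * \<delta>) + 1"
    have T: "T > vd (2 * \<delta>)" "T > 0" using vd2 C by (auto simp: T_def)
    \<comment> \<open>A \<open>q\<close>-th root of \<open>c\<close> gives a point with
      \<open>v y = - T\<close>, in a repelling direction; from there each \<open>\<phi>\<close>
      moves \<open>v\<close> to the left by at least \<open>1 / 2\<close>.\<close>
    define c where "c = 1 / (of_nat q * a * of_real T)"
    have c: "c \<noteq> 0" using q a T by (simp add: c_def)
    define y where "y = z0 + exp (Ln c / of_nat q)"
    have "(y - z0) ^ q = c" using q c by (simp add: y_def flip: exp_of_nat_mult)
    then have vy: "v y = - of_real T" using q a T by (simp add: v_def c_def)
    have ynz: "y \<noteq> z0" by (simp add: y_def)
    have *: "(\<phi> ^^ n) y \<noteq> z0 \<and> Re (v ((\<phi> ^^ n) y)) \<le> - T - real n / 2 \<and> (F ^^ n) ((\<phi> ^^ n) y) = y" for n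
    proof (induction n)
      case (Suc n)
      define x where "x = (\<phi> ^^ n) y"
      have x: "x \<noteq> z0" "Re (v x) \<le> - T - real n / 2" "(F ^^ n) x = y" using Suc by (simp_all add: x_def)
      have "norm (v x) \<ge> T" using x(2) abs_Re_le_cmod[of "v x"] by (smt (verit) divide_nonneg_nonneg of_nat_0_le_iff)
      then have "norm (x - z0) < 2 * \<delta>" using T \<delta>(1) by (intro in_ball x(1)) auto
      then have "norm (x - z0) < \<delta>0" using \<delta>(2) by simp
      note nx = near[OF x(1) this]
      have "\<bar>Re (v (\<phi> x) - v x + 1)\<bar> < 1 / 8" using abs_Re_le_cmod nx(2) by (meson le_less_trans)
      then have "\<bar>Re (v (\<phi> x)) - Re (v x) + 1\<bar> < 1 / 8" by simp
      then have "Re (v (\<phi> x)) \<le> Re (v x) - 1 / 2" by linarith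
      then have "Re (v (\<phi> x)) \<le> - T - real (Suc n) / 2" using x(2) by (simp add: field_simps)
      moreover have "(F ^^ Suc n) (\<phi> x) = y" using nx(5) x(3) by (simp add: funpow_swap1)
      ultimately show ?case using nx(4) by (simp add: x_def)
    qed (use ynz vy in simp)
    have "(\<lambda>n. (\<phi> ^^ n) y) \<longlonglongrightarrow> z0"
    proof (rule lim)
      show "(\<phi> ^^ n) y \<noteq> z0" for n using * by blast
      show "norm (v ((\<phi> ^^ n) y)) \<ge> real n / 8" for n
        using *[of n] abs_Re_le_cmod[of "v ((\<phi> ^^ n) y)"] T(2) by linarith
    qed
    then show ?thesis using * ynz by blast
  qed
  have "continuous_on (ball z0 (2 * \<delta>)) \<phi>"
    using \<phi>(1) \<delta>(2) \<delta>0(3) by (meson continuous_on_subset holomorphic_on_imp_continuous_on subset_ball order_trans)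
  then show ?thesis
    unfolding local_exit_def using \<delta>(1,3) \<epsilon>(1,2) inv attr orbit by blast
qed

section \<open>The landing theorem\<close>

text \<open>Lift through one \<open>f\<close> at a time. Some iterate takes each intermediate value
  to \<open>exp x\<close>, outside \<open>P\<close>; by the first assumption on \<open>P\<close> the
  value itself is outside \<open>P\<close>, hence regular.\<close>

lemma lift_funpow:
  assumes f: "f holomorphic_on UNIV"
    and P: "\<And>x n. (f ^^ n) x \<notin> P \<Longrightarrow> x \<notin> P" and reg: "\<And>w. w \<notin> P \<Longrightarrow> regular_value f w"
    and V: "V holomorphic_on rhp \<rho>" "\<And>x. x \<in> rhp \<rho> \<Longrightarrow> (f ^^ j) (V x) = exp x" "\<And>x. x \<in> rhp \<rho> \<Longrightarrow> exp x \<notin> P"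
    and \<zeta>: "\<zeta> \<in> rhp \<rho>" and y: "(f ^^ q) y = V \<zeta>"
  shows "\<exists>W. W holomorphic_on rhp \<rho> \<and> W \<zeta> = y \<and> (\<forall>x\<in>rhp \<rho>. (f ^^ q) (W x) = V x)"
  using y
proof (induction q arbitrary: y)
  case 0
  then show ?case using V(1) by (intro exI[of _ V]) simp
next
  case (Suc q)
  have "(f ^^ q) (f y) = V \<zeta>" using Suc.prems by (simp add: funpow_swap1)
  from Suc.IH[OF this] obtain W1 where W1: "W1 holomorphic_on rhp \<rho>" "W1 \<zeta> = f y" "\<forall>x\<in>rhp \<rho>. (f ^^ q) (W1 x) = V x"
    by blast
  have "regular_value f (W1 x)" if "x \<in> rhp \<rho>" for x
  proof -
    have "(f ^^ (j + q)) (W1 x) = exp x" using W1(3) V(2) that by (simp add: funpow_add)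
    then show ?thesis using P[of "j + q" "W1 x"] V(3)[OF that] reg by simp
  qed
  then obtain W where W: "W holomorphic_on rhp \<rho>" "W \<zeta> = y" "\<forall>x\<in>rhp \<rho>. f (W x) = W1 x"
    using holomorphic_lift_rhp[OF f W1(1) _ \<zeta>, of y] W1(2) by auto
  then have "\<forall>x\<in>rhp \<rho>. (f ^^ Suc q) (W x) = V x" using W1(3) by (simp add: funpow_swap1)
  then show ?case using W by blast
qed

lemma escape_map_ex:
  assumes te: "transcendental_entire f" and gf: "geometrically_finite f" and fo: "finite_order f" and p: "p \<ge> 1"
  shows "\<exists>\<rho>0. \<forall>\<rho>\<ge>\<rho>0. \<exists>M. escape_map (f ^^ p) \<rho> M p"
proof -
  let ?P = "postsingular_set f"
  have f: "f holomorphic_on UNIV" and np: "\<not> (\<exists>q. \<forall>z. f z = poly q z)" using te by (auto simp: transcendental_entire_def)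
  obtain B where B: "\<forall>x\<in>?P. norm x \<le> B" using postsingular_bounded[OF te gf] unfolding bounded_iff ..
  then have "singular_set f \<subseteq> cball 0 B" using singular_subset_postsingular by fastforce
  then obtain M0 where M0: "\<And>M. M \<ge> M0 \<Longrightarrow> class_B f M" using class_B_ex[OF te] by blast
  have "\<exists>M. escape_map (f ^^ p) \<rho> M p" if \<rho>: "\<rho> \<ge> max M0 (max 0 (ln (max 1 B)))" for \<rho>
  proof -
    interpret class_B f \<rho> using M0 \<rho> by simp
    have \<rho>0: "0 \<le> \<rho>" using \<rho> unfolding max.bounded_iff by blast
    have "max 1 B = exp (ln (max 1 B))" by simp
    also have "\<dots> \<le> exp \<rho>" using \<rho> by (intro exp_le_cancel_iff[THEN iffD2]) simp
    finally have "max 1 B \<le> exp \<rho>" .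
    then have out: "exp x \<notin> ?P" if "x \<in> rhp \<rho>" for x
    proof -
      have "norm (exp x) > exp \<rho>" using that by simp
      then have "norm (exp x) > B" using \<open>max 1 B \<le> exp \<rho>\<close> by linarith
      then show ?thesis using B by (meson not_less)
    qed
    have P: "x \<notin> ?P" if "(f ^^ n) x \<notin> ?P" for x n
    proof
      assume x: "x \<in> ?P"
      have "(f ^^ n) x \<in> ?P" by (induction n) (use x postsingular_forward[OF f] in auto)
      then show False using that by simp
    qed
    have reg: "regular_value f w" if "w \<notin> ?P" for w
      using that singular_subset_postsingular by (intro regular_value_outside_singular) blast
    have F: "(f ^^ p) holomorphic_on UNIV" by (rule holomorphic_funpow[OF f])
    obtain D where D: "\<And>z. z \<in> cball 0 (exp (\<rho> + 1)) \<Longrightarrow> norm ((f ^^ p) z) \<le> D"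
      using entire_bounded_on_compact[OF F compact_cball] by blast
    define M where "M = max (\<rho> + 1) (ln (max 1 D))"
    have DM: "D \<le> exp M"
    proof -
      have "max 1 D = exp (ln (max 1 D))" by simp
      also have "\<dots> \<le> exp M" by (rule exp_le_cancel_iff[THEN iffD2]) (simp add: M_def)
      finally show ?thesis by simp
    qed
    have "escape_map (f ^^ p) \<rho> M p"
    proof
      show "(f ^^ p) holomorphic_on UNIV" by (rule F)
      show "\<exists>W. W holomorphic_on rhp \<rho> \<and> W \<zeta> = y \<and> (\<forall>x\<in>rhp \<rho>. (f ^^ p) (W x) = V x)"
        if "V holomorphic_on rhp \<rho>" "\<And>x. x \<in> rhp \<rho> \<Longrightarrow> ((f ^^ p) ^^ n) (V x) = exp x" "\<zeta> \<in> rhp \<rho>" "(f ^^ p) y = V \<zeta>" for V n \<zeta> y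
        by (rule lift_funpow[OF f P reg that(1) _ out that(3,4), where j = "p * n"]) (use that(2) in \<open>simp_all add: funpow_mult\<close>)
      show "inj_on W (rhp \<rho>)" if W: "W holomorphic_on rhp \<rho>" "\<And>x. x \<in> rhp \<rho> \<Longrightarrow> (f ^^ p) (W x) = exp x" for W
      proof -
        \<comment> \<open>\<open>f ^^ k\<close> after \<open>W\<close> is a lift of
          \<open>exp\<close> through \<open>f\<close> itself, hence injective, and so is
          \<open>W\<close>.\<close>
        obtain k where k: "p = Suc k" using p by (cases p) auto
        have "(\<lambda>x. (f ^^ k) (W x)) holomorphic_on rhp \<rho>"
          by (rule holomorphic_on_compose_gen[OF W(1) holomorphic_funpow[OF f], unfolded o_def]) simp
        then have "inj_on (\<lambda>x. (f ^^ k) (W x)) (rhp \<rho>)"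
          by (rule inj_on_exp_lift[OF f np]) (use W(2) k in simp)
        then show ?thesis by (auto simp: inj_on_def)
      qed
      show "p \<ge> 1" by (rule p)
      show "\<exists>D\<ge>1. \<exists>t0. \<forall>t\<ge>t0. Re (L (of_real (iter_exp p t))) \<ge> t / D \<and> norm (L (of_real (iter_exp p t))) \<le> D * t"
        if "L holomorphic_on rhp a" "\<And>x. x \<in> rhp a \<Longrightarrow> (f ^^ p) (exp (L x)) = exp x" for L a
        by (rule tract_log_growth[OF \<rho>0 fo that])
      show "\<exists>z. norm ((f ^^ p) z) > B" for B
      proof (rule ccontr)
        assume "\<not> ?thesis"
        then have "bounded (range (f ^^ p))" by (auto simp: bounded_iff not_less)
        then have "(f ^^ p) constant_on UNIV" using Liouville_theorem[OF F] by (auto simp: constant_on_def)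
        then show False using funpow_not_constant[OF f transcendental_not_constant[OF np]] by blast
      qed
      show "M \<ge> \<rho> + 1" by (simp add: M_def)
      show "norm ((f ^^ p) z) \<le> exp M" if "norm z \<le> exp (\<rho> + 1)" for z
        using D[of z] that DM by simp
    qed
    then show ?thesis by blast
  qed
  then show ?thesis by blast
qed

text \<open>Were the iterates bounded on a disc about \<open>z0\<close>, Cauchy estimates would make
  them uniformly Lipschitz near \<open>z0\<close>, forcing \<open>(F ^^ n) (x n)\<close> to tend to
  \<open>z0\<close> instead of staying at \<open>y\<close>.\<close>

lemma local_exit_unbounded:
  assumes F: "F holomorphic_on UNIV" "F z0 = z0" and r: "r > 0"
    and x: "y \<noteq> z0" "x \<longlonglongrightarrow> z0" "\<And>n. (F ^^ n) (x n) = y"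
  shows "\<exists>w\<in>ball z0 r. \<exists>n. norm ((F ^^ n) w) > B"
proof (rule ccontr)
  assume "\<not> ?thesis"
  then have bd: "norm ((F ^^ n) w) \<le> B" if "w \<in> ball z0 r" for w n using that by (meson not_less)
  define s where "s = r / 3"
  have s: "s > 0" using r by (simp add: s_def)
  have dv: "norm (deriv (F ^^ n) w) \<le> B / s" if "w \<in> ball z0 s" for w n
  proof -
    have sub: "cball w s \<subseteq> ball z0 r"
    proof
      fix u assume "u \<in> cball w s"
      then have "dist z0 u < s + s" using that dist_triangle[of z0 u w] by simp
      then show "u \<in> ball z0 r" using r by (simp add: s_def)
    qed
    have "norm ((deriv ^^ 1) (F ^^ n) w) \<le> fact 1 * B / s ^ 1"
    proof (rule Cauchy_inequality)
      show "(F ^^ n) holomorphic_on ball w s" "continuous_on (cball w s) (F ^^ n)"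
        using holomorphic_funpow[OF F(1), of n] by (auto intro: holomorphic_on_subset holomorphic_on_imp_continuous_on)
      show "norm ((F ^^ n) u) \<le> B" if "norm (w - u) = s" for u
        by (rule bd) (use sub that in \<open>auto simp: dist_norm\<close>)
    qed (rule s)
    then show ?thesis by simp
  qed
  have lip: "norm ((F ^^ n) w - (F ^^ n) z0) \<le> B / s * norm (w - z0)" if "w \<in> ball z0 s" for w n
  proof (rule field_differentiable_bound[of "ball z0 s" "F ^^ n" "deriv (F ^^ n)"])
    show "((F ^^ n) has_field_derivative deriv (F ^^ n) u) (at u within ball z0 s)" for u
      by (rule has_field_derivative_at_within[OF holomorphic_derivI[OF holomorphic_funpow[OF F(1)] open_UNIV UNIV_I]])
  qed (use dv that s in auto)
  have Fz: "(F ^^ n) z0 = z0" for n by (induction n) (simp_all add: F)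
  have "\<forall>\<^sub>F n in sequentially. x n \<in> ball z0 s" using x(2) s by (auto simp: tendsto_iff dist_commute)
  then have "\<forall>\<^sub>F n in sequentially. norm (y - z0) \<le> B / s * norm (x n - z0)"
  proof eventually_elim
    case (elim n)
    then show ?case using lip[of "x n" n] x(3)[of n] Fz[of n] by simp
  qed
  moreover have "(\<lambda>n. B / s * norm (x n - z0)) \<longlonglongrightarrow> B / s * norm (z0 - z0)"
    by (intro tendsto_intros x)
  ultimately have "norm (y - z0) \<le> B / s * norm (z0 - z0)"
    by (intro tendsto_lowerbound[of _ _ sequentially]) auto
  then show False using x(1) by simp
qed

lemma ray_at_local_exit:
  assumes te: "transcendental_entire f" and gf: "geometrically_finite f" and fo: "finite_order f" and p: "p \<ge> 1"
    and fixed: "(f ^^ p) z0 = z0" and le: "local_exit (f ^^ p) z0"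
  shows "\<exists>g. periodic_ray f g \<and> lands_at g z0"
proof -
  obtain \<rho>0 where \<rho>0: "\<And>\<rho>. \<rho> \<ge> \<rho>0 \<Longrightarrow> \<exists>M. escape_map (f ^^ p) \<rho> M p" using escape_map_ex[OF te gf fo p] by blast
  \<comment> \<open>The second entry puts \<open>ball z0 1\<close> inside the disc of radius
    \<open>exp \<rho>\<close>, so leaving the disc counts as an exit in the sense of
    \<open>local_exit\<close>.\<close>
  define \<rho> where "\<rho> = max \<rho>0 (ln (norm z0 + 1))"
  have "\<rho> \<ge> \<rho>0" by (simp add: \<rho>_def)
  then obtain M where em: "escape_map (f ^^ p) \<rho> M p" using \<rho>0 by blast
  interpret escape_map "f ^^ p" \<rho> M p by (rule em)
  have "norm z0 + 1 = exp (ln (norm z0 + 1))" by (subst exp_ln) (auto intro: add_nonneg_pos)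
  also have "\<dots> \<le> exp \<rho>" by (rule exp_le_cancel_iff[THEN iffD2]) (simp add: \<rho>_def)
  finally have z0\<rho>: "norm z0 + 1 \<le> exp \<rho>" .
  have out: "w \<notin> ball z0 1" if "norm w > exp \<rho>" for w
    using that z0\<rho> norm_triangle_sub[of w z0] by (auto simp: dist_norm norm_minus_commute)
  obtain \<phi> \<delta> \<epsilon> y x where l: "0 < \<delta>" "\<delta> \<le> 1 / 2" "0 < \<epsilon>" "\<epsilon> \<le> 1" "continuous_on (ball z0 (2 * \<delta>)) \<phi>"
    "\<And>x. x \<in> ball z0 (2 * \<delta>) \<Longrightarrow> (f ^^ p) (\<phi> x) = x"
    "\<And>y j. y \<in> ball z0 ((1 + \<epsilon>) * \<delta>) \<Longrightarrow> ((f ^^ p) ^^ j) y \<notin> ball z0 1 \<Longrightarrow>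
        (\<forall>n\<ge>1. (\<phi> ^^ n) y \<in> cball z0 \<delta>) \<and> (\<lambda>n. (\<phi> ^^ n) y) \<longlonglongrightarrow> z0"
    "y \<noteq> z0" "x \<longlonglongrightarrow> z0" "\<And>n. ((f ^^ p) ^^ n) (x n) = y"
    using le unfolding local_exit_def by blast
  have "exit_point (f ^^ p) \<rho> M p z0 \<phi> \<delta> \<epsilon>"
  proof (intro exit_point.intro exit_point_axioms.intro em)
    show "norm z0 + 2 * \<delta> \<le> exp \<rho>" using z0\<rho> l(2) by simp
    show "(\<phi> ^^ n) y \<in> cball z0 \<delta>"
      if "y \<in> ball z0 ((1 + \<epsilon>) * \<delta>)" "norm (((f ^^ p) ^^ j) y) > exp \<rho>" "n \<ge> 1" for y j n
      using l(7)[OF that(1) out[OF that(2)]] that(3) by blast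
    show "(\<lambda>n. (\<phi> ^^ n) y) \<longlonglongrightarrow> z0"
      if "y \<in> ball z0 ((1 + \<epsilon>) * \<delta>)" "norm (((f ^^ p) ^^ j) y) > exp \<rho>" for y j
      using l(7)[OF that(1) out[OF that(2)]] by blast
    show "\<exists>x\<in>ball z0 \<delta>. \<exists>n. norm (((f ^^ p) ^^ n) x) > B" for B
      by (rule local_exit_unbounded[OF hol fixed l(1) l(8-10)])
  qed (fact fixed l(1) l(3) l(4) l(5) l(6))+
  then obtain g where g: "periodic_ray (f ^^ p) g" "lands_at g z0" using exit_point.ray_exists by blast
  obtain n where n: "n \<ge> 1" "\<forall>t>0. g (2 * t) = ((f ^^ p) ^^ n) (g t)" using g(1) by (auto simp: periodic_ray_def)
  have "p * n \<ge> 1" using p n(1) by simp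
  moreover have "\<forall>t>0. g (2 * t) = (f ^^ (p * n)) (g t)" using n(2) by (simp add: funpow_mult)
  ultimately have "periodic_ray f g" using g(1) unfolding periodic_ray_def by blast
  then show ?thesis using g(2) by blast
qed

lemma deriv_funpow_fixed:
  assumes f: "f holomorphic_on UNIV" and z: "f z = z"
  shows "deriv (f ^^ k) z = deriv f z ^ k"
proof (induction k)
  case 0
  have "((\<lambda>x::complex. x) has_field_derivative 1) (at z)" by (rule DERIV_ident)
  then show ?case by (simp add: id_def DERIV_imp_deriv)
next
  case (Suc k)
  have "(f ^^ k) z = z" by (induction k) (simp_all add: z)
  then show ?case unfolding deriv_funpow_Suc[OF f] using Suc by simp
qed

theorem theorem1:
  fixes f :: "complex \<Rightarrow> complex"
  assumes "transcendental_entire f"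
    and "geometrically_finite f"
    and "finite_order f"
    and "repelling_periodic f z \<or> parabolic_periodic f z"
  shows "\<exists>g. periodic_ray f g \<and> lands_at g z"
  using assms(4)
proof
  have f: "f holomorphic_on UNIV" using assms(1) by (simp add: transcendental_entire_def)
  assume "repelling_periodic f z"
  then obtain n where n: "n \<ge> 1" "(f ^^ n) z = z" "norm (deriv (f ^^ n) z) > 1"
    by (auto simp: repelling_periodic_def minimal_period_def)
  then show ?thesis
    using ray_at_local_exit[OF assms(1-3) n(1,2)] local_exit_repelling[OF holomorphic_funpow[OF f]] by blast
next
  have f: "f holomorphic_on UNIV" using assms(1) by (simp add: transcendental_entire_def)
  assume "parabolic_periodic f z"
  then obtain n k where n: "n \<ge> 1" "(f ^^ n) z = z" and k: "k \<ge> 1" "deriv (f ^^ n) z ^ k = 1"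
    by (auto simp: parabolic_periodic_def minimal_period_def)
  \<comment> \<open>Passing to this multiple of the period makes the multiplier exactly 1.\<close>
  define p where "p = n * k"
  have p: "p \<ge> 1" using n k by (simp add: p_def)
  have Fp: "f ^^ p = (f ^^ n) ^^ k" by (simp add: p_def funpow_mult)
  have F: "(f ^^ p) holomorphic_on UNIV" by (rule holomorphic_funpow[OF f])
  have fixed: "(f ^^ p) z = z" unfolding Fp by (induction k) (simp_all add: n)
  have "deriv (f ^^ p) z = 1" using deriv_funpow_fixed[OF holomorphic_funpow[OF f] n(2)] k(2) by (simp add: Fp)
  \<comment> \<open>An escaping point is not fixed, so the iterate is not the identity and
    \<open>F z - z\<close> has a zero of finite order.\<close>
  moreover have "\<not> (\<forall>w. (f ^^ p) w = w)"
  proof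
    assume id: "\<forall>w. (f ^^ p) w = w"
    obtain \<rho> M where "escape_map (f ^^ p) \<rho> M p" using escape_map_ex[OF assms(1-3) p] by blast
    then obtain \<zeta> N where "\<forall>i\<ge>N. norm (((f ^^ p) ^^ i) (exp \<zeta>)) > norm (exp \<zeta>)"
      using escape_map.escaping_point by metis
    moreover have "((f ^^ p) ^^ i) w = w" for i w by (induction i) (simp_all add: id)
    ultimately show False by auto
  qed
  ultimately show ?thesis
    using ray_at_local_exit[OF assms(1-3) p fixed] local_exit_parabolic[OF F fixed] by blast
qed

end
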